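(* Let $N\in\mathbb{N}$ and $R>0$. (1) For every tracial state $\mu\in\mathcal{T}(\mathcal{A}_R^{(N)})$, $$\eta_R(\mu)=\inf\bigl\{\mu(h)+\pi_R(h):h\in(\mathcal{A}_R^{(N)})^{sa}\bigr\}.$$ Hence, $\eta_R(\mu)$ is concave and weakly* upper semicontinuous on $\mathcal{T}(\mathcal{A}_R^{(N)})$. (2) For every $h\in(\mathcal{A}_R^{(N)})^{sa}$, $$\pi_R(h)=\sup\bigl\{-\mu(h)+\eta_R(\mu):\mu\in\mathcal{T}(\mathcal{A}_R^{(N)})\bigr\}.$$
   Context: $M_n$ is the algebra of $n\times n$ complex matrices, $M_n^{sa}$ its selfadjoint part, $\mathrm{tr}_n$ the normalized trace, $\|\cdot\|$ the operator norm, $(M_n^{sa})_R:=\{A\in M_n^{sa}:\|A\|\le R\}$ and $(M_n^{sa})_R^N$ its $N$-fold Cartesian product. $\Lambda_n$ is the measure $d\Lambda_n(A):=2^{n(n-1)/2}\prod_{i=1}^n dA_{ii}\prod_{i<j}d(\mathrm{Re}\,A_{ij})\,d(\mathrm{Im}\,A_{ij})$ on $M_n^{sa}$, and $\Lambda_n^{\otimes N}$ is its $N$-fold product. $\mathbb{C}\langle X_1,\dots,X_N\rangle$ is the noncommutative polynomial $*$-algebra with $X_i^*=X_i$, and $\mathbb{C}\langle X_1,\dots,X_N\rangle^{sa}$ its selfadjoint part. For $R>0$ put $\|p\|_R:=\sup\{\|p(A_1,\dots,A_N)\|: A_i\in M_n^{sa},\ \|A_i\|\le R,\ n\in\mathbb{N}\}$,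 a $C^*$-norm, and let $\mathcal{A}_R^{(N)}$ be the corresponding $C^*$-completion (it is the $N$-fold full free product of $C([-R,R])$), with selfadjoint part $(\mathcal{A}_R^{(N)})^{sa}$. For selfadjoint $a_1,\dots,a_N\in B(\mathcal{H})$ with $\|a_i\|\le R$, the map $p\mapsto p(a_1,\dots,a_N)$ extends to a $*$-homomorphism $h\in\mathcal{A}_R^{(N)}\mapsto h(a_1,\dots,a_N)\in B(\mathcal{H})$. Free pressure: for $h\in(\mathcal{A}_R^{(N)})^{sa}$, $$\pi_R(h):=\limsup_{n\to\infty}\Bigl(\frac1{n^2}\log\int_{(M_n^{sa})_R^N}\exp\bigl(-n^2\mathrm{tr}_n(h(A_1,\dots,A_N))\bigr)\,d\Lambda_n^{\otimes N}(A_1,\dots,A_N)+\frac N2\log n\Bigr).$$ $\Sigma\langle X_1,\dots,X_N\rangle$ is the set of linear functionals $\mu$ on $\mathbb{C}\langle X_1,\dots,X_N\rangle$ with $\mu(p^* )=\overline{\mu(p)}$ and $\mu(\mathbf 1)=1$; for such $\mu$, $\eta_R(\mu):=\inf\{\mu(p)+\pi_R(p):p\in\mathbb{C}\langle X_1,\dots,X_N\rangle^{sa}\}\in[-\infty,\infty)$. $\mathcal{T}(\mathcal{A}_R^{(N)})$ is the set of tracial states on $\mathcal{A}_R^{(N)}$; a tracial state $\mu$ is identified with its restriction to $\mathbb{C}\langle X_1,\dots,X_N\rangle$, which lies in $\Sigma\langle X_1,\dots,X_N\rangle$, and $\eta_R(\mu)$ is defined by this restriction. *)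

theory Defs
  imports
    "HOL-Analysis.Analysis"
    "HOL-Library.Poly_Mapping"
    "Jordan_Normal_Form.Matrix"
    "Jordan_Normal_Form.Schur_Decomposition"
begin

section \<open>Noncommutative polynomials\<close>

text \<open>
  Words in the letters \<open>'v\<close> form the free monoid under concatenation, so that
  \<open>'v list \<Rightarrow>\<^sub>0 complex\<close>, with the convolution product of \<^theory>\<open>HOL-Library.Poly_Mapping\<close>,
  is the free unital complex algebra on the indeterminates indexed by \<open>'v\<close>. The finite type \<open>'v\<close>
  plays the role of the index set \<open>{1, \<dots>, N}\<close>, i.e. \<open>N = CARD('v)\<close>; constants are
  \<open>Poly_Mapping.single [] c\<close>.
\<close>

instantiation list :: (type) monoid_add
begin

definition zero_list_def: "0 = ([] :: 'a list)"
definition plus_list_def: "xs + ys = (xs @ ys :: 'a list)"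

instance
  by standard (simp_all add: zero_list_def plus_list_def)

end

type_synonym 'v ncpoly = "'v list \<Rightarrow>\<^sub>0 complex"

definition nc_scale :: "complex \<Rightarrow> 'v ncpoly \<Rightarrow> 'v ncpoly" where
  "nc_scale c p = Poly_Mapping.single [] c * p"

text \<open>The involution with \<open>X\<^sub>i\<^sup>* = X\<^sub>i\<close>: it reverses words and conjugates coefficients.\<close>

definition nc_star :: "'v ncpoly \<Rightarrow> 'v ncpoly" where
  "nc_star p = Poly_Mapping.map cnj (Poly_Mapping.map_key rev p)"

definition nc_sa :: "'v ncpoly set" where
  "nc_sa = {p. nc_star p = p}"


section \<open>Matrices\<close>

definition cvec_norm :: "complex vec \<Rightarrow> real" where
  "cvec_norm v = sqrt (Re (v \<bullet>c v))"

definition op_norm :: "complex mat \<Rightarrow> real" where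
  "op_norm A = (SUP v\<in>{v \<in> carrier_vec (dim_col A). cvec_norm v \<le> 1}. cvec_norm (A *\<^sub>v v))"

definition ntrace :: "nat \<Rightarrow> complex mat \<Rightarrow> complex" where
  "ntrace n A = (\<Sum>i<n. A $$ (i, i)) / of_nat n"

definition herm :: "nat \<Rightarrow> complex mat set" where
  "herm n = {A \<in> carrier_mat n n. mat_adjoint A = A}"

definition herm_ball :: "nat \<Rightarrow> real \<Rightarrow> complex mat set" where
  "herm_ball n R = {A \<in> herm n. op_norm A \<le> R}"

definition herm_tuples :: "nat \<Rightarrow> real \<Rightarrow> ('v \<Rightarrow> complex mat) set" where
  "herm_tuples n R = {A. \<forall>i. A i \<in> herm_ball n R}"

definition word_eval :: "nat \<Rightarrow> 'v list \<Rightarrow> ('v \<Rightarrow> complex mat) \<Rightarrow> complex mat" where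
  "word_eval n w A = foldr (\<lambda>i M. A i * M) w (1\<^sub>m n)"

text \<open>\<open>nc_eval n p A\<close> is \<open>p(A\<^sub>1, \<dots>, A\<^sub>N)\<close> for \<open>n \<times> n\<close> matrices \<open>A\<^sub>i\<close>. The sum over words is taken
  entrywise because \<^typ>\<open>complex mat\<close>, which contains matrices of all sizes, is not a monoid.\<close>

definition nc_eval :: "nat \<Rightarrow> 'v ncpoly \<Rightarrow> ('v \<Rightarrow> complex mat) \<Rightarrow> complex mat" where
  "nc_eval n p A = Matrix.mat n n (\<lambda>ij.
     \<Sum>w\<in>Poly_Mapping.keys p. Poly_Mapping.lookup p w * word_eval n w A $$ ij)"


section \<open>The measure on selfadjoint matrices\<close>

text \<open>The real coordinates \<open>x\<close> are the diagonal entries \<open>x(i,i)\<close> and, for \<open>i < j\<close>, the real part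
  \<open>x(i,j)\<close> and the imaginary part \<open>x(j,i)\<close> of the \<open>(i,j)\<close> entry.\<close>

definition herm_of_coords :: "nat \<Rightarrow> (nat \<times> nat \<Rightarrow> real) \<Rightarrow> complex mat" where
  "herm_of_coords n x = Matrix.mat n n (\<lambda>(i, j).
     if i = j then complex_of_real (x (i, i))
     else if i < j then Complex (x (i, j)) (x (j, i))
     else cnj (Complex (x (j, i)) (x (i, j))))"

definition herm_borel :: "nat \<Rightarrow> complex mat measure" where
  "herm_borel n = vimage_algebra (herm n)
     (\<lambda>A. \<lambda>ij\<in>{..<n} \<times> {..<n}. A $$ ij) (\<Pi>\<^sub>M ij\<in>{..<n} \<times> {..<n}. borel)"

definition Lambda :: "nat \<Rightarrow> complex mat measure" where
  "Lambda n = scale_measure (2 ^ (n * (n - 1) div 2))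
     (distr (\<Pi>\<^sub>M ij\<in>{..<n} \<times> {..<n}. lborel) (herm_borel n) (herm_of_coords n))"

definition Lambda_tensor :: "nat \<Rightarrow> ('v::finite \<Rightarrow> complex mat) measure" where
  "Lambda_tensor n = (\<Pi>\<^sub>M i\<in>UNIV. Lambda n)"


section \<open>The C*-algebra\<close>

text \<open>The index set of all matrix tuples \<open>(A\<^sub>1, \<dots>, A\<^sub>N)\<close> of all sizes \<open>n \<ge> 1\<close> over which the
  supremum defining \<open>\<parallel>p\<parallel>\<^sub>R\<close> is taken.\<close>

definition mat_points :: "real \<Rightarrow> (nat \<times> ('v \<Rightarrow> complex mat)) set" where
  "mat_points R = (SIGMA n:{1..}. herm_tuples n R)"

definition nc_norm :: "real \<Rightarrow> 'v ncpoly \<Rightarrow> real" where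
  "nc_norm R p = (SUP (n, A)\<in>mat_points R. op_norm (nc_eval n p A))"

definition nc_Cauchy :: "real \<Rightarrow> (nat \<Rightarrow> 'v ncpoly) \<Rightarrow> bool" where
  "nc_Cauchy R P \<longleftrightarrow> (\<forall>\<epsilon>>0. \<exists>M. \<forall>k\<ge>M. \<forall>l\<ge>M. nc_norm R (P k - P l) < \<epsilon>)"

text \<open>
  An element \<open>h\<close> of the completion is the class of a Cauchy sequence \<open>P\<close> of polynomials with respect
  to \<open>\<parallel>\<cdot>\<parallel>\<^sub>R\<close>, modulo null sequences. Since \<open>\<parallel>\<cdot>\<parallel>\<^sub>R\<close> is a supremum over matrix tuples, the class is
  determined by the family of its evaluations \<open>h(A\<^sub>1, \<dots>, A\<^sub>N) = lim\<^sub>k P\<^sub>k(A\<^sub>1, \<dots>, A\<^sub>N)\<close>, and it is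
  represented here by this family, \<open>h (n, A)\<close> being the evaluation of \<open>h\<close> at the \<open>n \<times> n\<close> matrices
  \<open>A\<close>. Equivalently (see \<open>calA_iff_uniform_limit\<close> below), the completion is the norm closure of the
  polynomials inside the bounded families of matrices, with the supremum norm and pointwise
  operations. Lemmas \<open>calA_norm_embed\<close>, \<open>nc_embed_mult\<close>, \<open>nc_embed_star\<close> and \<open>calA_complete\<close> show that
  \<open>nc_embed R\<close> is an isometric *-homomorphism into this complete algebra. Outside \<open>mat_points R\<close> the
  families are \<open>undefined\<close>.
\<close>

type_synonym 'v cstar_elem = "nat \<times> ('v \<Rightarrow> complex mat) \<Rightarrow> complex mat"

definition calA :: "real \<Rightarrow> 'v cstar_elem set" where
  "calA R = {h \<in> extensional (mat_points R). \<exists>P. nc_Cauchy R P \<and>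
     (\<forall>(n, A)\<in>mat_points R. h (n, A) \<in> carrier_mat n n \<and>
        (\<forall>i<n. \<forall>j<n. (\<lambda>k. nc_eval n (P k) A $$ (i, j)) \<longlonglongrightarrow> h (n, A) $$ (i, j)))}"

definition nc_embed :: "real \<Rightarrow> 'v ncpoly \<Rightarrow> 'v cstar_elem" where
  "nc_embed R p = (\<lambda>(n, A)\<in>mat_points R. nc_eval n p A)"

definition calA_norm :: "real \<Rightarrow> 'v cstar_elem \<Rightarrow> real" where
  "calA_norm R h = (SUP x\<in>mat_points R. op_norm (h x))"

definition calA_one :: "real \<Rightarrow> 'v cstar_elem" where
  "calA_one R = (\<lambda>(n, A)\<in>mat_points R. 1\<^sub>m n)"

definition calA_add :: "real \<Rightarrow> 'v cstar_elem \<Rightarrow> 'v cstar_elem \<Rightarrow> 'v cstar_elem" where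
  "calA_add R h k = (\<lambda>x\<in>mat_points R. h x + k x)"

definition calA_scale :: "real \<Rightarrow> complex \<Rightarrow> 'v cstar_elem \<Rightarrow> 'v cstar_elem" where
  "calA_scale R c h = (\<lambda>x\<in>mat_points R. c \<cdot>\<^sub>m h x)"

definition calA_mult :: "real \<Rightarrow> 'v cstar_elem \<Rightarrow> 'v cstar_elem \<Rightarrow> 'v cstar_elem" where
  "calA_mult R h k = (\<lambda>x\<in>mat_points R. h x * k x)"

definition calA_star :: "real \<Rightarrow> 'v cstar_elem \<Rightarrow> 'v cstar_elem" where
  "calA_star R h = (\<lambda>x\<in>mat_points R. mat_adjoint (h x))"

definition calA_sa :: "real \<Rightarrow> 'v cstar_elem set" where
  "calA_sa R = {h \<in> calA R. calA_star R h = h}"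


section \<open>Tracial states, free pressure and its Legendre transform\<close>

text \<open>Functionals on the algebra are extensional functions, so that they are determined by their
  values on \<open>calA R\<close>. In the positivity condition, \<open>0 \<le> z\<close> for complex \<open>z\<close> means that \<open>z\<close> is real
  and nonnegative.\<close>

definition tracial_states :: "real \<Rightarrow> ('v cstar_elem \<Rightarrow> complex) set" where
  "tracial_states R = {\<mu> \<in> extensional (calA R).
     (\<forall>h\<in>calA R. \<forall>k\<in>calA R. \<mu> (calA_add R h k) = \<mu> h + \<mu> k) \<and>
     (\<forall>c. \<forall>h\<in>calA R. \<mu> (calA_scale R c h) = c * \<mu> h) \<and>
     (\<forall>h\<in>calA R. 0 \<le> \<mu> (calA_mult R (calA_star R h) h)) \<and>
     \<mu> (calA_one R) = 1 \<and>
     (\<forall>h\<in>calA R. \<forall>k\<in>calA R. \<mu> (calA_mult R h k) = \<mu> (calA_mult R k h))}"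

text \<open>The weak* topology, i.e. the topology of pointwise convergence on \<open>calA R\<close>.\<close>

definition weak_star :: "real \<Rightarrow> ('v cstar_elem \<Rightarrow> complex) topology" where
  "weak_star R = subtopology (product_topology (\<lambda>_. euclidean) (calA R)) (tracial_states R)"

definition upper_semicontinuous_map :: "'a topology \<Rightarrow> ('a \<Rightarrow> ereal) \<Rightarrow> bool" where
  "upper_semicontinuous_map X f \<longleftrightarrow> (\<forall>c. openin X {x \<in> topspace X. f x < c})"

definition free_pressure :: "real \<Rightarrow> 'v::finite cstar_elem \<Rightarrow> ereal" where
  "free_pressure R h = limsup (\<lambda>n. ereal (
     1 / (real n)\<^sup>2 * ln (LINT A:herm_tuples n R|Lambda_tensor n.
                           exp (- ((real n)\<^sup>2 * Re (ntrace n (h (n, A))))))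
     + real CARD('v) / 2 * ln (real n)))"

definition Sigma_functionals :: "('v ncpoly \<Rightarrow> complex) set" where
  "Sigma_functionals = {\<mu>. (\<forall>p q. \<mu> (p + q) = \<mu> p + \<mu> q) \<and> (\<forall>c p. \<mu> (nc_scale c p) = c * \<mu> p) \<and>
     (\<forall>p. \<mu> (nc_star p) = cnj (\<mu> p)) \<and> \<mu> 1 = 1}"

text \<open>\<open>eta R \<mu>\<close> is meaningful for \<open>\<mu> \<in> Sigma_functionals\<close>; then \<open>\<mu> p\<close> is real for selfadjoint \<open>p\<close>.\<close>

definition eta :: "real \<Rightarrow> ('v::finite ncpoly \<Rightarrow> complex) \<Rightarrow> ereal" where
  "eta R \<mu> = (INF p\<in>nc_sa. ereal (Re (\<mu> p)) + free_pressure R (nc_embed R p))"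

definition nc_restrict :: "real \<Rightarrow> ('v cstar_elem \<Rightarrow> complex) \<Rightarrow> 'v ncpoly \<Rightarrow> complex" where
  "nc_restrict R \<mu> = (\<lambda>p. \<mu> (nc_embed R p))"

definition state_convex_comb ::
    "real \<Rightarrow> real \<Rightarrow> ('v cstar_elem \<Rightarrow> complex) \<Rightarrow> ('v cstar_elem \<Rightarrow> complex) \<Rightarrow> 'v cstar_elem \<Rightarrow> complex"
  where
  "state_convex_comb R t \<mu> \<nu> =
     (\<lambda>h\<in>calA R. complex_of_real t * \<mu> h + complex_of_real (1 - t) * \<nu> h)"


section \<open>Consistency of the definitions\<close>

subsection \<open>The operator norm\<close>

lemma cvec_norm_L2: "cvec_norm v = L2_set (\<lambda>i. cmod (vec_index v i)) {..<dim_vec v}"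
  unfolding cvec_norm_def L2_set_def scalar_prod_def
  by (simp add: complex_norm_square[symmetric] atLeast0LessThan complex_mult_cnj cmod_power2)

lemma cvec_norm_nonneg [simp]: "0 \<le> cvec_norm v"
  by (simp add: cvec_norm_L2)

lemma cvec_norm_zero [simp]: "cvec_norm (0\<^sub>v n) = 0"
  by (simp add: cvec_norm_L2 L2_set_def)

lemma cvec_norm_eq_0: "v \<in> carrier_vec n \<Longrightarrow> cvec_norm v = 0 \<longleftrightarrow> v = 0\<^sub>v n"
  by (auto simp: cvec_norm_L2 L2_set_eq_0_iff intro!: eq_vecI)

lemma cvec_norm_smult: "cvec_norm (c \<cdot>\<^sub>v v) = cmod c * cvec_norm v"
proof -
  have "cvec_norm (c \<cdot>\<^sub>v v) = L2_set (\<lambda>i. cmod c * cmod (vec_index v i)) {..<dim_vec v}"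
    by (auto simp: cvec_norm_L2 norm_mult intro!: L2_set_cong)
  then show ?thesis by (simp add: cvec_norm_L2 L2_set_right_distrib)
qed

lemma cvec_norm_add: "v \<in> carrier_vec n \<Longrightarrow> w \<in> carrier_vec n \<Longrightarrow> cvec_norm (v + w) \<le> cvec_norm v + cvec_norm w"
proof -
  assume v: "v \<in> carrier_vec n" and w: "w \<in> carrier_vec n"
  have "cvec_norm (v + w) = L2_set (\<lambda>i. cmod (vec_index v i + vec_index w i)) {..<n}"
    using v w by (auto simp: cvec_norm_L2 intro!: L2_set_cong)
  also have "\<dots> \<le> L2_set (\<lambda>i. cmod (vec_index v i) + cmod (vec_index w i)) {..<n}"
    by (intro L2_set_mono) (auto intro: norm_triangle_ineq)
  also have "\<dots> \<le> L2_set (\<lambda>i. cmod (vec_index v i)) {..<n} + L2_set (\<lambda>i. cmod (vec_index w i)) {..<n}"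
    by (rule L2_set_triangle_ineq)
  finally show ?thesis using v w by (simp add: cvec_norm_L2)
qed

lemma cvec_norm_index_le: "i < dim_vec v \<Longrightarrow> cmod (vec_index v i) \<le> cvec_norm v"
  unfolding cvec_norm_L2 by (rule member_le_L2_set) auto

lemma cvec_norm_unit_vec: "i < n \<Longrightarrow> cvec_norm (unit_vec n i) = 1"
proof -
  assume i: "i < n"
  have "(\<Sum>j<n. (cmod (vec_index (unit_vec n i) j))\<^sup>2) = (\<Sum>j<n. if j = i then 1 else 0)"
    using i by (intro sum.cong) (auto simp: unit_vec_def)
  then show ?thesis using i by (simp add: cvec_norm_L2 L2_set_def)
qed

lemma cvec_norm_mult_mat_le_entries:
  assumes "A \<in> carrier_mat m n" "v \<in> carrier_vec n"
  shows "cvec_norm (A *\<^sub>v v) \<le> (\<Sum>i<m. \<Sum>j<n. cmod (A $$ (i, j))) * cvec_norm v"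
proof -
  have "cvec_norm (A *\<^sub>v v) \<le> (\<Sum>i<m. cmod (vec_index (A *\<^sub>v v) i))"
    using assms L2_set_le_sum[of "{..<m}" "\<lambda>i. cmod (vec_index (A *\<^sub>v v) i)"]
    by (simp add: cvec_norm_L2 del: index_mult_mat_vec)
  also have "\<dots> \<le> (\<Sum>i<m. (\<Sum>j<n. cmod (A $$ (i, j))) * cvec_norm v)"
  proof (rule sum_mono)
    fix i assume "i \<in> {..<m}"
    then have "vec_index (A *\<^sub>v v) i = (\<Sum>j<n. A $$ (i, j) * vec_index v j)"
      using assms by (simp add: scalar_prod_def atLeast0LessThan)
    also have "cmod \<dots> \<le> (\<Sum>j<n. cmod (A $$ (i, j)) * cvec_norm v)"
      using assms by (intro sum_norm_le) (auto simp: norm_mult intro!: mult_left_mono cvec_norm_index_le)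
    finally show "cmod (vec_index (A *\<^sub>v v) i) \<le> (\<Sum>j<n. cmod (A $$ (i, j))) * cvec_norm v"
      by (simp add: sum_distrib_right)
  qed
  finally show ?thesis by (simp add: sum_distrib_right)
qed

lemma op_norm_bdd:
  assumes "A \<in> carrier_mat m n"
  shows "bdd_above ((\<lambda>v. cvec_norm (A *\<^sub>v v)) ` {v \<in> carrier_vec n. cvec_norm v \<le> 1})"
proof (rule bdd_aboveI2)
  fix v assume "v \<in> {v \<in> carrier_vec n. cvec_norm v \<le> 1}"
  then have "cvec_norm (A *\<^sub>v v) \<le> (\<Sum>i<m. \<Sum>j<n. cmod (A $$ (i, j))) * cvec_norm v"
    "cvec_norm v \<le> 1"
    using cvec_norm_mult_mat_le_entries[OF assms] by auto
  moreover have "(\<Sum>i<m. \<Sum>j<n. cmod (A $$ (i, j))) * cvec_norm v \<le> (\<Sum>i<m. \<Sum>j<n. cmod (A $$ (i, j))) * 1"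
    using \<open>cvec_norm v \<le> 1\<close> by (intro mult_left_mono sum_nonneg) auto
  ultimately show "cvec_norm (A *\<^sub>v v) \<le> (\<Sum>i<m. \<Sum>j<n. cmod (A $$ (i, j)))" by simp
qed

lemma op_norm_nonneg [simp]: "0 \<le> op_norm A"
proof -
  have "cvec_norm (A *\<^sub>v 0\<^sub>v (dim_col A)) \<le> op_norm A"
    unfolding op_norm_def by (rule cSUP_upper) (auto intro!: op_norm_bdd[of _ "dim_row A"])
  then show ?thesis using cvec_norm_nonneg order_trans by blast
qed

lemma op_norm_mult_vec:
  assumes A: "A \<in> carrier_mat m n" and v: "v \<in> carrier_vec n"
  shows "cvec_norm (A *\<^sub>v v) \<le> op_norm A * cvec_norm v"
proof (cases "cvec_norm v = 0")
  case True
  then show ?thesis using cvec_norm_mult_mat_le_entries[OF A v] by simp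
next
  case False
  then have pos: "cvec_norm v > 0" using cvec_norm_nonneg[of v] by linarith
  let ?c = "complex_of_real (1 / cvec_norm v)"
  have "cvec_norm (A *\<^sub>v (?c \<cdot>\<^sub>v v)) \<le> op_norm A"
    unfolding op_norm_def
    by (rule cSUP_upper) (use A v pos in \<open>auto simp: cvec_norm_smult norm_divide intro!: op_norm_bdd[OF A]\<close>)
  also have "A *\<^sub>v (?c \<cdot>\<^sub>v v) = ?c \<cdot>\<^sub>v (A *\<^sub>v v)"
    by (rule mult_mat_vec[OF A v])
  finally show ?thesis using pos by (simp add: cvec_norm_smult norm_divide field_simps)
qed

lemma op_norm_leI:
  assumes A: "A \<in> carrier_mat m n" and "0 \<le> K"
    and "\<And>v. v \<in> carrier_vec n \<Longrightarrow> cvec_norm (A *\<^sub>v v) \<le> K * cvec_norm v"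
  shows "op_norm A \<le> K"
  unfolding op_norm_def
proof (rule cSUP_least)
  show "{v \<in> carrier_vec (dim_col A). cvec_norm v \<le> 1} \<noteq> {}"
    using cvec_norm_zero[of "dim_col A"] by (metis (no_types, lifting) empty_iff mem_Collect_eq zero_carrier_vec zero_le_one)
  fix v assume "v \<in> {v \<in> carrier_vec (dim_col A). cvec_norm v \<le> 1}"
  then have "cvec_norm (A *\<^sub>v v) \<le> K * cvec_norm v" "cvec_norm v \<le> 1"
    using A assms by auto
  moreover from this have "K * cvec_norm v \<le> K * 1"
    by (intro mult_left_mono \<open>0 \<le> K\<close>)
  ultimately show "cvec_norm (A *\<^sub>v v) \<le> K" by simp
qed

lemma op_norm_le_entries:
  assumes A: "A \<in> carrier_mat m n"
  shows "op_norm A \<le> (\<Sum>i<m. \<Sum>j<n. cmod (A $$ (i, j)))"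
  by (rule op_norm_leI[OF A]) (auto intro!: sum_nonneg cvec_norm_mult_mat_le_entries[OF A])

lemma entry_le_op_norm:
  assumes A: "A \<in> carrier_mat m n" and "i < m" "j < n"
  shows "cmod (A $$ (i, j)) \<le> op_norm A"
proof -
  have "cmod (A $$ (i, j)) = cmod (vec_index (A *\<^sub>v unit_vec n j) i)"
    using assms by (simp add: scalar_prod_right_unit)
  also have "\<dots> \<le> cvec_norm (A *\<^sub>v unit_vec n j)"
    using assms by (intro cvec_norm_index_le) auto
  also have "\<dots> \<le> op_norm A"
    using op_norm_mult_vec[OF A, of "unit_vec n j"] assms by (simp add: cvec_norm_unit_vec)
  finally show ?thesis .
qed

lemma op_norm_add:
  assumes A: "A \<in> carrier_mat m n" and B: "B \<in> carrier_mat m n"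
  shows "op_norm (A + B) \<le> op_norm A + op_norm B"
proof (rule op_norm_leI)
  fix v :: "complex vec" assume v: "v \<in> carrier_vec n"
  have "cvec_norm ((A + B) *\<^sub>v v) \<le> cvec_norm (A *\<^sub>v v) + cvec_norm (B *\<^sub>v v)"
    using A B v by (simp add: add_mult_distrib_mat_vec[OF A B v] cvec_norm_add[of _ m])
  then show "cvec_norm ((A + B) *\<^sub>v v) \<le> (op_norm A + op_norm B) * cvec_norm v"
    using op_norm_mult_vec[OF A v] op_norm_mult_vec[OF B v] by (simp add: algebra_simps)
qed (use A B in auto)

lemma op_norm_mult:
  assumes A: "A \<in> carrier_mat m n" and B: "B \<in> carrier_mat n k"
  shows "op_norm (A * B) \<le> op_norm A * op_norm B"
proof (rule op_norm_leI)
  fix v :: "complex vec" assume v: "v \<in> carrier_vec k"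
  have "cvec_norm ((A * B) *\<^sub>v v) \<le> op_norm A * cvec_norm (B *\<^sub>v v)"
    using op_norm_mult_vec[OF A, of "B *\<^sub>v v"] A B v by (simp add: assoc_mult_mat_vec[OF A B v])
  also have "\<dots> \<le> op_norm A * (op_norm B * cvec_norm v)"
    by (intro mult_left_mono op_norm_mult_vec[OF B v]) auto
  finally show "cvec_norm ((A * B) *\<^sub>v v) \<le> op_norm A * op_norm B * cvec_norm v" by simp
qed (use A B in auto)

lemma op_norm_smult:
  assumes A: "A \<in> carrier_mat m n"
  shows "op_norm (c \<cdot>\<^sub>m A) \<le> cmod c * op_norm A"
proof (rule op_norm_leI)
  fix v :: "complex vec" assume v: "v \<in> carrier_vec n"
  have "(c \<cdot>\<^sub>m A) *\<^sub>v v = c \<cdot>\<^sub>v (A *\<^sub>v v)" using A v by auto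
  then show "cvec_norm ((c \<cdot>\<^sub>m A) *\<^sub>v v) \<le> cmod c * op_norm A * cvec_norm v"
    using op_norm_mult_vec[OF A v] by (simp add: cvec_norm_smult mult.assoc mult_left_mono)
qed (use A in auto)

lemma op_norm_one_le: "op_norm (1\<^sub>m n) \<le> 1"
  by (rule op_norm_leI) auto

subsection \<open>Polynomial evaluation is a *-homomorphism\<close>

lemma mat_adjoint_index:
  fixes A :: "complex mat"
  assumes "A \<in> carrier_mat m n" "i < n" "j < m"
  shows "mat_adjoint A $$ (i, j) = cnj (A $$ (j, i))"
  using assms by (auto simp: mat_adjoint_def mat_of_rows_def conjugate_vec_def)

lemma mat_adjoint_carrier:
  fixes A :: "complex mat"
  assumes "A \<in> carrier_mat m n"
  shows "mat_adjoint A \<in> carrier_mat n m"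
  using assms by (auto simp: mat_adjoint_def)

lemma herm_tuplesD:
  assumes "A \<in> herm_tuples n R"
  shows "A i \<in> carrier_mat n n" "mat_adjoint (A i) = A i" "op_norm (A i) \<le> R"
  using assms by (auto simp: herm_tuples_def herm_ball_def herm_def)

lemma word_eval_carrier:
  assumes "\<And>i. A i \<in> carrier_mat n n"
  shows "word_eval n w A \<in> carrier_mat n n"
  by (induction w) (simp_all add: word_eval_def mult_carrier_mat[OF assms])

lemma word_eval_append:
  assumes "\<And>i. A i \<in> carrier_mat n n"
  shows "word_eval n (u @ w) A = word_eval n u A * word_eval n w A"
proof (induction u)
  case Nil
  show ?case using left_mult_one_mat[OF word_eval_carrier[of A, OF assms], of w] by (simp add: word_eval_def)
next
  case (Cons a u)
  then show ?case
    using assoc_mult_mat[OF assms[of a] word_eval_carrier[of A, OF assms, of u] word_eval_carrier[of A, OF assms, of w]]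
    by (simp add: word_eval_def)
qed

lemma nc_eval_carrier [simp]: "nc_eval n p A \<in> carrier_mat n n"
  by (simp add: nc_eval_def)

lemma nc_eval_index:
  assumes "finite S" "Poly_Mapping.keys p \<subseteq> S" "i < n" "j < n"
  shows "nc_eval n p A $$ (i, j) = (\<Sum>w\<in>S. Poly_Mapping.lookup p w * word_eval n w A $$ (i, j))"
proof -
  have "nc_eval n p A $$ (i, j) = (\<Sum>w\<in>Poly_Mapping.keys p. Poly_Mapping.lookup p w * word_eval n w A $$ (i, j))"
    using assms by (simp add: nc_eval_def)
  also have "\<dots> = (\<Sum>w\<in>S. Poly_Mapping.lookup p w * word_eval n w A $$ (i, j))"
    using assms by (intro sum.mono_neutral_left) (auto simp: in_keys_iff)
  finally show ?thesis .
qed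

lemma nc_eval_add: "nc_eval n (p + q) A = nc_eval n p A + nc_eval n q A"
proof (rule eq_matI)
  fix i j assume ij: "i < dim_row (nc_eval n p A + nc_eval n q A)" "j < dim_col (nc_eval n p A + nc_eval n q A)"
  then have ij: "i < n" "j < n" by (auto simp: nc_eval_def)
  let ?S = "Poly_Mapping.keys p \<union> Poly_Mapping.keys q"
  have "Poly_Mapping.keys (p + q) \<subseteq> ?S" by (rule Poly_Mapping.keys_add)
  then show "nc_eval n (p + q) A $$ (i, j) = (nc_eval n p A + nc_eval n q A) $$ (i, j)"
    using ij nc_eval_carrier[of n p A] nc_eval_carrier[of n q A]
    by (simp add: nc_eval_index[of ?S] lookup_add distrib_right sum.distrib del: nc_eval_carrier)
qed (auto simp: nc_eval_def)

lemma nc_eval_zero: "nc_eval n 0 A = 0\<^sub>m n n"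
  by (rule eq_matI) (auto simp: nc_eval_def)

lemma nc_eval_single:
  assumes "word_eval n w A \<in> carrier_mat n n"
  shows "nc_eval n (Poly_Mapping.single w c) A = c \<cdot>\<^sub>m word_eval n w A"
  by (rule eq_matI) (use assms in \<open>auto simp: nc_eval_index[of "{w}"]\<close>, auto simp: nc_eval_def)

lemma ncpoly_induct [case_names zero single_add]:
  fixes p :: "'v ncpoly"
  assumes zero: "P 0" and add: "\<And>w c q. P q \<Longrightarrow> P (Poly_Mapping.single w c + q)"
  shows "P p"
proof (induction "card (Poly_Mapping.keys p)" arbitrary: p rule: less_induct)
  case less
  show ?case
  proof (cases "p = 0")
    case False
    then obtain w where w: "w \<in> Poly_Mapping.keys p" by fastforce
    define q where "q = p - Poly_Mapping.single w (Poly_Mapping.lookup p w)"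
    have "Poly_Mapping.keys q = Poly_Mapping.keys p - {w}"
      using w by (auto simp: q_def in_keys_iff lookup_minus lookup_single when_def split: if_splits)
    then have "card (Poly_Mapping.keys q) < card (Poly_Mapping.keys p)"
      using w by (metis card_Diff1_less finite_keys)
    then have "P (Poly_Mapping.single w (Poly_Mapping.lookup p w) + q)"
      by (intro add less)
    then show ?thesis by (simp add: q_def)
  qed (simp add: zero)
qed

lemma nc_eval_one:
  fixes A :: "'a \<Rightarrow> complex mat"
  shows "nc_eval n 1 A = 1\<^sub>m n"
proof -
  have "nc_eval n (Poly_Mapping.single [] 1) A = 1 \<cdot>\<^sub>m word_eval n [] A"
    by (rule nc_eval_single) (simp add: word_eval_def)
  moreover have "Poly_Mapping.single [] 1 = (1 :: 'a ncpoly)"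
    by (metis single_one zero_list_def)
  ultimately show ?thesis by (simp add: word_eval_def) (auto intro!: eq_matI)
qed

lemma nc_eval_minus: "nc_eval n (p - q) A = nc_eval n p A - nc_eval n q A"
proof -
  have "nc_eval n p A = nc_eval n (p - q) A + nc_eval n q A"
    by (simp flip: nc_eval_add)
  then show ?thesis
    using nc_eval_carrier[of n p A] nc_eval_carrier[of n q A] nc_eval_carrier[of n "p - q" A]
    by (intro eq_matI) (auto simp del: nc_eval_carrier)
qed

lemma nc_eval_single_mult:
  assumes A: "\<And>i. A i \<in> carrier_mat n n"
  shows "nc_eval n (Poly_Mapping.single u a * q) A = nc_eval n (Poly_Mapping.single u a) A * nc_eval n q A"
proof (induction q rule: ncpoly_induct)
  case zero
  then show ?case
    using right_mult_zero_mat[OF nc_eval_carrier[of n "Poly_Mapping.single u a" A], of n]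
    by (simp add: nc_eval_zero)
next
  case (single_add w c q)
  note W = word_eval_carrier[of A n, OF A]
  have "nc_eval n (Poly_Mapping.single u a * Poly_Mapping.single w c) A =
      (a * c) \<cdot>\<^sub>m (word_eval n u A * word_eval n w A)"
    by (simp add: mult_single plus_list_def nc_eval_single[OF W] word_eval_append[OF A])
  also have "\<dots> = nc_eval n (Poly_Mapping.single u a) A * nc_eval n (Poly_Mapping.single w c) A"
    using W[of u] W[of w]
    by (simp add: nc_eval_single[OF W] mult_smult_distrib[of _ n n _ n] mult_smult_assoc_mat[of _ n n _ n])
      (auto intro!: eq_matI)
  finally show ?case
    by (simp add: distrib_left nc_eval_add single_add
        mult_add_distrib_mat[OF nc_eval_carrier nc_eval_carrier nc_eval_carrier])
qed

lemma nc_eval_mult: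
  assumes A: "\<And>i. A i \<in> carrier_mat n n"
  shows "nc_eval n (p * q) A = nc_eval n p A * nc_eval n q A"
proof (induction p rule: ncpoly_induct)
  case zero
  then show ?case
    using left_mult_zero_mat[OF nc_eval_carrier[of n q A], of n] by (simp add: nc_eval_zero)
next
  case (single_add w c p)
  then show ?case
    by (simp add: distrib_right nc_eval_add nc_eval_single_mult[OF A]
        add_mult_distrib_mat[OF nc_eval_carrier nc_eval_carrier nc_eval_carrier])
qed

lemma nc_eval_scale:
  assumes A: "\<And>i. A i \<in> carrier_mat n n"
  shows "nc_eval n (nc_scale c p) A = c \<cdot>\<^sub>m nc_eval n p A"
proof -
  have "nc_eval n (Poly_Mapping.single [] c) A = c \<cdot>\<^sub>m 1\<^sub>m n"
    by (subst nc_eval_single) (simp_all add: word_eval_def)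
  then show ?thesis
    using nc_eval_carrier[of n p A]
    by (simp add: nc_scale_def nc_eval_mult[OF A] mult_smult_assoc_mat[of _ n n _ n] del: nc_eval_carrier)
qed

lemma inj_rev: "inj rev"
  by (auto intro: injI)

lemma lookup_nc_star: "Poly_Mapping.lookup (nc_star p) w = cnj (Poly_Mapping.lookup p (rev w))"
  by (simp add: nc_star_def Poly_Mapping.map.rep_eq map_key.rep_eq[OF inj_rev] when_def)

lemma nc_star_add: "nc_star (p + q) = nc_star p + nc_star q"
  by (rule poly_mapping_eqI) (simp add: lookup_nc_star lookup_add)

lemma nc_star_single: "nc_star (Poly_Mapping.single w c) = Poly_Mapping.single (rev w) (cnj c)"
  by (rule poly_mapping_eqI) (auto simp: lookup_nc_star lookup_single when_def)

lemma nc_star_star: "nc_star (nc_star p) = p"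
  by (rule poly_mapping_eqI) (simp add: lookup_nc_star)

lemma mat_adjoint_mult:
  fixes A B :: "complex mat"
  assumes A: "A \<in> carrier_mat m n" and B: "B \<in> carrier_mat n k"
  shows "mat_adjoint (A * B) = mat_adjoint B * mat_adjoint A"
proof (rule eq_matI)
  note C = mat_adjoint_carrier[OF A] mat_adjoint_carrier[OF B] mat_adjoint_carrier[OF mult_carrier_mat[OF A B]]
  show "dim_row (mat_adjoint (A * B)) = dim_row (mat_adjoint B * mat_adjoint A)"
       "dim_col (mat_adjoint (A * B)) = dim_col (mat_adjoint B * mat_adjoint A)"
    using C by auto
  fix i j assume "i < dim_row (mat_adjoint B * mat_adjoint A)" "j < dim_col (mat_adjoint B * mat_adjoint A)"
  then have ij: "i < k" "j < m" using C by auto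
  have "mat_adjoint (A * B) $$ (i, j) = cnj (\<Sum>l<n. A $$ (j, l) * B $$ (l, i))"
    using ij A B by (simp add: mat_adjoint_index[of _ m k] scalar_prod_def atLeast0LessThan)
  also have "\<dots> = (\<Sum>l<n. mat_adjoint B $$ (i, l) * mat_adjoint A $$ (l, j))"
    using ij by (simp add: mat_adjoint_index[OF A] mat_adjoint_index[OF B] mult.commute)
  also have "\<dots> = (mat_adjoint B * mat_adjoint A) $$ (i, j)"
    using ij C by (simp add: scalar_prod_def atLeast0LessThan)
  finally show "mat_adjoint (A * B) $$ (i, j) = (mat_adjoint B * mat_adjoint A) $$ (i, j)" .
qed

lemma mat_adjoint_add:
  fixes A B :: "complex mat"
  assumes A: "A \<in> carrier_mat m n" and B: "B \<in> carrier_mat m n"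
  shows "mat_adjoint (A + B) = mat_adjoint A + mat_adjoint B"
  using mat_adjoint_carrier[OF A] mat_adjoint_carrier[OF B] mat_adjoint_carrier[OF add_carrier_mat[OF B, of A]] A B
  by (intro eq_matI) (auto simp: mat_adjoint_index[of _ m n])

lemma mat_adjoint_smult:
  fixes A :: "complex mat"
  assumes A: "A \<in> carrier_mat m n"
  shows "mat_adjoint (c \<cdot>\<^sub>m A) = cnj c \<cdot>\<^sub>m mat_adjoint A"
  using mat_adjoint_carrier[OF A] mat_adjoint_carrier[OF smult_carrier_mat[OF A, of c]] A
  by (intro eq_matI) (auto simp: mat_adjoint_index[of _ m n])

lemma mat_adjoint_one: "mat_adjoint (1\<^sub>m n :: complex mat) = 1\<^sub>m n"
  using mat_adjoint_carrier[OF one_carrier_mat[of n]]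
  by (intro eq_matI) (auto simp: mat_adjoint_index[OF one_carrier_mat])

lemma word_eval_adjoint:
  assumes A: "A \<in> herm_tuples n R"
  shows "mat_adjoint (word_eval n w A) = word_eval n (rev w) A"
proof (induction w)
  case Nil
  then show ?case by (simp add: word_eval_def mat_adjoint_one)
next
  case (Cons a w)
  note C = herm_tuplesD(1)[OF A]
  have "mat_adjoint (word_eval n (a # w) A) = mat_adjoint (A a * word_eval n w A)"
    by (simp add: word_eval_def)
  also have "\<dots> = word_eval n (rev w) A * A a"
    by (simp add: mat_adjoint_mult[OF C word_eval_carrier[of A, OF C]] Cons herm_tuplesD(2)[OF A])
  also have "\<dots> = word_eval n (rev (a # w)) A"
    using C[of a] by (simp add: word_eval_append[OF C], simp add: word_eval_def)
  finally show ?case .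
qed

lemma nc_eval_star:
  assumes A: "A \<in> herm_tuples n R"
  shows "nc_eval n (nc_star p) A = mat_adjoint (nc_eval n p A)"
proof (induction p rule: ncpoly_induct)
  case zero
  have "nc_star 0 = (0 :: 'a ncpoly)" by (rule poly_mapping_eqI) (simp add: lookup_nc_star)
  then show ?case
    using mat_adjoint_carrier[OF zero_carrier_mat[of n n]]
    by (auto simp: nc_eval_zero mat_adjoint_index[of _ n n] intro!: eq_matI)
next
  case (single_add w c p)
  note W = word_eval_carrier[of A n, OF herm_tuplesD(1)[OF A]]
  show ?case
    by (simp add: nc_star_add nc_eval_add nc_star_single single_add nc_eval_single[OF W]
        mat_adjoint_add[OF smult_carrier_mat[OF W] nc_eval_carrier] mat_adjoint_smult[OF W] word_eval_adjoint[OF A])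
qed

subsection \<open>The supremum norm on polynomials\<close>

lemma op_norm_word_eval:
  assumes A: "A \<in> herm_tuples n R"
  shows "op_norm (word_eval n w A) \<le> R ^ length w"
proof (induction w)
  case Nil
  then show ?case by (simp add: word_eval_def op_norm_one_le)
next
  case (Cons a w)
  note C = herm_tuplesD(1)[OF A]
  have "0 \<le> R" using herm_tuplesD(3)[OF A, of a] op_norm_nonneg[of "A a"] by linarith
  have "op_norm (word_eval n (a # w) A) \<le> op_norm (A a) * op_norm (word_eval n w A)"
    using op_norm_mult[OF C word_eval_carrier[of A, OF C]] by (simp add: word_eval_def)
  also have "\<dots> \<le> R * R ^ length w"
    by (intro mult_mono herm_tuplesD(3)[OF A] Cons \<open>0 \<le> R\<close>) auto
  finally show ?case by simp
qed

lemma nc_eval_bounded: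
  fixes p :: "'a ncpoly"
  shows "\<exists>K. \<forall>(n, A)\<in>mat_points R. op_norm (nc_eval n p A) \<le> K"
proof (induction p rule: ncpoly_induct)
  case zero
  have "op_norm (0\<^sub>m n n) \<le> 0" for n
    using op_norm_le_entries[of "0\<^sub>m n n" n n] by simp
  then show ?case by (auto simp: nc_eval_zero intro!: exI[of _ 0])
next
  case (single_add w c p)
  then obtain K where K: "\<And>n A. (n, A) \<in> mat_points R \<Longrightarrow> op_norm (nc_eval n p A) \<le> K" by blast
  show ?case
  proof (intro exI ballI, clarify)
    fix n and A :: "'a \<Rightarrow> complex mat" assume nA: "(n, A) \<in> mat_points R"
    then have A: "A \<in> herm_tuples n R" by (simp add: mat_points_def)
    note W = word_eval_carrier[of A n, OF herm_tuplesD(1)[OF A]]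
    have "op_norm (nc_eval n (Poly_Mapping.single w c + p) A) \<le>
        op_norm (c \<cdot>\<^sub>m word_eval n w A) + op_norm (nc_eval n p A)"
      by (simp add: nc_eval_add nc_eval_single[OF W] op_norm_add[OF smult_carrier_mat[OF W] nc_eval_carrier])
    also have "\<dots> \<le> cmod c * R ^ length w + K"
      by (intro add_mono K nA order_trans[OF op_norm_smult[OF W]] mult_left_mono op_norm_word_eval[OF A]) auto
    finally show "op_norm (nc_eval n (Poly_Mapping.single w c + p) A) \<le> cmod c * R ^ length w + K" .
  qed
qed

lemma nc_norm_upper:
  assumes "(n, A) \<in> mat_points R"
  shows "op_norm (nc_eval n p A) \<le> nc_norm R p"
proof -
  obtain K where "\<forall>(n, A)\<in>mat_points R. op_norm (nc_eval n p A) \<le> K" using nc_eval_bounded by blast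
  then have "bdd_above ((\<lambda>(n, A). op_norm (nc_eval n p A)) ` mat_points R)"
    by (intro bdd_aboveI2[of _ _ K]) auto
  then show ?thesis
    unfolding nc_norm_def using cSUP_upper[OF assms] by fastforce
qed

lemma mat_points_nonempty: "0 \<le> R \<Longrightarrow> (1, \<lambda>_. 0\<^sub>m 1 1) \<in> mat_points R"
proof -
  assume R: "0 \<le> R"
  have "mat_adjoint (0\<^sub>m 1 1 :: complex mat) = 0\<^sub>m 1 1"
    using mat_adjoint_carrier[OF zero_carrier_mat[of 1 1]]
    by (intro eq_matI) (auto simp: mat_adjoint_index[of _ 1 1])
  moreover have "op_norm (0\<^sub>m 1 1) \<le> R"
    using op_norm_le_entries[of "0\<^sub>m 1 1" 1 1] R by simp
  ultimately show ?thesis by (simp add: mat_points_def herm_tuples_def herm_ball_def herm_def)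
qed

lemma nc_norm_least:
  assumes "0 \<le> R" "\<And>n A. (n, A) \<in> mat_points R \<Longrightarrow> op_norm (nc_eval n p A) \<le> K"
  shows "nc_norm R p \<le> K"
  unfolding nc_norm_def using mat_points_nonempty[OF assms(1)] assms(2)
  by (intro cSUP_least) auto


subsection \<open>\<open>calA R\<close> is the completion\<close>

lemma op_norm_diff_triangle:
  assumes "A \<in> carrier_mat m n" "B \<in> carrier_mat m n" "C \<in> carrier_mat m n"
  shows "op_norm (A - C) \<le> op_norm (A - B) + op_norm (B - C)"
proof -
  have "A - C = (A - B) + (B - C)" using assms by (intro eq_matI) auto
  then show ?thesis using op_norm_add[of "A - B" m n "B - C"] assms by (simp add: minus_carrier_mat)
qed

lemma op_norm_minus_commute:
  assumes "A \<in> carrier_mat m n" "B \<in> carrier_mat m n"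
  shows "op_norm (A - B) = op_norm (B - A)"
proof -
  have le: "op_norm (A - B) \<le> op_norm (B - A)"
    if "A \<in> carrier_mat m n" "B \<in> carrier_mat m n" for A B
  proof -
    have "A - B = (-1) \<cdot>\<^sub>m (B - A)" using that by (intro eq_matI) auto
    then show ?thesis using op_norm_smult[OF minus_carrier_mat[OF that(1), of B], of "-1"] by simp
  qed
  show ?thesis using le[OF assms] le[OF assms(2,1)] by simp
qed

lemma op_norm_limit_le:
  assumes X: "\<And>k. X k \<in> carrier_mat m n" and L: "L \<in> carrier_mat m n" and B: "B \<in> carrier_mat m n"
    and lim: "\<And>i j. i < m \<Longrightarrow> j < n \<Longrightarrow> (\<lambda>k. X k $$ (i, j)) \<longlonglongrightarrow> L $$ (i, j)"
    and le: "\<And>k. k \<ge> M \<Longrightarrow> op_norm (X k - B) \<le> K"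
  shows "op_norm (L - B) \<le> K"
proof (rule LIMSEQ_le_const)
  let ?f = "\<lambda>k. (\<Sum>i<m. \<Sum>j<n. cmod (L $$ (i, j) - X k $$ (i, j))) + K"
  have "(\<lambda>k. \<Sum>i<m. \<Sum>j<n. cmod (L $$ (i, j) - X k $$ (i, j))) \<longlonglongrightarrow>
      (\<Sum>i<m. \<Sum>j<n. cmod (L $$ (i, j) - L $$ (i, j)))"
    by (intro tendsto_sum tendsto_norm tendsto_diff tendsto_const lim) auto
  from tendsto_add[OF this tendsto_const[of K]] show "?f \<longlonglongrightarrow> K" by simp
  have "op_norm (L - B) \<le> ?f k" if "k \<ge> M" for k
  proof -
    have "op_norm (L - B) \<le> op_norm (L - X k) + op_norm (X k - B)"
      by (rule op_norm_diff_triangle[OF L X B])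
    also have "op_norm (L - X k) \<le> (\<Sum>i<m. \<Sum>j<n. cmod ((L - X k) $$ (i, j)))"
      by (intro op_norm_le_entries minus_carrier_mat X)
    also have "\<dots> = (\<Sum>i<m. \<Sum>j<n. cmod (L $$ (i, j) - X k $$ (i, j)))"
      using X[of k] L by (intro sum.cong refl) auto
    finally show ?thesis using le[OF that] by linarith
  qed
  then show "\<exists>N. \<forall>k\<ge>N. op_norm (L - B) \<le> ?f k" by blast
qed

lemma calA_carrier: "h \<in> calA R \<Longrightarrow> (n, A) \<in> mat_points R \<Longrightarrow> h (n, A) \<in> carrier_mat n n"
  by (auto simp: calA_def)

lemma uniform_Cauchy_limit:
  fixes P :: "nat \<Rightarrow> 'v ncpoly"
  assumes R: "0 \<le> R" and P: "nc_Cauchy R P"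
  obtains h where "h \<in> calA R"
    "\<And>n A i j. (n, A) \<in> mat_points R \<Longrightarrow> i < n \<Longrightarrow> j < n \<Longrightarrow>
        (\<lambda>k. nc_eval n (P k) A $$ (i, j)) \<longlonglongrightarrow> h (n, A) $$ (i, j)"
proof -
  define h :: "'v cstar_elem" where
    "h = (\<lambda>(n, A)\<in>mat_points R. Matrix.mat n n (\<lambda>ij. lim (\<lambda>k. nc_eval n (P k) A $$ ij)))"
  have lim: "(\<lambda>k. nc_eval n (P k) A $$ (i, j)) \<longlonglongrightarrow> h (n, A) $$ (i, j)"
    if nA: "(n, A) \<in> mat_points R" and ij: "i < n" "j < n" for n A i j
  proof -
    have "Cauchy (\<lambda>k. nc_eval n (P k) A $$ (i, j))"
    proof (rule metric_CauchyI)
      fix \<epsilon> :: real assume "0 < \<epsilon>"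
      then obtain M where M: "\<forall>k\<ge>M. \<forall>l\<ge>M. nc_norm R (P k - P l) < \<epsilon>"
        using P unfolding nc_Cauchy_def by blast
      have "dist (nc_eval n (P k) A $$ (i, j)) (nc_eval n (P l) A $$ (i, j)) < \<epsilon>" if "k \<ge> M" "l \<ge> M" for k l
      proof -
        have "dist (nc_eval n (P k) A $$ (i, j)) (nc_eval n (P l) A $$ (i, j)) = cmod (nc_eval n (P k - P l) A $$ (i, j))"
          using ij nc_eval_carrier[of n "P k" A] nc_eval_carrier[of n "P l" A]
          by (simp add: dist_norm nc_eval_minus del: nc_eval_carrier)
        also have "\<dots> \<le> nc_norm R (P k - P l)"
          using entry_le_op_norm[OF nc_eval_carrier ij] nc_norm_upper[OF nA] order_trans by blast
        also have "\<dots> < \<epsilon>" using M that by blast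
        finally show ?thesis .
      qed
      then show "\<exists>M. \<forall>k\<ge>M. \<forall>l\<ge>M. dist (nc_eval n (P k) A $$ (i, j)) (nc_eval n (P l) A $$ (i, j)) < \<epsilon>" by blast
    qed
    then show ?thesis using nA ij by (simp add: h_def Cauchy_convergent_iff convergent_LIMSEQ_iff)
  qed
  have "h \<in> calA R"
    unfolding calA_def
  proof (safe intro!: exI[of _ P])
    show "h \<in> extensional (mat_points R)" by (simp add: h_def)
  qed (use P lim in \<open>auto simp: h_def\<close>)
  with lim show thesis using that by blast
qed

text \<open>The completion is the norm closure of the polynomials: polynomials are dense in \<open>calA R\<close>, and
  every uniform limit of polynomials belongs to it.\<close>

lemma calA_iff_uniform_limit:
  fixes h :: "'a cstar_elem"
  assumes R: "0 \<le> R"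
  shows "h \<in> calA R \<longleftrightarrow> h \<in> extensional (mat_points R) \<and>
     (\<forall>(n, A)\<in>mat_points R. h (n, A) \<in> carrier_mat n n) \<and>
     (\<forall>\<epsilon>>0. \<exists>p. \<forall>(n, A)\<in>mat_points R. op_norm (h (n, A) - nc_eval n p A) \<le> \<epsilon>)" (is "_ \<longleftrightarrow> ?rhs")
proof
  assume h: "h \<in> calA R"
  then obtain P where P: "nc_Cauchy R P" and lim: "\<And>n A i j. (n, A) \<in> mat_points R \<Longrightarrow> i < n \<Longrightarrow> j < n \<Longrightarrow>
        (\<lambda>k. nc_eval n (P k) A $$ (i, j)) \<longlonglongrightarrow> h (n, A) $$ (i, j)"
    unfolding calA_def by blast
  have "\<exists>p. \<forall>(n, A)\<in>mat_points R. op_norm (h (n, A) - nc_eval n p A) \<le> \<epsilon>" if "\<epsilon> > 0" for \<epsilon> :: real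
  proof -
    obtain M where M: "\<forall>k\<ge>M. \<forall>l\<ge>M. nc_norm R (P k - P l) < \<epsilon>"
      using P \<open>\<epsilon> > 0\<close> unfolding nc_Cauchy_def by blast
    have "op_norm (h (n, A) - nc_eval n (P M) A) \<le> \<epsilon>" if nA: "(n, A) \<in> mat_points R" for n A
    proof (rule op_norm_limit_le[where X = "\<lambda>k. nc_eval n (P k) A" and M = M])
      fix k assume "M \<le> k"
      then have "nc_norm R (P k - P M) < \<epsilon>" using M by blast
      with nc_norm_upper[OF nA, of "P k - P M"]
      show "op_norm (nc_eval n (P k) A - nc_eval n (P M) A) \<le> \<epsilon>" by (simp add: nc_eval_minus)
    qed (use calA_carrier[OF h nA] lim[OF nA] in auto)
    then show ?thesis by blast
  qed
  then show ?rhs using h calA_carrier[OF h] by (auto simp: calA_def)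
next
  assume rhs: ?rhs
  then have "\<exists>p. \<forall>(n, A)\<in>mat_points R. op_norm (h (n, A) - nc_eval n p A) \<le> 1 / real (Suc k)" for k
    by simp
  then obtain P where P: "\<And>k n A. (n, A) \<in> mat_points R \<Longrightarrow> op_norm (h (n, A) - nc_eval n (P k) A) \<le> 1 / real (Suc k)"
    by (metis (no_types, lifting) case_prodD)
  have C: "h (n, A) \<in> carrier_mat n n" if "(n, A) \<in> mat_points R" for n A using rhs that by blast
  have "nc_Cauchy R P"
    unfolding nc_Cauchy_def
  proof safe
    fix \<epsilon> :: real assume "0 < \<epsilon>"
    then obtain M where M: "2 / real (Suc M) < \<epsilon>"
      using reals_Archimedean[of "\<epsilon> / 2"] by (auto simp: inverse_eq_divide field_simps)
    have "nc_norm R (P k - P l) < \<epsilon>" if "k \<ge> M" "l \<ge> M" for k l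
    proof -
      have "nc_norm R (P k - P l) \<le> 1 / real (Suc k) + 1 / real (Suc l)"
      proof (rule nc_norm_least[OF R])
        fix n and A :: "'a \<Rightarrow> complex mat" assume nA: "(n, A) \<in> mat_points R"
        show "op_norm (nc_eval n (P k - P l) A) \<le> 1 / real (Suc k) + 1 / real (Suc l)"
          using op_norm_diff_triangle[OF nc_eval_carrier[of n "P k" A] C[OF nA] nc_eval_carrier[of n "P l" A]]
            P[OF nA, of k] P[OF nA, of l] op_norm_minus_commute[OF C[OF nA] nc_eval_carrier[of n "P k" A]]
          by (simp add: nc_eval_minus)
      qed
      also have "\<dots> \<le> 1 / real (Suc M) + 1 / real (Suc M)"
        using that by (intro add_mono divide_left_mono) auto
      also have "\<dots> < \<epsilon>" using M by simp
      finally show ?thesis .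
    qed
    then show "\<exists>M. \<forall>k\<ge>M. \<forall>l\<ge>M. nc_norm R (P k - P l) < \<epsilon>" by blast
  qed
  moreover have "(\<lambda>k. nc_eval n (P k) A $$ (i, j)) \<longlonglongrightarrow> h (n, A) $$ (i, j)"
    if nA: "(n, A) \<in> mat_points R" and ij: "i < n" "j < n" for n A i j
  proof (rule LIMSEQ_I)
    fix \<epsilon> :: real assume "0 < \<epsilon>"
    then obtain M where M: "1 / real (Suc M) < \<epsilon>"
      using reals_Archimedean[of \<epsilon>] by (auto simp: inverse_eq_divide)
    have "cmod (nc_eval n (P k) A $$ (i, j) - h (n, A) $$ (i, j)) < \<epsilon>" if "k \<ge> M" for k
    proof -
      have "cmod (nc_eval n (P k) A $$ (i, j) - h (n, A) $$ (i, j)) = cmod ((h (n, A) - nc_eval n (P k) A) $$ (i, j))"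
        using ij C[OF nA] nc_eval_carrier[of n "P k" A] by (simp add: norm_minus_commute del: nc_eval_carrier)
      also have "\<dots> \<le> op_norm (h (n, A) - nc_eval n (P k) A)"
        by (rule entry_le_op_norm[OF minus_carrier_mat[OF nc_eval_carrier] ij])
      also have "\<dots> \<le> 1 / real (Suc k)" by (rule P[OF nA])
      also have "\<dots> \<le> 1 / real (Suc M)" using that by (intro divide_left_mono) auto
      finally show ?thesis using M by linarith
    qed
    then show "\<exists>no. \<forall>k\<ge>no. cmod (nc_eval n (P k) A $$ (i, j) - h (n, A) $$ (i, j)) < \<epsilon>" by blast
  qed
  ultimately show "h \<in> calA R" using rhs unfolding calA_def by blast
qed

lemma calA_complete:
  fixes H :: "nat \<Rightarrow> 'v cstar_elem"
  assumes R: "0 \<le> R" and H: "\<And>k. H k \<in> calA R"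
    and Cauchy: "\<And>\<epsilon>. 0 < \<epsilon> \<Longrightarrow> \<exists>M. \<forall>k\<ge>M. \<forall>l\<ge>M. \<forall>x\<in>mat_points R. op_norm (H k x - H l x) \<le> \<epsilon>"
  shows "\<exists>h\<in>calA R. \<forall>\<epsilon>>0. \<exists>M. \<forall>k\<ge>M. \<forall>x\<in>mat_points R. op_norm (H k x - h x) \<le> \<epsilon>"
proof -
  have "\<exists>p. \<forall>(n, A)\<in>mat_points R. op_norm (H k (n, A) - nc_eval n p A) \<le> 1 / real (Suc k)" for k
    using H[of k] by (simp add: calA_iff_uniform_limit[OF R])
  then obtain P where P: "\<And>k n A. (n, A) \<in> mat_points R \<Longrightarrow> op_norm (H k (n, A) - nc_eval n (P k) A) \<le> 1 / real (Suc k)"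
    by (metis (no_types, lifting) case_prodD)
  have near: "\<exists>M. \<forall>k\<ge>M. \<forall>l\<ge>M. \<forall>(n, A)\<in>mat_points R.
      op_norm (H k (n, A) - nc_eval n (P l) A) \<le> \<epsilon> \<and> op_norm (nc_eval n (P k - P l) A) \<le> \<epsilon>" if "0 < \<epsilon>" for \<epsilon> :: real
  proof -
    obtain M1 where M1: "\<forall>k\<ge>M1. \<forall>l\<ge>M1. \<forall>x\<in>mat_points R. op_norm (H k x - H l x) \<le> \<epsilon> / 3"
      using Cauchy[of "\<epsilon> / 3"] \<open>0 < \<epsilon>\<close> by auto
    obtain M2 where M2: "1 / real (Suc M2) < \<epsilon> / 3"
      using reals_Archimedean[of "\<epsilon> / 3"] \<open>0 < \<epsilon>\<close> by (auto simp: inverse_eq_divide)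
    have "op_norm (H k (n, A) - nc_eval n (P l) A) \<le> \<epsilon> \<and> op_norm (nc_eval n (P k - P l) A) \<le> \<epsilon>"
      if k: "k \<ge> max M1 M2" and l: "l \<ge> max M1 M2" and nA: "(n, A) \<in> mat_points R" for k l n A
    proof -
      have small: "op_norm (H k (n, A) - nc_eval n (P k) A) \<le> \<epsilon> / 3" if "k \<ge> M2" for k
      proof -
        have "1 / real (Suc k) \<le> 1 / real (Suc M2)" using that by (intro divide_left_mono) auto
        then show ?thesis using P[OF nA, of k] M2 by linarith
      qed
      have kl: "op_norm (H k (n, A) - H l (n, A)) \<le> \<epsilon> / 3" using M1 k l nA by auto
      note C = calA_carrier[OF H nA] nc_eval_carrier[of n _ A]
      have 1: "op_norm (H k (n, A) - nc_eval n (P l) A) \<le> \<epsilon> / 3 + \<epsilon> / 3"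
        using op_norm_diff_triangle[OF C(1)[of k] C(1)[of l] C(2)[of "P l"]] kl small[of l] l by simp
      moreover have "op_norm (nc_eval n (P k) A - nc_eval n (P l) A) \<le> \<epsilon>"
        using op_norm_diff_triangle[OF C(2)[of "P k"] C(1)[of k] C(2)[of "P l"]] 1 small[of k] k
          op_norm_minus_commute[OF C(1)[of k] C(2)[of "P k"]] by simp
      ultimately show ?thesis using \<open>0 < \<epsilon>\<close> by (simp add: nc_eval_minus)
    qed
    then show ?thesis by blast
  qed
  have PC: "nc_Cauchy R P"
    unfolding nc_Cauchy_def
  proof safe
    fix \<epsilon> :: real assume e: "0 < \<epsilon>"
    then obtain M where "\<forall>k\<ge>M. \<forall>l\<ge>M. \<forall>(n, A)\<in>mat_points R. op_norm (nc_eval n (P k - P l) A) \<le> \<epsilon> / 2"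
      using near[of "\<epsilon> / 2"] by fastforce
    then have "\<forall>k\<ge>M. \<forall>l\<ge>M. nc_norm R (P k - P l) \<le> \<epsilon> / 2"
      by (intro allI impI nc_norm_least[OF R]) blast
    then show "\<exists>M. \<forall>k\<ge>M. \<forall>l\<ge>M. nc_norm R (P k - P l) < \<epsilon>"
      using e by (intro exI[of _ M]) fastforce
  qed
  obtain h where h: "h \<in> calA R" and lim: "\<And>n A i j. (n, A) \<in> mat_points R \<Longrightarrow> i < n \<Longrightarrow> j < n \<Longrightarrow>
        (\<lambda>k. nc_eval n (P k) A $$ (i, j)) \<longlonglongrightarrow> h (n, A) $$ (i, j)"
    using uniform_Cauchy_limit[OF R PC] by blast
  have "\<exists>M. \<forall>k\<ge>M. \<forall>x\<in>mat_points R. op_norm (H k x - h x) \<le> \<epsilon>" if e: "0 < \<epsilon>" for \<epsilon> :: real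
  proof -
    obtain M where M: "\<And>k l n A. k \<ge> M \<Longrightarrow> l \<ge> M \<Longrightarrow> (n, A) \<in> mat_points R \<Longrightarrow>
        op_norm (H k (n, A) - nc_eval n (P l) A) \<le> \<epsilon>"
      using near[OF e] by fastforce
    have "op_norm (H k (n, A) - h (n, A)) \<le> \<epsilon>" if "k \<ge> M" and nA: "(n, A) \<in> mat_points R" for k n A
    proof -
      note C = calA_carrier[OF H nA] nc_eval_carrier[of n _ A]
      have "op_norm (h (n, A) - H k (n, A)) \<le> \<epsilon>"
      proof (rule op_norm_limit_le[where X = "\<lambda>k. nc_eval n (P k) A" and M = M and m = n and n = n])
        fix l assume "M \<le> l"
        show "op_norm (nc_eval n (P l) A - H k (n, A)) \<le> \<epsilon>"
          using M[OF \<open>k \<ge> M\<close> \<open>M \<le> l\<close> nA] op_norm_minus_commute[OF C(1)[of k] C(2)[of "P l"]] by simp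
      qed (use C calA_carrier[OF h nA] lim[OF nA] in auto)
      then show ?thesis using op_norm_minus_commute[OF C(1)[of k] calA_carrier[OF h nA]] by simp
    qed
    then show ?thesis by fast
  qed
  with h show ?thesis by blast
qed

lemma nc_embed_calA: "0 \<le> R \<Longrightarrow> nc_embed R p \<in> calA R"
proof -
  assume R: "0 \<le> R"
  have "op_norm (nc_eval n p A - nc_eval n p A) \<le> \<epsilon>" if "0 < \<epsilon>" for n A \<epsilon>
  proof -
    have eq: "nc_eval n p A - nc_eval n p A = 0\<^sub>m n n"
      using nc_eval_carrier[of n p A] by (intro eq_matI) (auto simp del: nc_eval_carrier)
    have "op_norm (0\<^sub>m n n) \<le> 0"
      using op_norm_le_entries[of "0\<^sub>m n n" n n] by simp
    then show ?thesis unfolding eq using that by linarith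
  qed
  then have "\<exists>q. \<forall>(n, A)\<in>mat_points R. op_norm (nc_embed R p (n, A) - nc_eval n q A) \<le> \<epsilon>" if "0 < \<epsilon>" for \<epsilon>
    using that by (intro exI[of _ p]) (simp add: nc_embed_def split_beta)
  then show ?thesis
    by (simp add: calA_iff_uniform_limit[OF R]) (simp add: nc_embed_def split_beta)
qed

lemma calA_norm_embed: "calA_norm R (nc_embed R p) = nc_norm R p"
  unfolding calA_norm_def nc_norm_def nc_embed_def by (intro SUP_cong) auto

lemma mat_pointsD: "(n, A) \<in> mat_points R \<Longrightarrow> A \<in> herm_tuples n R"
  by (simp add: mat_points_def)

lemma nc_embed_one: "nc_embed R 1 = calA_one R"
  by (rule ext) (auto simp: nc_embed_def calA_one_def nc_eval_one restrict_def)

lemma nc_embed_add: "nc_embed R (p + q) = calA_add R (nc_embed R p) (nc_embed R q)"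
  by (rule ext) (auto simp: nc_embed_def calA_add_def nc_eval_add restrict_def)

lemma nc_embed_scale: "nc_embed R (nc_scale c p) = calA_scale R c (nc_embed R p)"
  by (rule ext) (auto simp: nc_embed_def calA_scale_def restrict_def nc_eval_scale herm_tuplesD(1)[OF mat_pointsD])

lemma nc_embed_mult: "nc_embed R (p * q) = calA_mult R (nc_embed R p) (nc_embed R q)"
  by (rule ext) (auto simp: nc_embed_def calA_mult_def restrict_def nc_eval_mult herm_tuplesD(1)[OF mat_pointsD])

lemma nc_embed_star: "nc_embed R (nc_star p) = calA_star R (nc_embed R p)"
  by (rule ext) (auto simp: nc_embed_def calA_star_def restrict_def nc_eval_star[OF mat_pointsD])

text \<open>The identification of tracial states with elements of \<open>\<Sigma>\<langle>X\<^sub>1, \<dots>, X\<^sub>N\<rangle>\<close>.\<close>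

lemma nc_restrict_Sigma:
  assumes R: "0 \<le> R" and \<mu>: "\<mu> \<in> tracial_states R"
  shows "nc_restrict R \<mu> \<in> Sigma_functionals"
proof -
  let ?m = "nc_restrict R \<mu>"
  note E = nc_embed_calA[OF R]
  have add: "?m (p + q) = ?m p + ?m q" for p q
    using \<mu> by (simp add: E nc_restrict_def nc_embed_add tracial_states_def)
  have scale: "?m (nc_scale c p) = c * ?m p" for c p
    using \<mu> by (simp add: E nc_restrict_def nc_embed_scale tracial_states_def)
  have one: "?m 1 = 1"
    using \<mu> by (simp add: nc_restrict_def nc_embed_one tracial_states_def)
  have pos: "0 \<le> ?m (nc_star p * p)" for p
    using \<mu> by (simp add: E nc_restrict_def nc_embed_mult nc_embed_star tracial_states_def)
  have star: "?m (nc_star p) = cnj (?m p)" for p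
  proof -
    have *: "Im (c * ?m (nc_star p) + cnj c * ?m p) = 0" for c
    proof -
      let ?c = "Poly_Mapping.single [] c"
      have st: "nc_star (p + ?c) = nc_star p + Poly_Mapping.single [] (cnj c)"
        by (simp add: nc_star_add nc_star_single)
      have comm: "q * Poly_Mapping.single [] c = nc_scale c q" for q :: "'a ncpoly"
      proof (induction q rule: ncpoly_induct)
        case (single_add w d q)
        then show ?case
          by (simp add: nc_scale_def distrib_left distrib_right mult_single plus_list_def mult.commute)
      qed (simp add: nc_scale_def)
      have "nc_star (p + ?c) * (p + ?c) =
          nc_star p * p + nc_scale c (nc_star p) + nc_scale (cnj c) p + nc_scale (cnj c * c) 1"
        unfolding st by (simp add: distrib_left distrib_right comm)
          (simp add: nc_scale_def distrib_left mult_single plus_list_def mult.commute)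
      then have "?m (nc_star (p + ?c) * (p + ?c)) =
          ?m (nc_star p * p) + c * ?m (nc_star p) + cnj c * ?m p + cnj c * c"
        by (simp add: add scale one)
      moreover have "Im (?m (nc_star (p + ?c) * (p + ?c))) = 0" "Im (?m (nc_star p * p)) = 0"
        using pos[of "p + ?c"] pos[of p] by (auto simp: less_eq_complex_def)
      ultimately show ?thesis by (simp add: mult.commute)
    qed
    show ?thesis using *[of 1] *[of \<i>] by (simp add: complex_eq_iff)
  qed
  show ?thesis using add scale one star by (auto simp: Sigma_functionals_def)
qed

end

theory Submission
  imports Defs
begin

text \<open>
  For \<open>h \<in> calA R\<close> let \<open>\<mu>\<^sub>n\<close> be the Gibbs state \<open>g \<mapsto> \<integral> tr\<^sub>n(g) exp(-n\<^sup>2 tr\<^sub>n(h)) d\<Lambda>\<^sub>n / Z\<^sub>n\<close>, a tracial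
  state, and let \<open>\<pi>\<^sub>n\<close> be the matrix-size-\<open>n\<close> quantity whose limsup is \<open>\<pi>\<^sub>R\<close>. Since the exponential lies
  above its tangents, \<open>\<pi>\<^sub>n(k) \<ge> \<pi>\<^sub>n(h) - \<mu>\<^sub>n(k - h)\<close>. Along a subsequence realising \<open>\<pi>\<^sub>R(h)\<close> and a
  cluster point \<open>\<mu>\<close> of the \<open>\<mu>\<^sub>n\<close> (Tychonoff) this becomes \<open>\<mu>(k) + \<pi>\<^sub>R(k) \<ge> \<mu>(h) + \<pi>\<^sub>R(h)\<close> for all \<open>k\<close>,
  so the supremum in (2) is attained at \<open>\<mu>\<close>. The same inequality shows that \<open>\<pi>\<^sub>R\<close> is 1-Lipschitz for the norm. As tracial states are norm
  continuous, because \<open>1 - h = k\<^sup>*k\<close> for selfadjoint \<open>h\<close> of small norm, (1) follows from density of the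
  polynomials.
\<close>

section \<open>The measure of the matrix balls\<close>

text \<open>The tangent state is built directly as a limit of Gibbs states because positivity and
  traciality are then inherited from identities for the matrix trace. The limsup treats the two
  elements differently: for h the values \<pi>_n(h) must converge, hence the subsequence, while for
  k it is enough that \<pi>_n(k) is eventually below each c > \<pi>_R(k). The states live in a
  product over an uncountable index set, so the cluster point is reached along a filter finer than
  the subsequence and not by a further extraction. Pressures are extended reals and are only ever
  shifted by real numbers, so every rearrangement is also valid at infinite values. The matrix balls
  enter through three facts: they are measurable, of finite volume and of positive volume. The
  square root k is constructed inside the algebra, since positivity of a state concerns products of
  the adjoint of k with k for elements k of \<open>calA R\<close>. The radius 1/2 makes the
  fixed-point map a contraction; it costs a factor 2 in the estimate for states, which an
  arbitrarily small approximation error absorbs.\<close>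

lemma herm_of_coords_index:
  assumes "i < n" "j < n"
  shows "herm_of_coords n x $$ (i, j) =
    (if i = j then complex_of_real (x (i, i)) else if i < j then Complex (x (i, j)) (x (j, i))
     else Complex (x (j, i)) (- x (i, j)))"
  using assms by (simp add: herm_of_coords_def complex_eq_iff)

lemma herm_of_coords_herm: "herm_of_coords n x \<in> herm n"
proof -
  have C: "herm_of_coords n x \<in> carrier_mat n n" by (simp add: herm_of_coords_def)
  then show ?thesis
    using mat_adjoint_carrier[OF C]
    by (auto simp: herm_def mat_adjoint_index[OF C] herm_of_coords_index complex_eq_iff intro!: eq_matI)
qed

lemma herm_of_coords_carrier [simp]: "herm_of_coords n x \<in> carrier_mat n n"
  by (simp add: herm_of_coords_def)

lemma space_Lambda [simp]: "space (Lambda n) = herm n"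
  by (simp add: Lambda_def space_scale_measure herm_borel_def)

lemma sets_Lambda [simp, measurable_cong]: "sets (Lambda n) = sets (herm_borel n)"
  by (simp add: Lambda_def)

lemma measurable_entry [measurable]:
  assumes "i < n" "j < n"
  shows "(\<lambda>A. A $$ (i, j)) \<in> borel_measurable (herm_borel n)"
proof -
  let ?P = "\<Pi>\<^sub>M ij\<in>{..<n} \<times> {..<n}. (borel :: complex measure)"
  have "(\<lambda>A. \<lambda>ij\<in>{..<n} \<times> {..<n}. A $$ ij) \<in> measurable (herm_borel n) ?P"
    unfolding herm_borel_def by (rule measurable_vimage_algebra1) (auto simp: space_PiM)
  moreover have "(\<lambda>f. f (i, j)) \<in> measurable ?P borel"
    using assms by (intro measurable_component_singleton) auto
  ultimately have "(\<lambda>f. f (i, j)) \<circ> (\<lambda>A. \<lambda>ij\<in>{..<n} \<times> {..<n}. A $$ ij) \<in> borel_measurable (herm_borel n)"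
    by (rule measurable_comp)
  then show ?thesis using assms by (simp add: comp_def)
qed

lemma measurable_herm_of_coords [measurable]:
  "herm_of_coords n \<in> measurable (\<Pi>\<^sub>M ij\<in>{..<n} \<times> {..<n}. lborel) (herm_borel n)"
  unfolding herm_borel_def
proof (rule measurable_vimage_algebra2)
  let ?I = "{..<n} \<times> {..<n}" and ?P = "\<Pi>\<^sub>M ij\<in>{..<n} \<times> {..<n}. (lborel :: real measure)"
  show "herm_of_coords n \<in> space ?P \<rightarrow> herm n" by (simp add: herm_of_coords_herm)
  show "(\<lambda>x. \<lambda>ij\<in>?I. herm_of_coords n x $$ ij) \<in> measurable ?P (\<Pi>\<^sub>M ij\<in>?I. borel)"
  proof (rule measurable_restrict)
    fix ij assume "ij \<in> ?I"
    then obtain i j where ij: "ij = (i, j)" "i < n" "j < n" by auto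
    have comp[measurable]: "(\<lambda>x. x kl) \<in> borel_measurable ?P" if "kl \<in> ?I" for kl
      using measurable_component_singleton[OF that, of "\<lambda>_. lborel :: real measure"] by simp
    \<comment> \<open>\<open>Complex\<close> is replaced by sums and multiples of \<i>, for which
      measurability is automatic.\<close>
    have "(\<lambda>x. herm_of_coords n x $$ (i, j)) = (\<lambda>x.
        if i = j then complex_of_real (x (i, i))
        else if i < j then complex_of_real (x (i, j)) + \<i> * complex_of_real (x (j, i))
        else complex_of_real (x (j, i)) - \<i> * complex_of_real (x (i, j)))"
      using ij by (auto simp: herm_of_coords_index complex_eq_iff)
    moreover have "\<dots> \<in> borel_measurable ?P"
      using ij comp[of "(i, i)"] comp[of "(i, j)"] comp[of "(j, i)"] by (cases "i = j"; cases "i < j") auto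
    ultimately show "(\<lambda>x. herm_of_coords n x $$ ij) \<in> borel_measurable ?P" using ij by simp
  qed
qed

section \<open>Measurability of operator norm balls\<close>

definition rational_vecs :: "nat \<Rightarrow> complex vec set" where
  "rational_vecs n = (\<lambda>q. vec n (\<lambda>i. Complex (of_rat (fst (q i))) (of_rat (snd (q i))))) ` ({..<n} \<rightarrow>\<^sub>E UNIV)"

lemma countable_rational_vecs: "countable (rational_vecs n)"
  unfolding rational_vecs_def by (intro countable_image countable_PiE) auto

lemma rational_vecs_carrier: "v \<in> rational_vecs n \<Longrightarrow> v \<in> carrier_vec n"
  unfolding rational_vecs_def by (elim imageE) simp

text \<open>Both sides of the inequality are continuous in v, so a dense countable set of test
  vectors decides it. The homogeneous form with \<open>R * cvec_norm v\<close> lets the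
  approximating vectors be arbitrary, with no need to keep them in the unit ball.\<close>

lemma op_norm_le_iff_rational:
  assumes A: "A \<in> carrier_mat n n" and R: "0 \<le> R"
  shows "op_norm A \<le> R \<longleftrightarrow> (\<forall>v\<in>rational_vecs n. cvec_norm (A *\<^sub>v v) \<le> R * cvec_norm v)"
proof
  assume "op_norm A \<le> R"
  moreover have "cvec_norm (A *\<^sub>v v) \<le> op_norm A * cvec_norm v" if "v \<in> rational_vecs n" for v
    by (rule op_norm_mult_vec[OF A rational_vecs_carrier[OF that]])
  ultimately show "\<forall>v\<in>rational_vecs n. cvec_norm (A *\<^sub>v v) \<le> R * cvec_norm v"
    by (meson cvec_norm_nonneg mult_right_mono order_trans)
next
  assume D: "\<forall>v\<in>rational_vecs n. cvec_norm (A *\<^sub>v v) \<le> R * cvec_norm v"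
  show "op_norm A \<le> R"
  proof (rule op_norm_leI[OF A R])
    fix v :: "complex vec" assume v: "v \<in> carrier_vec n"
    \<comment> \<open>One approximating sequence is chosen for every real x at once, so that it can
      be applied to the real and imaginary parts of all components of v.\<close>
    have "\<exists>q. \<forall>k. \<bar>of_rat (q k) - x\<bar> < inverse (real (Suc k))" for x :: real
    proof -
      have "\<exists>q. \<bar>of_rat q - x\<bar> < inverse (real (Suc k))" for k
      proof -
        have "0 < inverse (real (Suc k))" by simp
        then obtain q where "x < of_rat q" "of_rat q < x + inverse (real (Suc k))"
          using of_rat_dense[of x "x + inverse (real (Suc k))"] by auto
        then show ?thesis by (intro exI[of _ q]) linarith
      qed
      then show ?thesis by (intro choice) simp
    qed
    from choice[OF allI[OF this]] obtain q
      where q: "\<forall>x k. \<bar>of_rat (q x k) - x\<bar> < inverse (real (Suc k))" by (rule exE)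
    have lim: "(\<lambda>k. of_rat (q x k)) \<longlonglongrightarrow> (x::real)" for x
    proof (rule LIM_zero_cancel, rule tendsto_rabs_zero_cancel, rule tendsto_sandwich[OF _ _ tendsto_const LIMSEQ_inverse_real_of_nat])
      show "\<forall>\<^sub>F k in sequentially. \<bar>of_rat (q x k) - x\<bar> \<le> inverse (real (Suc k))"
        using q by (intro always_eventually allI less_imp_le) (rule spec, rule spec)
    qed simp
    define w where "w k = vec n (\<lambda>i. Complex (of_rat (q (Re (vec_index v i)) k)) (of_rat (q (Im (vec_index v i)) k)))" for k
    have w: "w k \<in> carrier_vec n" for k by (simp add: w_def)
    have "w k \<in> rational_vecs n" for k
      unfolding rational_vecs_def by (rule image_eqI[of _ _ "\<lambda>i\<in>{..<n}. (q (Re (vec_index v i)) k, q (Im (vec_index v i)) k)"])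
        (auto simp: w_def)
    then have le: "cvec_norm (A *\<^sub>v w k) \<le> R * cvec_norm (w k)" for k using D by blast
    have wi: "(\<lambda>k. vec_index (w k) i) \<longlonglongrightarrow> vec_index v i" if "i < n" for i
      using that tendsto_Complex[OF lim[of "Re (vec_index v i)"] lim[of "Im (vec_index v i)"]] by (simp add: w_def)
    have N: "cvec_norm u = sqrt (\<Sum>i<n. (cmod (vec_index u i))\<^sup>2)" if "u \<in> carrier_vec n" for u
      using that by (simp add: cvec_norm_L2 L2_set_def)
    have NA: "cvec_norm (A *\<^sub>v u) = sqrt (\<Sum>i<n. (cmod (\<Sum>j<n. A $$ (i, j) * vec_index u j))\<^sup>2)"
      if "u \<in> carrier_vec n" for u
      using that A by (simp add: cvec_norm_L2 L2_set_def scalar_prod_def atLeast0LessThan)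
    have "(\<lambda>k. cvec_norm (w k)) \<longlonglongrightarrow> cvec_norm v"
      unfolding N[OF v] N[OF w] by (intro tendsto_intros wi) simp
    moreover have "(\<lambda>k. cvec_norm (A *\<^sub>v w k)) \<longlonglongrightarrow> cvec_norm (A *\<^sub>v v)"
      unfolding NA[OF v] NA[OF w] by (intro tendsto_intros wi) simp
    ultimately show "cvec_norm (A *\<^sub>v v) \<le> R * cvec_norm v"
      using le by (intro LIMSEQ_le[where X = "\<lambda>k. cvec_norm (A *\<^sub>v w k)" and Y = "\<lambda>k. R * cvec_norm (w k)"])
        (auto intro: tendsto_mult_left)
  qed
qed

text \<open>The sigma-algebra only knows matrix entries. Testing the norm on countably many vectors
  turns the ball into a countable intersection of conditions that are measurable in the
  entries.\<close>

lemma herm_ball_sets: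
  assumes "0 \<le> R"
  shows "herm_ball n R \<in> sets (herm_borel n)"
proof -
  have M: "{A \<in> space (herm_borel n). cvec_norm (A *\<^sub>v v) \<le> R * cvec_norm v} \<in> sets (herm_borel n)"
    if v: "v \<in> carrier_vec n" for v
  proof -
    have "(\<lambda>A. cvec_norm (A *\<^sub>v v)) \<in> borel_measurable (herm_borel n) \<longleftrightarrow>
      (\<lambda>A. sqrt (\<Sum>i<n. (cmod (\<Sum>j<n. A $$ (i, j) * vec_index v j))\<^sup>2)) \<in> borel_measurable (herm_borel n)"
      using v by (intro measurable_cong)
        (auto simp: herm_borel_def herm_def cvec_norm_L2 L2_set_def scalar_prod_def atLeast0LessThan)
    moreover have "(\<lambda>A. sqrt (\<Sum>i<n. (cmod (\<Sum>j<n. A $$ (i, j) * vec_index v j))\<^sup>2)) \<in> borel_measurable (herm_borel n)"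
    proof -
      have "(\<lambda>A. \<Sum>j<n. A $$ (i, j) * vec_index v j) \<in> borel_measurable (herm_borel n)" if "i < n" for i
        using that by (intro borel_measurable_sum borel_measurable_times measurable_entry) auto
      then show ?thesis by measurable
    qed
    ultimately show ?thesis by simp
  qed
  have "herm_ball n R = {A \<in> space (herm_borel n). \<forall>v\<in>rational_vecs n. cvec_norm (A *\<^sub>v v) \<le> R * cvec_norm v}"
    using op_norm_le_iff_rational[OF _ assms] by (auto simp: herm_ball_def herm_borel_def herm_def)
  also have "\<dots> \<in> sets (herm_borel n)"
    by (intro sets.sets_Collect_countable_All' countable_rational_vecs M rational_vecs_carrier)
  finally show ?thesis .
qed

section \<open>Finite and positive volume\<close>

lemma emeasure_Lambda:
  assumes "B \<in> sets (herm_borel n)"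
  shows "emeasure (Lambda n) B = 2 ^ (n * (n - 1) div 2) *
    emeasure (\<Pi>\<^sub>M ij\<in>{..<n} \<times> {..<n}. lborel) (herm_of_coords n -` B \<inter> space (\<Pi>\<^sub>M ij\<in>{..<n} \<times> {..<n}. lborel))"
  using assms by (simp add: Lambda_def emeasure_distr)

text \<open>Up to sign, the coordinate at (i, j) is the real or the imaginary part of the entry at
  the same position, also below the diagonal.\<close>

lemma coords_le_entry:
  assumes "i < n" "j < n" "\<And>i j. i < n \<Longrightarrow> j < n \<Longrightarrow> cmod (herm_of_coords n x $$ (i, j)) \<le> K"
  shows "\<bar>x (i, j)\<bar> \<le> K"
proof -
  let ?z = "herm_of_coords n x $$ (i, j)"
  have "\<bar>x (i, j)\<bar> = \<bar>Re ?z\<bar> \<or> \<bar>x (i, j)\<bar> = \<bar>Im ?z\<bar>"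
    using assms(1,2) by (auto simp: herm_of_coords_index)
  then show ?thesis
    using assms(3)[OF assms(1,2)] abs_Re_le_cmod[of ?z] abs_Im_le_cmod[of ?z] by auto
qed

lemma emeasure_coord_box:
  fixes K :: real
  assumes "0 \<le> K"
  shows "emeasure (\<Pi>\<^sub>M ij\<in>{..<n} \<times> {..<n}. lborel) (Pi\<^sub>E ({..<n} \<times> {..<n}) (\<lambda>_. {-K..K})) = ennreal ((2 * K) ^ (n * n))"
proof -
  interpret product_sigma_finite "\<lambda>_ :: nat \<times> nat. lborel :: real measure" by standard
  have "emeasure (\<Pi>\<^sub>M ij\<in>{..<n} \<times> {..<n}. lborel) (Pi\<^sub>E ({..<n} \<times> {..<n}) (\<lambda>_. {-K..K})) =
      (\<Prod>ij\<in>{..<n} \<times> {..<n}. emeasure lborel {-K..K})"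
    by (rule emeasure_PiM) auto
  also have "\<dots> = ennreal (2 * K) ^ (n * n)"
    using assms by (simp add: card_cartesian_product)
  finally show ?thesis using assms by (simp add: ennreal_power)
qed

lemma coord_box_sets:
  fixes n :: nat
  shows "Pi\<^sub>E ({..<n} \<times> {..<n}) (\<lambda>_. {-K..K::real}) \<in> sets (\<Pi>\<^sub>M ij\<in>{..<n} \<times> {..<n}. lborel)"
  by (intro sets_PiM_I_finite) auto

text \<open>Bounded entries force bounded coordinates, so the preimage of B in coordinate space lies
  in a cube of finite Lebesgue measure.\<close>

lemma emeasure_Lambda_bounded:
  fixes K :: real
  assumes B: "B \<in> sets (herm_borel n)"
    and le: "\<And>A i j. A \<in> B \<Longrightarrow> i < n \<Longrightarrow> j < n \<Longrightarrow> cmod (A $$ (i, j)) \<le> K"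
  shows "emeasure (Lambda n) B < \<infinity>"
proof -
  let ?P = "\<Pi>\<^sub>M ij\<in>{..<n} \<times> {..<n}. (lborel :: real measure)"
  \<comment> \<open>The cube uses \<bar>K\<bar> because K may be negative when the bound on entries
    is vacuous, and the volume formula wants a nonnegative half-width.\<close>
  have le': "\<bar>x (i, j)\<bar> \<le> \<bar>K\<bar>" if "herm_of_coords n x \<in> B" "i < n" "j < n" for x i j
    using le[OF that(1)] by (intro coords_le_entry[OF that(2,3)]) (meson abs_ge_self order_trans)
  have "emeasure ?P (herm_of_coords n -` B \<inter> space ?P) \<le> emeasure ?P (Pi\<^sub>E ({..<n} \<times> {..<n}) (\<lambda>_. {-\<bar>K\<bar>..\<bar>K\<bar>}))"
  proof (rule emeasure_mono[OF _ coord_box_sets], rule subsetI)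
    fix x assume x: "x \<in> herm_of_coords n -` B \<inter> space ?P"
    then have "x ij \<in> {-\<bar>K\<bar>..\<bar>K\<bar>}" if "ij \<in> {..<n} \<times> {..<n}" for ij
      using le'[of x "fst ij" "snd ij"] that by (cases ij) (auto simp: abs_le_iff)
    moreover have "x \<in> extensional ({..<n} \<times> {..<n})" using x by (simp add: space_PiM PiE_def)
    ultimately show "x \<in> Pi\<^sub>E ({..<n} \<times> {..<n}) (\<lambda>_. {-\<bar>K\<bar>..\<bar>K\<bar>})" by (simp add: PiE_def Pi_def)
  qed
  also have "\<dots> < \<infinity>" by (subst emeasure_coord_box) auto
  finally show ?thesis
    by (simp add: emeasure_Lambda[OF B] ennreal_mult_less_top power_less_top_ennreal)
qed

text \<open>The ball contains the image of a small coordinate cube around 0, because the operator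
  norm is at most the sum of the moduli of the entries.\<close>

lemma emeasure_Lambda_herm_ball_pos:
  assumes "0 < R"
  shows "0 < emeasure (Lambda n) (herm_ball n R)"
proof -
  let ?P = "\<Pi>\<^sub>M ij\<in>{..<n} \<times> {..<n}. (lborel :: real measure)"
  \<comment> \<open>Each of the n^2 entries has modulus at most 2 * e, so their sum is at most R;
    the summand 1 keeps the denominator positive for n = 0.\<close>
  define e where "e = R / (2 * (real n * real n) + 1)"
  have e: "0 < e" using assms by (simp add: e_def add_nonneg_pos)
  have "herm_of_coords n x \<in> herm_ball n R" if x: "x \<in> Pi\<^sub>E ({..<n} \<times> {..<n}) (\<lambda>_. {-e..e})" for x
  proof -
    have "op_norm (herm_of_coords n x) \<le> (\<Sum>i<n. \<Sum>j<n. cmod (herm_of_coords n x $$ (i, j)))"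
      by (rule op_norm_le_entries) simp
    also have "\<dots> \<le> (\<Sum>i<n. \<Sum>j<n. 2 * e)"
    proof (intro sum_mono)
      fix i j assume "i \<in> {..<n}" "j \<in> {..<n}"
      then have ij: "i < n" "j < n" by auto
      have xe: "\<bar>x (k, l)\<bar> \<le> e" if "k < n" "l < n" for k l
        using PiE_mem[OF x, of "(k, l)"] that by auto
      show "cmod (herm_of_coords n x $$ (i, j)) \<le> 2 * e"
        using ij e cmod_le[of "herm_of_coords n x $$ (i, j)"] xe[of i j] xe[of j i]
        by (auto simp: herm_of_coords_index split: if_splits)
    qed
    also have "\<dots> \<le> R"
    proof -
      have "2 * (real n * real n) / (2 * (real n * real n) + 1) \<le> 1"
        by (simp add: divide_le_eq_1 add_nonneg_pos)
      from mult_left_mono[OF this, of R] show ?thesis using assms by (simp add: e_def mult_ac)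
    qed
    finally show ?thesis by (simp add: herm_ball_def herm_of_coords_herm)
  qed
  then have "Pi\<^sub>E ({..<n} \<times> {..<n}) (\<lambda>_. {-e..e}) \<subseteq> herm_of_coords n -` herm_ball n R \<inter> space ?P"
    by (auto simp: space_PiM)
  then have "emeasure ?P (Pi\<^sub>E ({..<n} \<times> {..<n}) (\<lambda>_. {-e..e})) \<le> emeasure ?P (herm_of_coords n -` herm_ball n R \<inter> space ?P)"
    using assms by (intro emeasure_mono measurable_sets[OF measurable_herm_of_coords herm_ball_sets]) auto
  moreover have "0 < emeasure ?P (Pi\<^sub>E ({..<n} \<times> {..<n}) (\<lambda>_. {-e..e}))"
    using e by (simp add: emeasure_coord_box)
  moreover have "0 < (2 :: ennreal) ^ k" for k by (induction k) (auto simp: ennreal_zero_less_mult_iff)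
  ultimately show ?thesis
    using assms by (auto simp: emeasure_Lambda herm_ball_sets ennreal_zero_less_mult_iff)
qed

text \<open>Exhaustion by sets of uniformly bounded entries. This is what makes the product formula
  for \<open>Lambda_tensor\<close> on rectangles available.\<close>

lemma sigma_finite_Lambda: "sigma_finite_measure (Lambda n)"
proof
  define B where "B k = {A \<in> space (herm_borel n). \<forall>i\<in>{..<n}. \<forall>j\<in>{..<n}. cmod (A $$ (i, j)) \<le> real k}" for k
  have B: "B k \<in> sets (herm_borel n)" for k
  proof -
    have "{A \<in> space (herm_borel n). cmod (A $$ (i, j)) \<le> real k} \<in> sets (herm_borel n)" if "i < n" "j < n" for i j
      using measurable_compose[OF measurable_entry[OF that] borel_measurable_norm] by measurable
    then show ?thesis unfolding B_def by (intro sets.sets_Collect_countable_All') auto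
  qed
  have "A \<in> (\<Union>k. B k)" if A: "A \<in> herm n" for A
  proof -
    obtain k where "op_norm A \<le> real k" using real_arch_simple by blast
    then show ?thesis
      using A entry_le_op_norm[of A n n] by (auto simp: B_def herm_borel_def herm_def intro!: exI[of _ k] intro: order_trans)
  qed
  then have "\<Union>(range B) = space (Lambda n)" by (auto simp: B_def herm_borel_def)
  moreover have "emeasure (Lambda n) (B k) \<noteq> \<infinity>" for k
    using emeasure_Lambda_bounded[OF B, of k "real k"] by (simp add: B_def)
  ultimately show "\<exists>F. countable F \<and> F \<subseteq> sets (Lambda n) \<and> \<Union>F = space (Lambda n) \<and> (\<forall>a\<in>F. emeasure (Lambda n) a \<noteq> \<infinity>)"
    using B by (intro exI[of _ "range B"]) auto
qed

text \<open>The set of tuples is a rectangle with equal sides, so its volume is the CARD('v)-th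
  power of the volume of one ball.\<close>

lemma Lambda_tensor_herm_tuples:
  assumes "0 < R"
  shows "herm_tuples n R \<in> sets (Lambda_tensor n :: ('v::finite \<Rightarrow> complex mat) measure)"
    and "0 < emeasure (Lambda_tensor n :: ('v \<Rightarrow> complex mat) measure) (herm_tuples n R)"
    and "emeasure (Lambda_tensor n :: ('v \<Rightarrow> complex mat) measure) (herm_tuples n R) < \<infinity>"
proof -
  interpret product_sigma_finite "\<lambda>_ :: 'v. Lambda n"
    unfolding product_sigma_finite_def using sigma_finite_Lambda by simp
  have eq: "herm_tuples n R = Pi\<^sub>E (UNIV :: 'v set) (\<lambda>_. herm_ball n R)"
    by (auto simp: herm_tuples_def PiE_def Pi_def)
  have B: "herm_ball n R \<in> sets (herm_borel n)" using assms by (simp add: herm_ball_sets)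
  show "herm_tuples n R \<in> sets (Lambda_tensor n :: ('v \<Rightarrow> complex mat) measure)"
    unfolding eq Lambda_tensor_def using B by (intro sets_PiM_I_finite) auto
  have em: "emeasure (Lambda_tensor n :: ('v \<Rightarrow> complex mat) measure) (herm_tuples n R) =
      emeasure (Lambda n) (herm_ball n R) ^ CARD('v)"
    unfolding eq Lambda_tensor_def using B by (subst emeasure_PiM) auto
  have "emeasure (Lambda n) (herm_ball n R) < \<infinity>"
  proof (rule emeasure_Lambda_bounded[OF B])
    fix A i j assume "A \<in> herm_ball n R" "i < n" "j < n"
    then show "cmod (A $$ (i, j)) \<le> R"
      using entry_le_op_norm[of A n n i j] by (simp add: herm_ball_def herm_def)
  qed
  then show "emeasure (Lambda_tensor n :: ('v \<Rightarrow> complex mat) measure) (herm_tuples n R) < \<infinity>"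
    by (simp add: em power_less_top_ennreal)
  have "0 < (x :: ennreal) ^ k" if "0 < x" for x k
    using that by (induction k) (auto simp: ennreal_zero_less_mult_iff)
  then show "0 < emeasure (Lambda_tensor n :: ('v \<Rightarrow> complex mat) measure) (herm_tuples n R)"
    unfolding em using emeasure_Lambda_herm_ball_pos[OF assms] by blast
qed

text \<open>Restriction turns set integrals against a sigma-finite measure into plain integrals over
  a finite measure space, where bounded measurable functions are integrable.\<close>

definition tuple_measure :: "nat \<Rightarrow> real \<Rightarrow> ('v::finite \<Rightarrow> complex mat) measure" where
  "tuple_measure n R = restrict_space (Lambda_tensor n) (herm_tuples n R)"

lemma space_tuple_measure:
  fixes R :: real assumes "0 < R"
  shows "space (tuple_measure n R :: ('v::finite \<Rightarrow> complex mat) measure) = herm_tuples n R"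
  using sets.sets_into_space[OF Lambda_tensor_herm_tuples(1)[OF assms, of n, where 'v = 'v]]
  by (auto simp: tuple_measure_def space_restrict_space)

lemma finite_measure_tuple_measure:
  assumes "0 < R"
  shows "finite_measure (tuple_measure n R :: ('v::finite \<Rightarrow> complex mat) measure)"
proof
  have "emeasure (tuple_measure n R :: ('v \<Rightarrow> complex mat) measure) (herm_tuples n R) =
      emeasure (Lambda_tensor n :: ('v \<Rightarrow> complex mat) measure) (herm_tuples n R)"
    unfolding tuple_measure_def
    by (rule emeasure_restrict_space) (use Lambda_tensor_herm_tuples(1)[OF assms, of n, where 'v = 'v] in auto)
  then show "emeasure (tuple_measure n R :: ('v \<Rightarrow> complex mat) measure) (space (tuple_measure n R)) \<noteq> \<infinity>"
    using Lambda_tensor_herm_tuples(3)[OF assms, of n, where 'v = 'v] by (simp add: space_tuple_measure[OF assms])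
qed

lemma measure_tuple_measure_pos:
  assumes "0 < R"
  shows "0 < measure (tuple_measure n R :: ('v::finite \<Rightarrow> complex mat) measure) (space (tuple_measure n R))"
proof -
  have "emeasure (tuple_measure n R :: ('v \<Rightarrow> complex mat) measure) (herm_tuples n R) =
      emeasure (Lambda_tensor n :: ('v \<Rightarrow> complex mat) measure) (herm_tuples n R)"
    unfolding tuple_measure_def
    by (rule emeasure_restrict_space) (use Lambda_tensor_herm_tuples(1)[OF assms, of n, where 'v = 'v] in auto)
  then show ?thesis
    using Lambda_tensor_herm_tuples(2,3)[OF assms, of n, where 'v = 'v]
    by (simp add: space_tuple_measure[OF assms] measure_def enn2real_positive_iff)
qed

lemma set_integral_herm_tuples:
  fixes f :: "('v::finite \<Rightarrow> complex mat) \<Rightarrow> real"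
  assumes "0 < R"
  shows "(LINT A:herm_tuples n R|Lambda_tensor n. f A) = (LINT A|tuple_measure n R. f A)"
  unfolding tuple_measure_def set_lebesgue_integral_def
  by (rule integral_restrict_space[symmetric]) (use Lambda_tensor_herm_tuples(1)[OF assms, of n, where 'v = 'v] in auto)

section \<open>Measurability of traces of algebra elements\<close>

lemma measurable_word_eval:
  assumes "0 < R" "i < n" "j < n"
  shows "(\<lambda>A :: 'v::finite \<Rightarrow> complex mat. word_eval n w A $$ (i, j)) \<in> borel_measurable (tuple_measure n R)"
  using assms(2,3)
proof (induction w arbitrary: i j)
  case Nil
  then show ?case by (simp add: word_eval_def)
next
  case (Cons a w)
  have X: "(\<lambda>A :: 'v \<Rightarrow> complex mat. A a $$ (i, k)) \<in> borel_measurable (tuple_measure n R)" if "k < n" for k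
  proof -
    have "(\<lambda>A :: 'v \<Rightarrow> complex mat. A a) \<in> measurable (Lambda_tensor n) (Lambda n)"
      unfolding Lambda_tensor_def by (intro measurable_component_singleton) auto
    moreover have "(\<lambda>A. A $$ (i, k)) \<in> borel_measurable (Lambda n)"
      using measurable_entry[OF Cons.prems(1) that] measurable_cong_sets[OF sets_Lambda refl] by blast
    ultimately show ?thesis
      unfolding tuple_measure_def by (intro measurable_restrict_space1) (rule measurable_compose)
  qed
  have "(\<lambda>A :: 'v \<Rightarrow> complex mat. word_eval n (a # w) A $$ (i, j)) \<in> borel_measurable (tuple_measure n R) \<longleftrightarrow>
      (\<lambda>A :: 'v \<Rightarrow> complex mat. \<Sum>k<n. A a $$ (i, k) * word_eval n w A $$ (k, j)) \<in> borel_measurable (tuple_measure n R)"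
  proof (rule measurable_cong)
    fix A :: "'v \<Rightarrow> complex mat" assume "A \<in> space (tuple_measure n R)"
    then have A: "A i \<in> carrier_mat n n" for i
      using herm_tuplesD(1) by (auto simp: space_tuple_measure[OF assms(1)])
    have "word_eval n (a # w) A = A a * word_eval n w A" by (simp add: word_eval_def)
    then show "word_eval n (a # w) A $$ (i, j) = (\<Sum>k<n. A a $$ (i, k) * word_eval n w A $$ (k, j))"
      using A[of a] word_eval_carrier[of A n w, OF A] Cons.prems
      by (simp add: scalar_prod_def atLeast0LessThan)
  qed
  moreover have "(\<lambda>A :: 'v \<Rightarrow> complex mat. \<Sum>k<n. A a $$ (i, k) * word_eval n w A $$ (k, j)) \<in> borel_measurable (tuple_measure n R)"
    using Cons by (intro borel_measurable_sum borel_measurable_times X Cons.IH) auto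
  ultimately show ?case by simp
qed

lemma calA_limit:
  fixes h :: "'v cstar_elem"
  assumes h: "h \<in> calA R"
  shows "\<exists>P. \<forall>(n, A)\<in>mat_points R. h (n, A) \<in> carrier_mat n n \<and>
        (\<forall>i<n. \<forall>j<n. (\<lambda>k. nc_eval n (P k) A $$ (i, j)) \<longlonglongrightarrow> h (n, A) $$ (i, j))"
proof -
  have 1: "h \<in> extensional (mat_points R) \<and> (\<exists>P. nc_Cauchy R P \<and>
     (\<forall>(n, A)\<in>mat_points R. h (n, A) \<in> carrier_mat n n \<and>
        (\<forall>i<n. \<forall>j<n. (\<lambda>k. nc_eval n (P k) A $$ (i, j)) \<longlonglongrightarrow> h (n, A) $$ (i, j))))"
     using h by (simp only: calA_def mem_Collect_eq)
  show ?thesis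
    by (rule exE[OF conjunct2[OF 1]], erule conjE, rule exI)
qed

text \<open>An element of the completion has no formula, but its trace is the pointwise limit of
  traces of polynomials, which are polynomial in the matrix entries. The condition on n places the
  whole space of the measure inside \<open>mat_points R\<close>.\<close>

lemma measurable_ntrace_calA:
  fixes h :: "'v::finite cstar_elem"
  assumes R: "0 < R" and h: "h \<in> calA R" and n: "1 \<le> n"
  shows "(\<lambda>A. ntrace n (h (n, A))) \<in> borel_measurable (tuple_measure n R)"
proof -
  obtain P where P: "\<forall>(n, A)\<in>mat_points R. h (n, A) \<in> carrier_mat n n \<and>
        (\<forall>i<n. \<forall>j<n. (\<lambda>k. nc_eval n (P k) A $$ (i, j)) \<longlonglongrightarrow> h (n, A) $$ (i, j))"
    by (rule exE[OF calA_limit[OF h]])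
  have lim: "(\<lambda>k. nc_eval n (P k) A $$ (i, i)) \<longlonglongrightarrow> h (n, A) $$ (i, i)"
    if "(n, A) \<in> mat_points R" "i < n" for A i
    using bspec[OF P that(1)] that(2) by simp
  show ?thesis
  proof (rule borel_measurable_LIMSEQ_metric)
    fix k
    have "(\<lambda>A :: 'v \<Rightarrow> complex mat. nc_eval n (P k) A $$ (i, i)) \<in> borel_measurable (tuple_measure n R)" if "i < n" for i
    proof -
      have "(\<lambda>A :: 'v \<Rightarrow> complex mat. \<Sum>w\<in>Poly_Mapping.keys (P k). Poly_Mapping.lookup (P k) w * word_eval n w A $$ (i, i)) \<in> borel_measurable (tuple_measure n R)"
        by (intro borel_measurable_sum borel_measurable_times borel_measurable_const measurable_word_eval[OF R] that)
      then show ?thesis using that by (simp add: nc_eval_def)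
    qed
    then show "(\<lambda>A. ntrace n (nc_eval n (P k) A)) \<in> borel_measurable (tuple_measure n R)"
      unfolding ntrace_def by (intro borel_measurable_divide borel_measurable_sum borel_measurable_const) simp
  next
    fix A :: "'v \<Rightarrow> complex mat" assume "A \<in> space (tuple_measure n R)"
    then have "(n, A) \<in> mat_points R" using n by (simp add: space_tuple_measure[OF R] mat_points_def)
    from lim[OF this] n show "(\<lambda>k. ntrace n (nc_eval n (P k) A)) \<longlonglongrightarrow> ntrace n (h (n, A))"
      unfolding ntrace_def by (intro tendsto_divide tendsto_sum tendsto_const) auto
  qed
qed

section \<open>Operations on \<open>calA R\<close> and continuity of tracial states\<close>

lemma op_norm_zero_mat: "op_norm (0\<^sub>m n n) = 0"
  using op_norm_le_entries[of "0\<^sub>m n n" n n] op_norm_nonneg[of "0\<^sub>m n n"] by simp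

text \<open>For w the image of v under the adjoint, the square of the norm of w is the inner product
  of v with A w, hence at most |v| |A| |w| by Cauchy-Schwarz; then one factor |w| is
  cancelled.\<close>

lemma op_norm_adjoint_le:
  assumes A: "A \<in> carrier_mat m n"
  shows "op_norm (mat_adjoint A) \<le> op_norm A"
proof (rule op_norm_leI[OF mat_adjoint_carrier[OF A] op_norm_nonneg])
  fix v :: "complex vec" assume v: "v \<in> carrier_vec m"
  define w where "w = mat_adjoint A *\<^sub>v v"
  have w: "w \<in> carrier_vec n" unfolding w_def by (rule mult_mat_vec_carrier[OF mat_adjoint_carrier[OF A] v])
  have wi: "vec_index w i = (\<Sum>j<m. cnj (A $$ (j, i)) * vec_index v j)" if "i < n" for i
    using that v mat_adjoint_carrier[OF A] unfolding w_def
    by (simp add: scalar_prod_def atLeast0LessThan mat_adjoint_index[OF A])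
  have Aw: "vec_index (A *\<^sub>v w) j = (\<Sum>i<n. A $$ (j, i) * vec_index w i)" if "j < m" for j
    using that w A by (simp add: scalar_prod_def atLeast0LessThan)
  have "complex_of_real ((cvec_norm w)\<^sup>2) = (\<Sum>i<n. vec_index w i * cnj (vec_index w i))"
    using w by (simp add: cvec_norm_L2 L2_set_def sum_nonneg complex_norm_square del: of_real_power)
  also have "\<dots> = (\<Sum>i<n. \<Sum>j<m. vec_index v j * cnj (A $$ (j, i) * vec_index w i))"
    by (simp add: wi sum_distrib_right mult_ac)
  also have "\<dots> = (\<Sum>j<m. vec_index v j * cnj (vec_index (A *\<^sub>v w) j))"
    by (subst sum.swap) (simp add: Aw sum_distrib_left del: index_mult_mat_vec)
  finally have "(cvec_norm w)\<^sup>2 = cmod (\<Sum>j<m. vec_index v j * cnj (vec_index (A *\<^sub>v w) j))"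
    by (metis abs_of_nonneg norm_of_real zero_le_power2)
  also have "\<dots> \<le> (\<Sum>j<m. \<bar>cmod (vec_index v j)\<bar> * \<bar>cmod (vec_index (A *\<^sub>v w) j)\<bar>)"
    by (intro sum_norm_le) (simp add: norm_mult del: index_mult_mat_vec)
  also have "\<dots> \<le> cvec_norm v * cvec_norm (A *\<^sub>v w)"
    using L2_set_mult_ineq[of "\<lambda>j. cmod (vec_index v j)" "\<lambda>j. cmod (vec_index (A *\<^sub>v w) j)" "{..<m}"] v w A
    by (simp add: cvec_norm_L2 del: index_mult_mat_vec)
  also have "\<dots> \<le> cvec_norm v * (op_norm A * cvec_norm w)"
    by (intro mult_left_mono op_norm_mult_vec[OF A w]) simp
  finally have *: "cvec_norm w * cvec_norm w \<le> (op_norm A * cvec_norm v) * cvec_norm w"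
    by (simp add: power2_eq_square mult_ac)
  show "cvec_norm (mat_adjoint A *\<^sub>v v) \<le> op_norm A * cvec_norm v"
  proof (cases "cvec_norm w = 0")
    case True
    then show ?thesis by (simp add: w_def)
  next
    case False
    then have "0 < cvec_norm w" using cvec_norm_nonneg[of w] by linarith
    from mult_right_le_imp_le[OF * this] show ?thesis by (simp add: w_def)
  qed
qed

lemma mat_adjoint_minus:
  fixes A B :: "complex mat"
  assumes A: "A \<in> carrier_mat m n" and B: "B \<in> carrier_mat m n"
  shows "mat_adjoint (A - B) = mat_adjoint A - mat_adjoint B"
  using mat_adjoint_carrier[OF A] mat_adjoint_carrier[OF B] mat_adjoint_carrier[OF minus_carrier_mat[OF B, of A]] A B
  by (intro eq_matI)
    (auto simp: mat_adjoint_index[OF A] mat_adjoint_index[OF B] mat_adjoint_index[OF minus_carrier_mat[OF B, of A]])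

text \<open>Inserting A Q splits the difference into A (B - Q) and (A - P) Q. The estimate serves
  both the closure of \<open>calA R\<close> under products and the contraction property of the
  square root iteration.\<close>

lemma op_norm_mult_diff_le:
  assumes C: "A \<in> carrier_mat n n" "B \<in> carrier_mat n n" "P \<in> carrier_mat n n" "Q \<in> carrier_mat n n"
  shows "op_norm (A * B - P * Q) \<le> op_norm A * op_norm (B - Q) + op_norm (A - P) * op_norm Q"
proof -
  have "op_norm (A * B - P * Q) \<le> op_norm (A * B - A * Q) + op_norm (A * Q - P * Q)"
    using C by (intro op_norm_diff_triangle[of _ n n]) auto
  also have "A * B - A * Q = A * (B - Q)"
    by (rule mult_minus_distrib_mat[OF C(1,2,4), symmetric])
  also have "A * Q - P * Q = (A - P) * Q"
    by (rule minus_mult_distrib_mat[OF C(1,3,4), symmetric])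
  also have "op_norm (A * (B - Q)) \<le> op_norm A * op_norm (B - Q)"
    using C by (intro op_norm_mult minus_carrier_mat) auto
  also have "op_norm ((A - P) * Q) \<le> op_norm (A - P) * op_norm Q"
    using C by (intro op_norm_mult[of _ n n _ n] minus_carrier_mat) auto
  finally show ?thesis by simp
qed

lemma ntrace_add:
  assumes "A \<in> carrier_mat n n" "B \<in> carrier_mat n n"
  shows "ntrace n (A + B) = ntrace n A + ntrace n B"
  using assms by (simp add: ntrace_def sum.distrib add_divide_distrib)

lemma ntrace_smult:
  assumes "A \<in> carrier_mat n n"
  shows "ntrace n (c \<cdot>\<^sub>m A) = c * ntrace n A"
  using assms by (simp add: ntrace_def sum_distrib_left)

lemma ntrace_one: "1 \<le> n \<Longrightarrow> ntrace n (1\<^sub>m n) = 1"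
  by (simp add: ntrace_def)

lemma ntrace_mult_commute:
  assumes A: "A \<in> carrier_mat n n" and B: "B \<in> carrier_mat n n"
  shows "ntrace n (A * B) = ntrace n (B * A)"
proof -
  have "(\<Sum>i<n. (A * B) $$ (i, i)) = (\<Sum>i<n. \<Sum>j<n. A $$ (i, j) * B $$ (j, i))"
    using A B by (intro sum.cong) (auto simp: scalar_prod_def atLeast0LessThan)
  also have "\<dots> = (\<Sum>j<n. \<Sum>i<n. B $$ (j, i) * A $$ (i, j))"
    by (subst sum.swap) (simp add: mult.commute)
  also have "\<dots> = (\<Sum>i<n. (B * A) $$ (i, i))"
    using A B by (intro sum.cong) (auto simp: scalar_prod_def atLeast0LessThan)
  finally show ?thesis by (simp add: ntrace_def)
qed

text \<open>This is the normalized Hilbert-Schmidt norm squared; being real and nonnegative, it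
  yields positivity of the Gibbs states.\<close>

lemma ntrace_adjoint_mult:
  assumes A: "A \<in> carrier_mat n n"
  shows "ntrace n (mat_adjoint A * A) = complex_of_real ((\<Sum>i<n. \<Sum>j<n. (cmod (A $$ (j, i)))\<^sup>2) / real n)"
proof -
  have "(mat_adjoint A * A) $$ (i, i) = (\<Sum>j<n. complex_of_real ((cmod (A $$ (j, i)))\<^sup>2))" if "i < n" for i
    using that A mat_adjoint_carrier[OF A]
    by (simp add: scalar_prod_def atLeast0LessThan mat_adjoint_index[OF A] complex_norm_square mult.commute del: of_real_power)
  then show ?thesis by (simp add: ntrace_def)
qed

lemma cmod_ntrace_le:
  assumes A: "A \<in> carrier_mat n n" and n: "1 \<le> n"
  shows "cmod (ntrace n A) \<le> op_norm A"
proof -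
  have "cmod (\<Sum>i<n. A $$ (i, i)) \<le> (\<Sum>i<n. op_norm A)"
    by (intro sum_norm_le entry_le_op_norm[OF A]) auto
  then show ?thesis using n by (simp add: ntrace_def norm_divide field_simps)
qed

section \<open>Closure of the completion under the algebra operations\<close>

lemma calA_approx:
  fixes h :: "'v cstar_elem"
  assumes "0 \<le> R" "h \<in> calA R" "0 < e"
  obtains p where "\<And>n A. (n, A) \<in> mat_points R \<Longrightarrow> op_norm (h (n, A) - nc_eval n p A) \<le> e"
proof -
  have "\<forall>\<epsilon>>0. \<exists>p. \<forall>(n, A)\<in>mat_points R. op_norm (h (n, A) - nc_eval n p A) \<le> \<epsilon>"
    using assms(2) unfolding calA_iff_uniform_limit[OF assms(1)] by (elim conjE)
  then have "\<exists>p. \<forall>(n, A)\<in>mat_points R. op_norm (h (n, A) - nc_eval n p A) \<le> e" using assms(3) by (elim allE impE)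
  then obtain p where p: "\<forall>(n, A)\<in>mat_points R. op_norm (h (n, A) - nc_eval n p A) \<le> e" by (rule exE)
  show thesis
  proof (rule that)
    fix n and A :: "'v \<Rightarrow> complex mat" assume "(n, A) \<in> mat_points R"
    from bspec[OF p this] show "op_norm (h (n, A) - nc_eval n p A) \<le> e" by simp
  qed
qed

lemma calA_I:
  assumes "0 \<le> R" "h \<in> extensional (mat_points R)"
    and "\<And>n A. (n, A) \<in> mat_points R \<Longrightarrow> h (n, A) \<in> carrier_mat n n"
    and "\<And>e. 0 < e \<Longrightarrow> \<exists>p. \<forall>n A. (n, A) \<in> mat_points R \<longrightarrow> op_norm (h (n, A) - nc_eval n p A) \<le> e"
  shows "h \<in> calA R"
proof -
  have "\<exists>p. \<forall>(n, A)\<in>mat_points R. op_norm (h (n, A) - nc_eval n p A) \<le> e" if "0 < e" for e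
    using assms(4)[OF that] by (rule ex_forward) (simp add: Ball_def)
  moreover have "\<forall>(n, A)\<in>mat_points R. h (n, A) \<in> carrier_mat n n"
    using assms(3) by (simp add: Ball_def)
  ultimately show ?thesis
    unfolding calA_iff_uniform_limit[OF assms(1)] using assms(2) by simp
qed

lemma calA_extensional: "h \<in> calA R \<Longrightarrow> h \<in> extensional (mat_points R)"
  by (simp add: calA_def)

lemma nc_eval_uniform_bound:
  fixes p :: "'v ncpoly"
  obtains K where "0 \<le> K" "\<And>n A. (n, A) \<in> mat_points R \<Longrightarrow> op_norm (nc_eval n p A) \<le> K"
proof -
  obtain K where K: "\<forall>(n, A)\<in>mat_points R. op_norm (nc_eval n p A) \<le> K"
    by (rule exE[OF nc_eval_bounded])
  show thesis
  proof (rule that[of "max K 0"])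
    fix n and A :: "'v \<Rightarrow> complex mat" assume "(n, A) \<in> mat_points R"
    from bspec[OF K this] show "op_norm (nc_eval n p A) \<le> max K 0" by simp
  qed simp
qed

text \<open>A polynomial at distance at most 1 passes on its own uniform bound.\<close>

lemma calA_uniform_bound:
  fixes h :: "'v cstar_elem"
  assumes "0 \<le> R" "h \<in> calA R"
  obtains K where "0 \<le> K" "\<And>n A. (n, A) \<in> mat_points R \<Longrightarrow> op_norm (h (n, A)) \<le> K"
proof -
  have "0 < (1::real)" by simp
  then obtain p where p: "\<And>n A. (n, A) \<in> mat_points R \<Longrightarrow> op_norm (h (n, A) - nc_eval n p A) \<le> 1"
    using calA_approx[OF assms] by blast
  obtain K where K: "0 \<le> K" "\<And>n A. (n, A) \<in> mat_points R \<Longrightarrow> op_norm (nc_eval n p A) \<le> K"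
    using nc_eval_uniform_bound[of R p] by blast
  show thesis
  proof (rule that[of "1 + K"])
    fix n and A :: "'v \<Rightarrow> complex mat" assume nA: "(n, A) \<in> mat_points R"
    note C = calA_carrier[OF assms(2) nA] nc_eval_carrier[of n p A]
    have "h (n, A) = (h (n, A) - nc_eval n p A) + nc_eval n p A"
      using C by (intro eq_matI) (auto simp del: nc_eval_carrier)
    then have "op_norm (h (n, A)) \<le> op_norm (h (n, A) - nc_eval n p A) + op_norm (nc_eval n p A)"
      using op_norm_add[OF minus_carrier_mat[OF C(2)] C(2)] by metis
    then show "op_norm (h (n, A)) \<le> 1 + K" using p[OF nA] K(2)[OF nA] by simp
  qed (use K in simp)
qed

lemma calA_add_closed:
  assumes R: "0 \<le> R" and h: "h \<in> calA R" and k: "k \<in> calA R"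
  shows "calA_add R h k \<in> calA R"
proof (rule calA_I[OF R])
  note C = calA_carrier[OF h] calA_carrier[OF k]
  show "calA_add R h k \<in> extensional (mat_points R)" by (simp add: calA_add_def)
  show "calA_add R h k (n, A) \<in> carrier_mat n n" if "(n, A) \<in> mat_points R" for n A
    using C[OF that] that by (simp add: calA_add_def)
  fix e :: real assume "0 < e"
  then have e: "0 < e / 2" by simp
  obtain p where p: "\<And>n A. (n, A) \<in> mat_points R \<Longrightarrow> op_norm (h (n, A) - nc_eval n p A) \<le> e / 2"
    using calA_approx[OF R h e] by blast
  obtain q where q: "\<And>n A. (n, A) \<in> mat_points R \<Longrightarrow> op_norm (k (n, A) - nc_eval n q A) \<le> e / 2"
    using calA_approx[OF R k e] by blast
  have "op_norm (calA_add R h k (n, A) - nc_eval n (p + q) A) \<le> e" if nA: "(n, A) \<in> mat_points R" for n A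
  proof -
    note D = C[OF nA] nc_eval_carrier[of n _ A]
    have "calA_add R h k (n, A) - nc_eval n (p + q) A = (h (n, A) - nc_eval n p A) + (k (n, A) - nc_eval n q A)"
      using D(1,2) D(3)[of p] D(3)[of q] nA
      by (intro eq_matI) (auto simp: calA_add_def nc_eval_add simp del: nc_eval_carrier)
    then show ?thesis
      using op_norm_add[OF minus_carrier_mat[OF D(3)[of p], of "h (n, A)"] minus_carrier_mat[OF D(3)[of q], of "k (n, A)"]]
        p[OF nA] q[OF nA] by simp
  qed
  then show "\<exists>r. \<forall>n A. (n, A) \<in> mat_points R \<longrightarrow> op_norm (calA_add R h k (n, A) - nc_eval n r A) \<le> e"
    by (intro exI[of _ "p + q"]) simp
qed

lemma calA_scale_closed:
  assumes R: "0 \<le> R" and h: "h \<in> calA R"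
  shows "calA_scale R c h \<in> calA R"
proof (rule calA_I[OF R])
  note C = calA_carrier[OF h]
  show "calA_scale R c h \<in> extensional (mat_points R)" by (simp add: calA_scale_def)
  show "calA_scale R c h (n, A) \<in> carrier_mat n n" if "(n, A) \<in> mat_points R" for n A
    using C[OF that] that by (simp add: calA_scale_def)
  fix e :: real assume e: "0 < e"
  \<comment> \<open>Dividing the tolerance by \<open>cmod c + 1\<close> covers c = 0 as
    well.\<close>
  have pos: "0 < cmod c + 1" using norm_ge_zero[of c] by linarith
  obtain p where p: "\<And>n A. (n, A) \<in> mat_points R \<Longrightarrow> op_norm (h (n, A) - nc_eval n p A) \<le> e / (cmod c + 1)"
    using calA_approx[OF R h divide_pos_pos[OF e pos]] by blast
  have "op_norm (calA_scale R c h (n, A) - nc_eval n (nc_scale c p) A) \<le> e" if nA: "(n, A) \<in> mat_points R" for n A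
  proof -
    note D = C[OF nA] nc_eval_carrier[of n p A]
    have "calA_scale R c h (n, A) - nc_eval n (nc_scale c p) A = c \<cdot>\<^sub>m (h (n, A) - nc_eval n p A)"
      unfolding nc_eval_scale[of A n, OF herm_tuplesD(1)[OF mat_pointsD[OF nA]]] using D nA
      by (intro eq_matI) (auto simp: calA_scale_def algebra_simps simp del: nc_eval_carrier)
    then have "op_norm (calA_scale R c h (n, A) - nc_eval n (nc_scale c p) A) \<le> cmod c * op_norm (h (n, A) - nc_eval n p A)"
      using op_norm_smult[OF minus_carrier_mat[OF D(2)]] by simp
    also have "\<dots> \<le> cmod c * (e / (cmod c + 1))"
      by (intro mult_left_mono p[OF nA]) simp
    also have "\<dots> \<le> (cmod c + 1) * (e / (cmod c + 1))"
      using e pos by (intro mult_right_mono) auto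
    also have "\<dots> = e" using pos by simp
    finally show ?thesis .
  qed
  then show "\<exists>r. \<forall>n A. (n, A) \<in> mat_points R \<longrightarrow> op_norm (calA_scale R c h (n, A) - nc_eval n r A) \<le> e"
    by (intro exI[of _ "nc_scale c p"]) simp
qed

lemma calA_star_closed:
  assumes R: "0 \<le> R" and h: "h \<in> calA R"
  shows "calA_star R h \<in> calA R"
proof (rule calA_I[OF R])
  note C = calA_carrier[OF h]
  show "calA_star R h \<in> extensional (mat_points R)" by (simp add: calA_star_def)
  show "calA_star R h (n, A) \<in> carrier_mat n n" if "(n, A) \<in> mat_points R" for n A
    using mat_adjoint_carrier[OF C[OF that]] that by (simp add: calA_star_def)
  fix e :: real assume e: "0 < e"
  obtain p where p: "\<And>n A. (n, A) \<in> mat_points R \<Longrightarrow> op_norm (h (n, A) - nc_eval n p A) \<le> e"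
    using calA_approx[OF R h e] by blast
  have "op_norm (calA_star R h (n, A) - nc_eval n (nc_star p) A) \<le> e" if nA: "(n, A) \<in> mat_points R" for n A
    unfolding nc_eval_star[OF mat_pointsD[OF nA]]
    using op_norm_adjoint_le[OF minus_carrier_mat[OF nc_eval_carrier[of n p A]], of "h (n, A)"] p[OF nA] nA
    by (simp add: calA_star_def mat_adjoint_minus[OF C[OF nA] nc_eval_carrier])
  then show "\<exists>r. \<forall>n A. (n, A) \<in> mat_points R \<longrightarrow> op_norm (calA_star R h (n, A) - nc_eval n r A) \<le> e"
    by (intro exI[of _ "nc_star p"]) simp
qed

lemma calA_mult_closed:
  assumes R: "0 \<le> R" and h: "h \<in> calA R" and k: "k \<in> calA R"
  shows "calA_mult R h k \<in> calA R"
proof (rule calA_I[OF R])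
  note C = calA_carrier[OF h] calA_carrier[OF k]
  show "calA_mult R h k \<in> extensional (mat_points R)" by (simp add: calA_mult_def)
  show "calA_mult R h k (n, A) \<in> carrier_mat n n" if "(n, A) \<in> mat_points R" for n A
    using C[OF that] that by (simp add: calA_mult_def)
  fix e :: real assume e: "0 < e"
  \<comment> \<open>The order of choices matters: q approximates k with a tolerance set by the bound
    of h, and only then p approximates h with a tolerance set by the bound of q. Adding 1 to each
    bound makes it a positive divisor.\<close>
  obtain K0 where K0: "0 \<le> K0" "\<And>n A. (n, A) \<in> mat_points R \<Longrightarrow> op_norm (h (n, A)) \<le> K0"
    using calA_uniform_bound[OF R h] by blast
  define K where "K = K0 + 1"
  have K: "0 < K" "\<And>n A. (n, A) \<in> mat_points R \<Longrightarrow> op_norm (h (n, A)) \<le> K"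
    using K0(1) order_trans[OF K0(2), of _ _ K] by (simp_all add: K_def)
  have e1: "0 < e / 2 / K" using e K by simp
  obtain q where q: "\<And>n A. (n, A) \<in> mat_points R \<Longrightarrow> op_norm (k (n, A) - nc_eval n q A) \<le> e / 2 / K"
    using calA_approx[OF R k e1] by blast
  obtain L0 where L0: "0 \<le> L0" "\<And>n A. (n, A) \<in> mat_points R \<Longrightarrow> op_norm (nc_eval n q A) \<le> L0"
    using nc_eval_uniform_bound[of R q] by blast
  define L where "L = L0 + 1"
  have L: "0 < L" "\<And>n A. (n, A) \<in> mat_points R \<Longrightarrow> op_norm (nc_eval n q A) \<le> L"
    using L0(1) order_trans[OF L0(2), of _ _ L] by (simp_all add: L_def)
  have e2: "0 < e / 2 / L" using e L by simp
  obtain p where p: "\<And>n A. (n, A) \<in> mat_points R \<Longrightarrow> op_norm (h (n, A) - nc_eval n p A) \<le> e / 2 / L"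
    using calA_approx[OF R h e2] by blast
  have "op_norm (calA_mult R h k (n, A) - nc_eval n (p * q) A) \<le> e" if nA: "(n, A) \<in> mat_points R" for n A
  proof -
    note D = C[OF nA] nc_eval_carrier[of n _ A]
    have "op_norm (calA_mult R h k (n, A) - nc_eval n (p * q) A) =
        op_norm (h (n, A) * k (n, A) - nc_eval n p A * nc_eval n q A)"
      using nA by (simp add: calA_mult_def nc_eval_mult[OF herm_tuplesD(1)[OF mat_pointsD[OF nA]]])
    also have "\<dots> \<le> op_norm (h (n, A)) * op_norm (k (n, A) - nc_eval n q A) +
        op_norm (h (n, A) - nc_eval n p A) * op_norm (nc_eval n q A)"
      by (rule op_norm_mult_diff_le[OF D(1,2) D(3) D(3)])
    also have "\<dots> \<le> K * (e / 2 / K) + e / 2 / L * L"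
      using K(1) K(2)[OF nA] L(1) L(2)[OF nA] e1 e2
      by (intro add_mono mult_mono q[OF nA] p[OF nA]) auto
    also have "\<dots> = e" using K(1) L(1) by simp
    finally show ?thesis .
  qed
  then show "\<exists>r. \<forall>n A. (n, A) \<in> mat_points R \<longrightarrow> op_norm (calA_mult R h k (n, A) - nc_eval n r A) \<le> e"
    by (intro exI[of _ "p * q"]) simp
qed

lemma calA_one_closed: "0 \<le> R \<Longrightarrow> calA_one R \<in> calA R"
  using nc_embed_calA[of R 1] by (simp add: nc_embed_one)

text \<open>An approximant q is symmetrized to half the sum of q and its adjoint. Since h is
  selfadjoint, the new error is the average of h - q and its adjoint, so the tolerance e is
  kept.\<close>

lemma nc_sa_approx:
  fixes h :: "'v cstar_elem"
  assumes R: "0 \<le> R" and h: "h \<in> calA_sa R" and e: "0 < e"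
  obtains p where "p \<in> nc_sa" "\<And>n A. (n, A) \<in> mat_points R \<Longrightarrow> op_norm (h (n, A) - nc_eval n p A) \<le> e"
proof -
  have hA: "h \<in> calA R" and hs: "calA_star R h = h" using h by (auto simp: calA_sa_def)
  obtain q where q: "\<And>n A. (n, A) \<in> mat_points R \<Longrightarrow> op_norm (h (n, A) - nc_eval n q A) \<le> e"
    using calA_approx[OF R hA e] by blast
  define p where "p = nc_scale (1/2) q + nc_scale (1/2) (nc_star q)"
  have lookup: "Poly_Mapping.lookup (nc_scale c r) w = c * Poly_Mapping.lookup r w" for c w and r :: "'v ncpoly"
  proof (induction r rule: ncpoly_induct)
    case (single_add u d r)
    then show ?case
      by (simp add: nc_scale_def distrib_left mult_single plus_list_def lookup_add lookup_single when_def)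
  qed (simp add: nc_scale_def)
  have "p \<in> nc_sa"
    unfolding nc_sa_def p_def
    by (simp, rule poly_mapping_eqI) (simp add: lookup_nc_star lookup lookup_add)
  moreover have "op_norm (h (n, A) - nc_eval n p A) \<le> e" if nA: "(n, A) \<in> mat_points R" for n A
  proof -
    note C = calA_carrier[OF hA nA] nc_eval_carrier[of n _ A]
    note cA = herm_tuplesD(1)[OF mat_pointsD[OF nA]]
    let ?D = "h (n, A) - nc_eval n q A"
    have D: "?D \<in> carrier_mat n n" by (rule minus_carrier_mat[OF C(2)])
    have hadj: "mat_adjoint (h (n, A)) = h (n, A)"
      using fun_cong[OF hs, of "(n, A)"] nA by (simp add: calA_star_def)
    have Ds: "mat_adjoint ?D = h (n, A) - nc_eval n (nc_star q) A"
      by (simp add: mat_adjoint_minus[OF C] hadj nc_eval_star[OF mat_pointsD[OF nA]])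
    have "h (n, A) - nc_eval n p A = (1/2) \<cdot>\<^sub>m ?D + (1/2) \<cdot>\<^sub>m mat_adjoint ?D"
      unfolding Ds p_def nc_eval_add nc_eval_scale[of A n, OF cA]
      using C(1) C(2)[of q] C(2)[of "nc_star q"]
      by (intro eq_matI) (auto simp: field_simps simp del: nc_eval_carrier)
    then have "op_norm (h (n, A) - nc_eval n p A) \<le> op_norm ((1/2) \<cdot>\<^sub>m ?D) + op_norm ((1/2) \<cdot>\<^sub>m mat_adjoint ?D)"
      using op_norm_add[OF smult_carrier_mat[OF D] smult_carrier_mat[OF mat_adjoint_carrier[OF D]]] by metis
    also have "\<dots> \<le> 1/2 * op_norm ?D + 1/2 * op_norm (mat_adjoint ?D)"
      using op_norm_smult[OF D, of "1/2"] op_norm_smult[OF mat_adjoint_carrier[OF D], of "1/2"] by (simp add: norm_divide)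
    also have "\<dots> \<le> e" using op_norm_adjoint_le[OF D] q[OF nA] by simp
    finally show ?thesis .
  qed
  ultimately show thesis by (rule that)
qed

section \<open>Square roots near the unit and norm continuity of states\<close>

lemma calA_sa_adjoint:
  assumes "h \<in> calA_sa R" "(n, A) \<in> mat_points R"
  shows "mat_adjoint (h (n, A)) = h (n, A)"
proof -
  have "calA_star R h = h" using assms(1) by (simp add: calA_sa_def)
  from fun_cong[OF this, of "(n, A)"] show ?thesis using assms(2) by (simp add: calA_star_def)
qed

lemma calA_saI:
  fixes h :: "'v cstar_elem"
  assumes h: "h \<in> calA R" and adj: "\<And>n A. (n, A) \<in> mat_points R \<Longrightarrow> mat_adjoint (h (n, A)) = h (n, A)"
  shows "h \<in> calA_sa R"
proof -
  have "calA_star R h = h"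
  proof (rule extensionalityI)
    show "calA_star R h \<in> extensional (mat_points R)" by (simp add: calA_star_def)
    show "h \<in> extensional (mat_points R)" by (rule calA_extensional[OF h])
    fix x :: "nat \<times> ('v \<Rightarrow> complex mat)" assume "x \<in> mat_points R"
    then show "calA_star R h x = h x" using adj by (cases x) (simp add: calA_star_def)
  qed
  then show ?thesis using h by (simp add: calA_sa_def)
qed

text \<open>A fixed point \<open>y\<close> of \<open>y \<mapsto> (h + y\<^sup>2) / 2\<close> satisfies \<open>(1 - y)\<^sup>2 = 1 - h\<close>, and for
  \<open>\<parallel>h\<parallel> \<le> 1/2\<close> this map is a contraction of the ball of radius \<open>1/2\<close>.\<close>

definition sqrt_step :: "real \<Rightarrow> 'v cstar_elem \<Rightarrow> 'v cstar_elem \<Rightarrow> 'v cstar_elem" where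
  "sqrt_step R h y = calA_scale R (1/2) (calA_add R h (calA_mult R y y))"

lemma sqrt_step_apply:
  "x \<in> mat_points R \<Longrightarrow> sqrt_step R h y x = (1/2) \<cdot>\<^sub>m (h x + y x * y x)"
  by (simp add: sqrt_step_def calA_scale_def calA_add_def calA_mult_def)

text \<open>Picard iteration started at the zero of the algebra, which is written as
  \<open>calA_scale R 0 h\<close>.\<close>

definition sqrt_iter :: "real \<Rightarrow> 'v cstar_elem \<Rightarrow> nat \<Rightarrow> 'v cstar_elem" where
  "sqrt_iter R h k = (sqrt_step R h ^^ k) (calA_scale R 0 h)"

lemma sqrt_iter_Suc: "sqrt_iter R h (Suc k) = sqrt_step R h (sqrt_iter R h k)"
  by (simp add: sqrt_iter_def)

lemma op_norm_smult_half:
  assumes "A \<in> carrier_mat n n"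
  shows "op_norm ((1/2) \<cdot>\<^sub>m A) \<le> op_norm A / 2"
  using op_norm_smult[OF assms, of "1/2"] by (simp add: norm_divide)

text \<open>Invariants of the iteration: the iterates stay selfadjoint, because the square of a
  selfadjoint element is selfadjoint, and stay in the ball of radius 1/2 on which the map
  contracts.\<close>

lemma sqrt_iter_props:
  fixes h :: "'v cstar_elem"
  assumes R: "0 \<le> R" and h: "h \<in> calA_sa R"
    and le: "\<forall>x\<in>mat_points R. op_norm (h x) \<le> 1/2"
  shows "sqrt_iter R h k \<in> calA R"
    and "(n, A) \<in> mat_points R \<Longrightarrow> mat_adjoint (sqrt_iter R h k (n, A)) = sqrt_iter R h k (n, A)"
    and "(n, A) \<in> mat_points R \<Longrightarrow> op_norm (sqrt_iter R h k (n, A)) \<le> 1/2"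
proof -
  have hA: "h \<in> calA R" using h by (simp add: calA_sa_def)
  show cl: "sqrt_iter R h k \<in> calA R" for k
  proof (induction k)
    case 0
    show ?case by (simp add: sqrt_iter_def calA_scale_closed[OF R hA])
  next
    case (Suc k)
    then show ?case
      unfolding sqrt_iter_Suc sqrt_step_def
      by (intro calA_scale_closed calA_add_closed calA_mult_closed R hA)
  qed
  assume nA: "(n, A) \<in> mat_points R"
  note hC = calA_carrier[OF hA nA]
  note C = calA_carrier[OF cl nA]
  have zero: "sqrt_iter R h 0 (n, A) = 0\<^sub>m n n"
    using nA hC by (auto simp: sqrt_iter_def calA_scale_def intro!: eq_matI)
  show "mat_adjoint (sqrt_iter R h k (n, A)) = sqrt_iter R h k (n, A)"
  proof (induction k)
    case 0
    show ?case unfolding zero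
      using mat_adjoint_carrier[OF zero_carrier_mat[of n n]]
      by (intro eq_matI) (auto simp: mat_adjoint_index[OF zero_carrier_mat])
  next
    case (Suc k)
    show ?case
      unfolding sqrt_iter_Suc sqrt_step_apply[OF nA]
      by (simp add: mat_adjoint_smult[OF add_carrier_mat[OF mult_carrier_mat[OF C C]]]
          mat_adjoint_add[OF hC mult_carrier_mat[OF C C]] mat_adjoint_mult[OF C C] Suc calA_sa_adjoint[OF h nA])
  qed
  show "op_norm (sqrt_iter R h k (n, A)) \<le> 1/2"
  proof (induction k)
    case 0
    show ?case unfolding zero by (simp add: op_norm_zero_mat)
  next
    case (Suc k)
    let ?y = "sqrt_iter R h k (n, A)"
    have "op_norm (h (n, A) + ?y * ?y) \<le> op_norm (h (n, A)) + op_norm ?y * op_norm ?y"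
      using op_norm_add[OF hC mult_carrier_mat[OF C[of k] C[of k]]] op_norm_mult[OF C[of k] C[of k]] by linarith
    \<comment> \<open>Halving this gives 3/8, which is within the radius 1/2.\<close>
    also have "\<dots> \<le> 1/2 + 1/2 * (1/2)"
      using Suc by (intro add_mono bspec[OF le nA] mult_mono) auto
    finally show ?case
      unfolding sqrt_iter_Suc sqrt_step_apply[OF nA]
      using op_norm_smult_half[OF add_carrier_mat[OF mult_carrier_mat[OF C[of k] C[of k]]], of "h (n, A)"] by simp
  qed
qed

text \<open>On the ball of radius 1/2 a difference of squares is no larger than the difference
  itself, so the factor 1/2 in the step is the contraction ratio. The first difference is at most
  1/2 + 1/2 = 1.\<close>

lemma sqrt_iter_diff:
  fixes h :: "'v cstar_elem"
  assumes R: "0 \<le> R" and h: "h \<in> calA_sa R"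
    and le: "\<forall>x\<in>mat_points R. op_norm (h x) \<le> 1/2"
    and nA: "(n, A) \<in> mat_points R"
  shows "op_norm (sqrt_iter R h (Suc k) (n, A) - sqrt_iter R h k (n, A)) \<le> (1/2) ^ k"
proof -
  note P = sqrt_iter_props[OF R h le]
  note C = calA_carrier[OF P(1) nA] and N = P(3)[OF nA]
  have hC: "h (n, A) \<in> carrier_mat n n" using h nA by (auto simp: calA_sa_def intro: calA_carrier)
  show ?thesis
  proof (induction k)
    case 0
    let ?a = "sqrt_iter R h (Suc 0) (n, A)" and ?b = "sqrt_iter R h 0 (n, A)"
    have "?a - ?b = ?a + (-1) \<cdot>\<^sub>m ?b" using C[of 0] C[of "Suc 0"] by (intro eq_matI) auto
    then have "op_norm (?a - ?b) \<le> op_norm ?a + op_norm ?b"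
      using op_norm_add[OF C[of "Suc 0"] smult_carrier_mat[OF C[of 0], of "-1"]] op_norm_smult[OF C[of 0], of "-1"] by simp
    then show ?case using N[of 0] N[of "Suc 0"] by simp
  next
    case (Suc k)
    let ?a = "sqrt_iter R h (Suc k) (n, A)" and ?b = "sqrt_iter R h k (n, A)"
    have 1: "sqrt_iter R h (Suc (Suc k)) (n, A) = (1/2) \<cdot>\<^sub>m (h (n, A) + ?a * ?a)"
      by (simp only: sqrt_iter_Suc[of R h "Suc k"] sqrt_step_apply[OF nA])
    have 2: "?a = (1/2) \<cdot>\<^sub>m (h (n, A) + ?b * ?b)"
      by (simp only: sqrt_iter_Suc[of R h k] sqrt_step_apply[OF nA])
    have "(1/2) \<cdot>\<^sub>m (h (n, A) + X) - (1/2) \<cdot>\<^sub>m (h (n, A) + Y) = (1/2) \<cdot>\<^sub>m (X - Y)"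
      if "X \<in> carrier_mat n n" "Y \<in> carrier_mat n n" for X Y :: "complex mat"
      using hC that by (intro eq_matI) (auto simp: field_simps)
    from this[OF mult_carrier_mat[OF C[of "Suc k"] C[of "Suc k"]] mult_carrier_mat[OF C[of k] C[of k]], folded 1 2]
    have "sqrt_iter R h (Suc (Suc k)) (n, A) - ?a = (1/2) \<cdot>\<^sub>m (?a * ?a - ?b * ?b)" .
    then have "op_norm (sqrt_iter R h (Suc (Suc k)) (n, A) - sqrt_iter R h (Suc k) (n, A)) \<le> op_norm (?a * ?a - ?b * ?b) / 2"
      using op_norm_smult_half[OF minus_carrier_mat[OF mult_carrier_mat[OF C[of k] C[of k]]]] by metis
    also have "op_norm (?a * ?a - ?b * ?b) \<le> op_norm ?a * op_norm (?a - ?b) + op_norm (?a - ?b) * op_norm ?b"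
      by (rule op_norm_mult_diff_le[OF C C C C])
    also have "\<dots> \<le> 1/2 * (1/2) ^ k + (1/2) ^ k * (1/2)"
      by (intro add_mono mult_mono N Suc) auto
    finally show ?case by simp
  qed
qed

text \<open>The iterates are Cauchy uniformly over all matrix points, so
  \<open>calA_complete\<close> supplies a limit y in the algebra. The element k = 1 - y is
  selfadjoint, hence its product with its adjoint is the square (1 - y)^2.\<close>

lemma calA_sqrt_one_minus:
  fixes h :: "'v cstar_elem"
  assumes R: "0 \<le> R" and h: "h \<in> calA_sa R"
    and le: "\<forall>x\<in>mat_points R. op_norm (h x) \<le> 1/2"
  obtains k where "k \<in> calA R" "calA_mult R (calA_star R k) k = calA_add R (calA_one R) (calA_scale R (-1) h)"
proof -
  note P = sqrt_iter_props[OF R h le]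
  let ?Y = "sqrt_iter R h"
  have hA: "h \<in> calA R" using h by (simp add: calA_sa_def)
  \<comment> \<open>The geometric sum is kept in closed form, with the negative term, so that the
    induction adds exactly (1/2)^(k + m).\<close>
  have tele: "op_norm (?Y (k + m) (n, A) - ?Y k (n, A)) \<le> 2 * (1/2) ^ k - 2 * (1/2) ^ (k + m)"
    if nA: "(n, A) \<in> mat_points R" for n A k m
  proof (induction m)
    case 0
    have "?Y k (n, A) - ?Y k (n, A) = 0\<^sub>m n n" using calA_carrier[OF P(1)[of k] nA] by (intro eq_matI) auto
    then show ?case by (simp add: op_norm_zero_mat)
  next
    case (Suc m)
    note C = calA_carrier[OF P(1) nA]
    show ?case
      using op_norm_diff_triangle[OF C[of "k + Suc m"] C[of "k + m"] C[of k]]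
        sqrt_iter_diff[OF R h le nA, of "k + m"] Suc by simp
  qed
  have Cauchy: "\<exists>M. \<forall>k\<ge>M. \<forall>l\<ge>M. \<forall>x\<in>mat_points R. op_norm (?Y k x - ?Y l x) \<le> e" if e: "0 < e" for e
  proof -
    obtain M where M: "(1/2) ^ M < e / 2" using real_arch_pow_inv[of "e / 2" "1/2"] e by auto
    have near: "op_norm (?Y k (n, A) - ?Y l (n, A)) \<le> e" if "k \<ge> M" "l \<ge> k" "(n, A) \<in> mat_points R" for k l n A
    proof -
      note C = calA_carrier[OF P(1) that(3)]
      have "op_norm (?Y l (n, A) - ?Y k (n, A)) \<le> 2 * (1/2) ^ k - 2 * (1/2) ^ l"
        using tele[OF that(3), of k "l - k"] that(2) by simp
      also have "\<dots> \<le> 2 * (1/2) ^ k" by simp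
      also have "\<dots> \<le> 2 * (1/2) ^ M" using that(1) by (intro mult_left_mono power_decreasing) auto
      finally show ?thesis using M op_norm_minus_commute[OF C[of k] C[of l]] by simp
    qed
    have "op_norm (?Y k x - ?Y l x) \<le> e" if "k \<ge> M" "l \<ge> M" "x \<in> mat_points R" for k l x
    proof -
      obtain n A where x: "x = (n, A)" by (cases x)
      note C = calA_carrier[OF P(1) that(3)[unfolded x]]
      show ?thesis
        using near[of k l n A] near[of l k n A] that op_norm_minus_commute[OF C[of k] C[of l]]
        unfolding x by (cases "k \<le> l") simp_all
    qed
    then show ?thesis by (intro exI[of _ M]) simp
  qed
  obtain y where y: "y \<in> calA R"
    and lim: "\<forall>\<epsilon>>0. \<exists>M. \<forall>k\<ge>M. \<forall>x\<in>mat_points R. op_norm (?Y k x - y x) \<le> \<epsilon>"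
  proof -
    have "\<exists>y\<in>calA R. \<forall>\<epsilon>>0. \<exists>M. \<forall>k\<ge>M. \<forall>x\<in>mat_points R. op_norm (?Y k x - y x) \<le> \<epsilon>"
      by (rule calA_complete[of R ?Y, OF R P(1) Cauchy])
    then show thesis by (elim bexE) (rule that)
  qed
  have entry: "(\<lambda>k. ?Y k (n, A) $$ (i, j)) \<longlonglongrightarrow> y (n, A) $$ (i, j)"
    if nA: "(n, A) \<in> mat_points R" and ij: "i < n" "j < n" for n A i j
  proof (rule LIMSEQ_I)
    fix e :: real assume "0 < e"
    then obtain M where M: "\<forall>k\<ge>M. \<forall>x\<in>mat_points R. op_norm (?Y k x - y x) \<le> e / 2"
      using lim[rule_format, of "e / 2"] by auto
    have "cmod (?Y k (n, A) $$ (i, j) - y (n, A) $$ (i, j)) < e" if "k \<ge> M" for k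
    proof -
      note C = calA_carrier[OF P(1)[of k] nA] calA_carrier[OF y nA]
      have "cmod (?Y k (n, A) $$ (i, j) - y (n, A) $$ (i, j)) = cmod ((?Y k (n, A) - y (n, A)) $$ (i, j))"
        using C ij by simp
      also have "\<dots> \<le> op_norm (?Y k (n, A) - y (n, A))"
        by (rule entry_le_op_norm[OF minus_carrier_mat[OF C(2)] ij])
      also have "\<dots> \<le> e / 2" using M that nA by blast
      finally show ?thesis using \<open>0 < e\<close> by simp
    qed
    then show "\<exists>no. \<forall>k\<ge>no. cmod (?Y k (n, A) $$ (i, j) - y (n, A) $$ (i, j)) < e" by blast
  qed
  have adj: "mat_adjoint (y (n, A)) = y (n, A)" if nA: "(n, A) \<in> mat_points R" for n A
  proof (rule eq_matI)
    note C = calA_carrier[OF y nA]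
    fix i j assume "i < dim_row (y (n, A))" "j < dim_col (y (n, A))"
    then have ij: "i < n" "j < n" using C by auto
    have "?Y k (n, A) $$ (i, j) = cnj (?Y k (n, A) $$ (j, i))" for k
      using mat_adjoint_index[OF calA_carrier[OF P(1)[of k] nA] ij] P(2)[OF nA, of k] by simp
    then have "(\<lambda>k. ?Y k (n, A) $$ (i, j)) \<longlonglongrightarrow> cnj (y (n, A) $$ (j, i))"
      using tendsto_cnj[OF entry[OF nA ij(2,1)]] by simp
    then show "mat_adjoint (y (n, A)) $$ (i, j) = y (n, A) $$ (i, j)"
      using LIMSEQ_unique[OF entry[OF nA ij]] by (simp add: mat_adjoint_index[OF C ij])
  qed (use mat_adjoint_carrier[OF calA_carrier[OF y nA]] calA_carrier[OF y nA] in auto)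
  \<comment> \<open>Entrywise convergence suffices here because an entry of a product is a finite
    sum of products of entries; the shifted sequence has the same limit y.\<close>
  have fixpoint: "(y (n, A) * y (n, A)) $$ (i, j) = 2 * y (n, A) $$ (i, j) - h (n, A) $$ (i, j)"
    if nA: "(n, A) \<in> mat_points R" and ij: "i < n" "j < n" for n A i j
  proof -
    note C = calA_carrier[OF P(1) nA] and Cy = calA_carrier[OF y nA] and hC = calA_carrier[OF hA nA]
    have *: "?Y (Suc k) (n, A) $$ (i, j) =
        (h (n, A) $$ (i, j) + (\<Sum>l<n. ?Y k (n, A) $$ (i, l) * ?Y k (n, A) $$ (l, j))) / 2" for k
      unfolding sqrt_iter_Suc sqrt_step_apply[OF nA]
      using C[of k] hC ij by (simp add: scalar_prod_def atLeast0LessThan)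
    have "(\<lambda>k. (h (n, A) $$ (i, j) + (\<Sum>l<n. ?Y k (n, A) $$ (i, l) * ?Y k (n, A) $$ (l, j))) / 2)
        \<longlonglongrightarrow> (h (n, A) $$ (i, j) + (\<Sum>l<n. y (n, A) $$ (i, l) * y (n, A) $$ (l, j))) / 2"
      using ij by (intro tendsto_divide tendsto_add tendsto_sum tendsto_mult tendsto_const entry[OF nA]) auto
    then have "y (n, A) $$ (i, j) =
        (h (n, A) $$ (i, j) + (\<Sum>l<n. y (n, A) $$ (i, l) * y (n, A) $$ (l, j))) / 2"
      by (rule LIMSEQ_unique[OF LIMSEQ_Suc[OF entry[OF nA ij], unfolded *]])
    then show ?thesis using Cy ij by (simp add: scalar_prod_def atLeast0LessThan field_simps)
  qed
  define k where "k = calA_add R (calA_one R) (calA_scale R (-1) y)"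
  have k: "k \<in> calA R"
    unfolding k_def by (intro calA_add_closed calA_scale_closed calA_one_closed R y)
  have eval: "k (n, A) = 1\<^sub>m n - y (n, A)" if nA: "(n, A) \<in> mat_points R" for n A
    using nA calA_carrier[OF y nA] unfolding k_def calA_add_def calA_one_def calA_scale_def
    by (intro eq_matI) auto
  have "calA_mult R (calA_star R k) k = calA_add R (calA_one R) (calA_scale R (-1) h)"
  proof (rule extensionalityI)
    show "calA_mult R (calA_star R k) k \<in> extensional (mat_points R)"
      "calA_add R (calA_one R) (calA_scale R (-1) h) \<in> extensional (mat_points R)"
      by (simp_all add: calA_mult_def calA_add_def)
    fix x :: "nat \<times> ('v \<Rightarrow> complex mat)" assume x: "x \<in> mat_points R"
    obtain n A where nA: "x = (n, A)" by (cases x)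
    note m = x[unfolded nA]
    note Cy = calA_carrier[OF y m] and hC = calA_carrier[OF hA m]
    let ?y = "y (n, A)"
    have Cyy: "?y * ?y \<in> carrier_mat n n" by (rule mult_carrier_mat[OF Cy Cy])
    have ky: "mat_adjoint (k (n, A)) = 1\<^sub>m n - ?y"
      by (simp add: eval[OF m] mat_adjoint_minus[OF one_carrier_mat Cy] mat_adjoint_one adj[OF m])
    have "calA_mult R (calA_star R k) k x = (1\<^sub>m n - ?y) * (1\<^sub>m n - ?y)"
      using x ky by (simp add: calA_mult_def calA_star_def nA eval[OF m])
    also have "\<dots> = (1\<^sub>m n - ?y) - (?y - ?y * ?y)"
      using Cy by (simp add: minus_mult_distrib_mat[OF one_carrier_mat Cy minus_carrier_mat[OF Cy]]
          mult_minus_distrib_mat[OF Cy one_carrier_mat Cy] left_mult_one_mat[OF minus_carrier_mat[OF Cy]])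
    also have "\<dots> = 1\<^sub>m n + (-1) \<cdot>\<^sub>m h (n, A)"
    proof (rule eq_matI)
      fix i j assume "i < dim_row (1\<^sub>m n + (-1) \<cdot>\<^sub>m h (n, A))" "j < dim_col (1\<^sub>m n + (-1) \<cdot>\<^sub>m h (n, A))"
      then have ij: "i < n" "j < n" using hC by auto
      have "((1\<^sub>m n - ?y) - (?y - ?y * ?y)) $$ (i, j) = 1\<^sub>m n $$ (i, j) - ?y $$ (i, j) - (?y $$ (i, j) - (?y * ?y) $$ (i, j))"
        using ij Cy Cyy by (simp del: index_mult_mat(1))
      also have "\<dots> = 1\<^sub>m n $$ (i, j) - h (n, A) $$ (i, j)" by (simp add: fixpoint[OF m ij])
      also have "\<dots> = (1\<^sub>m n + (-1) \<cdot>\<^sub>m h (n, A)) $$ (i, j)" using ij hC by simp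
      finally show "((1\<^sub>m n - ?y) - (?y - ?y * ?y)) $$ (i, j) = (1\<^sub>m n + (-1) \<cdot>\<^sub>m h (n, A)) $$ (i, j)" .
    qed (use Cy Cyy hC in auto)
    also have "\<dots> = calA_add R (calA_one R) (calA_scale R (-1) h) x"
      using x by (simp add: calA_add_def calA_one_def calA_scale_def nA)
    finally show "calA_mult R (calA_star R k) k x = calA_add R (calA_one R) (calA_scale R (-1) h) x" .
  qed
  with k show thesis by (rule that)
qed

text \<open>Rescaling h by 1 / (2 * e) brings its norm down to 1/2, where the unit minus the
  rescaled element is a positive square. Positivity then bounds the value of \<mu> on the rescaled
  element by 1, and scaling back gives 2 * e.\<close>

lemma tracial_state_Re_le:
  fixes h :: "'v cstar_elem"
  assumes R: "0 \<le> R" and mu: "\<mu> \<in> tracial_states R" and h: "h \<in> calA_sa R" and e: "0 < e"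
    and le: "\<And>n A. (n, A) \<in> mat_points R \<Longrightarrow> op_norm (h (n, A)) \<le> e"
  shows "Re (\<mu> h) \<le> 2 * e"
proof -
  have hA: "h \<in> calA R" using h by (simp add: calA_sa_def)
  define g where "g = calA_scale R (complex_of_real (1 / (2 * e))) h"
  have gA: "g \<in> calA R" unfolding g_def by (rule calA_scale_closed[OF R hA])
  have ge: "g (n, A) = complex_of_real (1 / (2 * e)) \<cdot>\<^sub>m h (n, A)" if "(n, A) \<in> mat_points R" for n A
    using that by (simp add: g_def calA_scale_def)
  have g: "g \<in> calA_sa R"
    by (rule calA_saI[OF gA]) (simp add: ge mat_adjoint_smult[OF calA_carrier[OF hA]] calA_sa_adjoint[OF h])
  have g1: "op_norm (g (n, A)) \<le> 1/2" if nA: "(n, A) \<in> mat_points R" for n A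
  proof -
    have "op_norm (g (n, A)) \<le> 1 / (2 * e) * op_norm (h (n, A))"
      using op_norm_smult[OF calA_carrier[OF hA nA], of "complex_of_real (1 / (2 * e))"] e
      by (simp add: ge[OF nA] norm_divide norm_mult)
    also have "\<dots> \<le> 1 / (2 * e) * e" using e by (intro mult_left_mono le[OF nA]) auto
    finally show ?thesis using e by simp
  qed
  have g2: "\<forall>x\<in>mat_points R. op_norm (g x) \<le> 1/2"
  proof
    fix x :: "nat \<times> ('v \<Rightarrow> complex mat)" assume "x \<in> mat_points R"
    then show "op_norm (g x) \<le> 1/2" using g1 by (cases x) simp
  qed
  obtain k where k: "k \<in> calA R" "calA_mult R (calA_star R k) k = calA_add R (calA_one R) (calA_scale R (-1) g)"
    using calA_sqrt_one_minus[OF R g g2] by blast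
  have add: "\<And>h k. h \<in> calA R \<Longrightarrow> k \<in> calA R \<Longrightarrow> \<mu> (calA_add R h k) = \<mu> h + \<mu> k"
    and scale: "\<And>c h. h \<in> calA R \<Longrightarrow> \<mu> (calA_scale R c h) = c * \<mu> h"
    and pos: "\<And>h. h \<in> calA R \<Longrightarrow> 0 \<le> \<mu> (calA_mult R (calA_star R h) h)"
    and one: "\<mu> (calA_one R) = 1"
    using mu by (auto simp: tracial_states_def)
  have "0 \<le> \<mu> (calA_add R (calA_one R) (calA_scale R (-1) g))" using pos[OF k(1)] k(2) by simp
  also have "\<dots> = 1 - \<mu> g"
    by (simp add: add[OF calA_one_closed[OF R] calA_scale_closed[OF R gA]] scale[OF gA] one)
  also have "\<mu> g = complex_of_real (1 / (2 * e)) * \<mu> h" unfolding g_def by (rule scale[OF hA])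
  finally have "0 \<le> Re (1 - complex_of_real (1 / (2 * e)) * \<mu> h)"
    by (simp only: less_eq_complex_def) simp
  then have "Re (\<mu> h) / (2 * e) \<le> 1" by simp
  then show ?thesis using e by (simp add: divide_le_eq)
qed

section \<open>Gibbs states\<close>

text \<open>The Gibbs-Bogoliubov inequality: changing the energy from f to g costs at most the mean
  of g - f under the Gibbs measure of f. Boundedness of f and g provides all integrability.\<close>

lemma (in finite_measure) ln_integral_exp_ge:
  fixes f g :: "'a \<Rightarrow> real"
  assumes pos: "0 < measure M (space M)"
    and meas: "f \<in> borel_measurable M" "g \<in> borel_measurable M"
    and bound: "\<And>x. x \<in> space M \<Longrightarrow> \<bar>f x\<bar> \<le> K" "\<And>x. x \<in> space M \<Longrightarrow> \<bar>g x\<bar> \<le> K"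
  shows "0 < (LINT x|M. exp (- f x))"
    and "ln (LINT x|M. exp (- f x)) - (LINT x|M. exp (- f x) * (g x - f x)) / (LINT x|M. exp (- f x))
      \<le> ln (LINT x|M. exp (- g x))"
proof -
  have expK: "exp (- u x) \<le> exp K" if "x \<in> space M" "\<And>x. x \<in> space M \<Longrightarrow> \<bar>u x\<bar> \<le> K" for u x
    using that(2)[OF that(1)] by simp
  have neg: "- f x \<le> K" "- g x \<le> K" if "x \<in> space M" for x
    using bound[OF that] by (auto simp: abs_le_iff)
  have int_f: "integrable M (\<lambda>x. exp (- f x))" and int_g: "integrable M (\<lambda>x. exp (- g x))"
    using meas by (auto intro!: integrable_const_bound[where B = "exp K"] AE_I2 neg)
  have int_d: "integrable M (\<lambda>x. exp (- f x) * (g x - f x))"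
  proof (rule integrable_const_bound[where B = "exp K * (K + K)"])
    show "AE x in M. norm (exp (- f x) * (g x - f x)) \<le> exp K * (K + K)"
    proof (rule AE_I2)
      fix x assume x: "x \<in> space M"
      have "\<bar>g x - f x\<bar> \<le> K + K" using bound[OF x] by linarith
      then show "norm (exp (- f x) * (g x - f x)) \<le> exp K * (K + K)"
        using expK[OF x bound(1)] by (simp add: abs_mult) (intro mult_mono, auto)
    qed
  qed (use meas in measurable)
  show Z: "0 < (LINT x|M. exp (- f x))"
  proof -
    have "0 < (LINT x|M. exp (- K))" using pos by simp
    also have "\<dots> \<le> (LINT x|M. exp (- f x))"
    proof (rule integral_mono[OF _ int_f])
      fix x assume "x \<in> space M"
      from bound(1)[OF this] show "exp (- K) \<le> exp (- f x)" by simp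
    qed simp
    finally show ?thesis .
  qed
  let ?Z = "LINT x|M. exp (- f x)" and ?D = "LINT x|M. exp (- f x) * (g x - f x)"
  \<comment> \<open>The tangent of exp is taken at the Gibbs mean of -(g - f); with this point of
    contact the linear correction integrates to 0 and only the factor \<open>exp c\<close>
    remains.\<close>
  define c where "c = - ?D / ?Z"
  have "?Z * exp c = (LINT x|M. exp c * ((1 - c) * exp (- f x) - exp (- f x) * (g x - f x)))"
  proof -
    have "(LINT x|M. exp c * ((1 - c) * exp (- f x) - exp (- f x) * (g x - f x))) = exp c * ((1 - c) * ?Z - ?D)"
      using int_f int_d by (simp only: integral_mult_right_zero Bochner_Integration.integral_diff integrable_mult_right)
    also have "(1 - c) * ?Z - ?D = ?Z"
    proof -
      have "c * ?Z = - ?D" using Z unfolding c_def by (intro nonzero_eq_divide_eq[THEN iffD1, rotated] refl) simp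
      then show ?thesis by (simp only: left_diff_distrib)
    qed
    finally show ?thesis by (simp only: mult.commute)
  qed
  also have "\<dots> \<le> (LINT x|M. exp (- g x))"
  proof (rule integral_mono)
    fix x assume "x \<in> space M"
    have "exp c * (1 + (- (g x - f x) - c)) \<le> exp c * exp (- (g x - f x) - c)"
      by (intro mult_left_mono exp_ge_add_one_self) simp
    then have "exp (- f x) * (exp c * (1 + (- (g x - f x) - c))) \<le> exp (- f x) * (exp c * exp (- (g x - f x) - c))"
      by (rule mult_left_mono) simp
    also have "\<dots> = exp (- g x)" by (simp flip: exp_add)
    finally show "exp c * ((1 - c) * exp (- f x) - exp (- f x) * (g x - f x)) \<le> exp (- g x)"
      by (simp add: algebra_simps)
  qed (use int_f int_d int_g in simp_all)
  finally have le: "?Z * exp c \<le> (LINT x|M. exp (- g x))" .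
  have "ln ?Z + c = ln (?Z * exp c)" using Z by (simp add: ln_mult)
  also have "\<dots> \<le> ln (LINT x|M. exp (- g x))"
  proof -
    have "0 < ?Z * exp c" using Z by simp
    then show ?thesis using le less_le_trans[OF _ le] by (subst ln_le_cancel_iff) auto
  qed
  finally show "ln ?Z - ?D / ?Z \<le> ln (LINT x|M. exp (- g x))" by (simp add: c_def)
qed

section \<open>Partition functions and Gibbs states at a fixed matrix size\<close>

definition gibbs_weight :: "nat \<Rightarrow> 'v cstar_elem \<Rightarrow> ('v \<Rightarrow> complex mat) \<Rightarrow> real" where
  "gibbs_weight n h A = exp (- ((real n)\<^sup>2 * Re (ntrace n (h (n, A)))))"

definition partition_fun :: "real \<Rightarrow> nat \<Rightarrow> 'v::finite cstar_elem \<Rightarrow> real" where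
  "partition_fun R n h = (LINT A|tuple_measure n R. gibbs_weight n h A)"

definition micro_pressure :: "real \<Rightarrow> nat \<Rightarrow> 'v::finite cstar_elem \<Rightarrow> real" where
  "micro_pressure R n h = 1 / (real n)\<^sup>2 * ln (partition_fun R n h) + real CARD('v) / 2 * ln (real n)"

definition gibbs_state :: "real \<Rightarrow> nat \<Rightarrow> 'v::finite cstar_elem \<Rightarrow> 'v cstar_elem \<Rightarrow> complex" where
  "gibbs_state R n h g =
     (LINT A|tuple_measure n R. gibbs_weight n h A *\<^sub>R ntrace n (g (n, A))) /\<^sub>R partition_fun R n h"

lemma free_pressure_eq_limsup:
  assumes "0 < R"
  shows "free_pressure R h = limsup (\<lambda>n. ereal (micro_pressure R n h))"
  by (simp add: free_pressure_def micro_pressure_def partition_fun_def gibbs_weight_def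
      set_integral_herm_tuples[OF assms])

context
  fixes R :: real and n :: nat
  assumes R: "0 < R" and n: "1 \<le> n"
begin

lemma mem_tuple_measure:
  "A \<in> space (tuple_measure n R :: ('v::finite \<Rightarrow> complex mat) measure) \<longleftrightarrow> (n, A) \<in> mat_points R"
  using n by (simp add: space_tuple_measure[OF R] mat_points_def)

lemma ntrace_calA_bound:
  fixes g :: "'v cstar_elem"
  assumes "g \<in> calA R"
  obtains K where "0 \<le> K" "\<And>A. (n, A) \<in> mat_points R \<Longrightarrow> cmod (ntrace n (g (n, A))) \<le> K"
proof -
  obtain K where K: "0 \<le> K" "\<And>n A. (n, A) \<in> mat_points R \<Longrightarrow> op_norm (g (n, A)) \<le> K"
    using calA_uniform_bound[OF less_imp_le[OF R] assms] by blast
  show thesis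
  proof (rule that[OF K(1)])
    fix A :: "'v \<Rightarrow> complex mat" assume nA: "(n, A) \<in> mat_points R"
    show "cmod (ntrace n (g (n, A))) \<le> K"
      using cmod_ntrace_le[OF calA_carrier[OF assms nA] n] K(2)[OF nA] by simp
  qed
qed

lemma measurable_gibbs_weight:
  fixes h :: "'v::finite cstar_elem"
  assumes "h \<in> calA R"
  shows "gibbs_weight n h \<in> borel_measurable (tuple_measure n R)"
  unfolding gibbs_weight_def using measurable_ntrace_calA[OF R assms n] by measurable

text \<open>All four facts come from the boundedness of the traces over the finite tuple measure.
  \<open>gibbs_variational\<close> is the Gibbs-Bogoliubov inequality with energies n^2 Re tr_n(h)
  and n^2 Re tr_n(k).\<close>

lemma
  fixes h k :: "'v::finite cstar_elem"
  assumes h: "h \<in> calA R"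
  shows partition_fun_pos: "0 < partition_fun R n h"
    and gibbs_variational: "k \<in> calA R \<Longrightarrow>
      micro_pressure R n h - Re (gibbs_state R n h k - gibbs_state R n h h) \<le> micro_pressure R n k"
    and integrable_gibbs: "g \<in> calA R \<Longrightarrow>
      integrable (tuple_measure n R) (\<lambda>A. gibbs_weight n h A *\<^sub>R ntrace n (g (n, A)))"
    and integrable_gibbs_weight: "integrable (tuple_measure n R) (gibbs_weight n h)"
proof -
  let ?M = "tuple_measure n R :: ('v \<Rightarrow> complex mat) measure"
  interpret finite_measure ?M by (rule finite_measure_tuple_measure[OF R])
  let ?f = "\<lambda>h :: 'v cstar_elem. \<lambda>A. (real n)\<^sup>2 * Re (ntrace n (h (n, A)))"
  have meas: "?f h \<in> borel_measurable ?M" if "h \<in> calA R" for h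
    using measurable_ntrace_calA[OF R that n] by measurable
  have bound: "\<exists>K. \<forall>A\<in>space ?M. \<bar>?f h A\<bar> \<le> K" if h': "h \<in> calA R" for h
  proof -
    obtain K where K: "0 \<le> K" "\<And>A. (n, A) \<in> mat_points R \<Longrightarrow> cmod (ntrace n (h (n, A))) \<le> K"
      using ntrace_calA_bound[OF h'] by blast
    have "\<bar>?f h A\<bar> \<le> (real n)\<^sup>2 * K" if "A \<in> space ?M" for A
      using order_trans[OF abs_Re_le_cmod K(2), of A] that
      by (simp add: mem_tuple_measure abs_mult mult_left_mono)
    then show ?thesis by blast
  qed
  obtain K where K: "\<And>A. A \<in> space ?M \<Longrightarrow> \<bar>?f h A\<bar> \<le> K" using bound[OF h] by blast
  have w: "gibbs_weight n h A \<le> exp K" if "A \<in> space ?M" for A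
    using K[OF that] by (simp add: gibbs_weight_def)
  show int: "integrable ?M (\<lambda>A. gibbs_weight n h A *\<^sub>R ntrace n (g (n, A)))" if g: "g \<in> calA R" for g
  proof -
    obtain L where L: "0 \<le> L" "\<And>A. (n, A) \<in> mat_points R \<Longrightarrow> cmod (ntrace n (g (n, A))) \<le> L"
      using ntrace_calA_bound[OF g] by blast
    show ?thesis
    proof (rule integrable_const_bound[where B = "exp K * L"])
      show "AE A in ?M. norm (gibbs_weight n h A *\<^sub>R ntrace n (g (n, A))) \<le> exp K * L"
      proof (rule AE_I2)
        fix A assume A: "A \<in> space ?M"
        have "norm (gibbs_weight n h A *\<^sub>R ntrace n (g (n, A))) = gibbs_weight n h A * cmod (ntrace n (g (n, A)))"
          by (simp add: gibbs_weight_def)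
        also have "\<dots> \<le> exp K * L"
          using w[OF A] L(1) L(2)[of A] A by (intro mult_mono) (auto simp: mem_tuple_measure)
        finally show "norm (gibbs_weight n h A *\<^sub>R ntrace n (g (n, A))) \<le> exp K * L" .
      qed
      show "(\<lambda>A. gibbs_weight n h A *\<^sub>R ntrace n (g (n, A))) \<in> borel_measurable ?M"
        by (intro borel_measurable_scaleR measurable_gibbs_weight h measurable_ntrace_calA R g n)
    qed
  qed
  show "integrable ?M (gibbs_weight n h)"
    by (rule integrable_const_bound[where B = "exp K"])
      (use w measurable_gibbs_weight[OF h] in \<open>auto intro!: AE_I2 simp: gibbs_weight_def\<close>)
  show Z: "0 < partition_fun R n h"
    unfolding partition_fun_def gibbs_weight_def
    by (rule ln_integral_exp_ge(1)[OF measure_tuple_measure_pos[OF R] meas[OF h] meas[OF h], of K]) (use K in auto)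
  assume k: "k \<in> calA R"
  obtain L where L: "\<And>A. A \<in> space ?M \<Longrightarrow> \<bar>?f k A\<bar> \<le> L" using bound[OF k] by blast
  have "ln (partition_fun R n h) - (LINT A|?M. gibbs_weight n h A * (?f k A - ?f h A)) / partition_fun R n h
      \<le> ln (partition_fun R n k)"
    unfolding partition_fun_def gibbs_weight_def
    by (rule ln_integral_exp_ge(2)[OF measure_tuple_measure_pos[OF R] meas[OF h] meas[OF k], of "max K L"])
      (use K L in \<open>auto simp: le_max_iff_disj\<close>)
  also have "(LINT A|?M. gibbs_weight n h A * (?f k A - ?f h A)) / partition_fun R n h =
      (real n)\<^sup>2 * Re (gibbs_state R n h k - gibbs_state R n h h)"
  proof -
    have Re: "(LINT A|?M. gibbs_weight n h A * Re (ntrace n (g (n, A)))) = partition_fun R n h * Re (gibbs_state R n h g)"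
      and Re_int: "integrable ?M (\<lambda>A. gibbs_weight n h A * Re (ntrace n (g (n, A))))"
      if g: "g \<in> calA R" for g
      using integral_Re[OF int[OF g]] integrable_Re[OF int[OF g]] Z by (simp_all add: gibbs_state_def)
    have "(LINT A|?M. gibbs_weight n h A * (?f k A - ?f h A)) =
        (LINT A|?M. (real n)\<^sup>2 * (gibbs_weight n h A * Re (ntrace n (k (n, A))) - gibbs_weight n h A * Re (ntrace n (h (n, A)))))"
      by (intro Bochner_Integration.integral_cong) (auto simp: algebra_simps)
    also have "\<dots> = (real n)\<^sup>2 * (partition_fun R n h * Re (gibbs_state R n h k) - partition_fun R n h * Re (gibbs_state R n h h))"
      using Re_int[OF h] Re_int[OF k] by (simp add: Re[OF h] Re[OF k])
    finally show ?thesis using Z by (simp add: field_simps)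
  qed
  finally have "ln (partition_fun R n h) - (real n)\<^sup>2 * Re (gibbs_state R n h k - gibbs_state R n h h)
      \<le> ln (partition_fun R n k)" .
  \<comment> \<open>Division by n^2 cancels the same factor in the energies; the logarithmic
    correction in n is common to both sides.\<close>
  then have "1 / (real n)\<^sup>2 * (ln (partition_fun R n h) - (real n)\<^sup>2 * Re (gibbs_state R n h k - gibbs_state R n h h))
      \<le> 1 / (real n)\<^sup>2 * ln (partition_fun R n k)"
    by (rule mult_left_mono) simp
  then show "micro_pressure R n h - Re (gibbs_state R n h k - gibbs_state R n h h) \<le> micro_pressure R n k"
    using n by (simp add: micro_pressure_def right_diff_distrib)
qed

text \<open>A weighted average of traces cannot exceed the norm bound. When K is uniform in n, so is
  the estimate; this gives the compactness of the family of Gibbs states and the Lipschitz estimate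
  for the pressure.\<close>

lemma cmod_gibbs_state_le:
  fixes h g :: "'v::finite cstar_elem"
  assumes h: "h \<in> calA R" and g: "g \<in> calA R"
    and le: "\<And>A. (n, A) \<in> mat_points R \<Longrightarrow> op_norm (g (n, A)) \<le> K"
  shows "cmod (gibbs_state R n h g) \<le> K"
proof -
  let ?M = "tuple_measure n R :: ('v \<Rightarrow> complex mat) measure"
  note Z = partition_fun_pos[OF h]
  have "cmod (LINT A|?M. gibbs_weight n h A *\<^sub>R ntrace n (g (n, A))) \<le> (LINT A|?M. gibbs_weight n h A * K)"
  proof (rule order_trans[OF integral_norm_bound integral_mono])
    show "integrable ?M (\<lambda>A. norm (gibbs_weight n h A *\<^sub>R ntrace n (g (n, A))))"
      by (rule integrable_norm[OF integrable_gibbs[OF h g]])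
    show "integrable ?M (\<lambda>A. gibbs_weight n h A * K)" using integrable_gibbs_weight[OF h] by simp
    fix A assume "A \<in> space ?M"
    then have nA: "(n, A) \<in> mat_points R" by (simp add: mem_tuple_measure)
    have "cmod (ntrace n (g (n, A))) \<le> K"
      using cmod_ntrace_le[OF calA_carrier[OF g nA] n] le[OF nA] by simp
    then show "norm (gibbs_weight n h A *\<^sub>R ntrace n (g (n, A))) \<le> gibbs_weight n h A * K"
      by (simp add: gibbs_weight_def)
  qed
  also have "\<dots> = partition_fun R n h * K" by (simp add: partition_fun_def)
  finally show ?thesis using Z by (simp add: gibbs_state_def field_simps)
qed

section \<open>State and trace properties of the Gibbs functionals\<close>

lemma gibbs_state_cong:
  fixes g k :: "'v::finite cstar_elem"
  assumes "\<And>A. (n, A) \<in> mat_points R \<Longrightarrow> ntrace n (g (n, A)) = ntrace n (k (n, A))"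
  shows "gibbs_state R n h g = gibbs_state R n h k"
proof -
  have "(LINT A|tuple_measure n R. gibbs_weight n h A *\<^sub>R ntrace n (g (n, A))) =
      (LINT A|tuple_measure n R. gibbs_weight n h A *\<^sub>R ntrace n (k (n, A)))"
    by (intro Bochner_Integration.integral_cong refl) (simp add: mem_tuple_measure assms)
  then show ?thesis by (simp add: gibbs_state_def)
qed

lemma gibbs_state_add:
  fixes h g k :: "'v::finite cstar_elem"
  assumes h: "h \<in> calA R" and g: "g \<in> calA R" and k: "k \<in> calA R"
  shows "gibbs_state R n h (calA_add R g k) = gibbs_state R n h g + gibbs_state R n h k"
proof -
  have "(LINT A|tuple_measure n R. gibbs_weight n h A *\<^sub>R ntrace n (calA_add R g k (n, A))) =
      (LINT A|tuple_measure n R. gibbs_weight n h A *\<^sub>R ntrace n (g (n, A)) + gibbs_weight n h A *\<^sub>R ntrace n (k (n, A)))"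
  proof (intro Bochner_Integration.integral_cong refl)
    fix A :: "'v \<Rightarrow> complex mat" assume "A \<in> space (tuple_measure n R)"
    then have nA: "(n, A) \<in> mat_points R" by (simp add: mem_tuple_measure)
    show "gibbs_weight n h A *\<^sub>R ntrace n (calA_add R g k (n, A)) =
        gibbs_weight n h A *\<^sub>R ntrace n (g (n, A)) + gibbs_weight n h A *\<^sub>R ntrace n (k (n, A))"
      using nA by (simp add: calA_add_def ntrace_add[OF calA_carrier[OF g nA] calA_carrier[OF k nA]] scaleR_add_right)
  qed
  also have "\<dots> = (LINT A|tuple_measure n R. gibbs_weight n h A *\<^sub>R ntrace n (g (n, A))) +
      (LINT A|tuple_measure n R. gibbs_weight n h A *\<^sub>R ntrace n (k (n, A)))"
    by (rule Bochner_Integration.integral_add[OF integrable_gibbs[OF h g] integrable_gibbs[OF h k]])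
  finally show ?thesis by (simp add: gibbs_state_def scaleR_add_right)
qed

lemma gibbs_state_scale:
  fixes h g :: "'v::finite cstar_elem"
  assumes g: "g \<in> calA R"
  shows "gibbs_state R n h (calA_scale R c g) = c * gibbs_state R n h g"
proof -
  have "(LINT A|tuple_measure n R. gibbs_weight n h A *\<^sub>R ntrace n (calA_scale R c g (n, A))) =
      (LINT A|tuple_measure n R. c * (gibbs_weight n h A *\<^sub>R ntrace n (g (n, A))))"
  proof (intro Bochner_Integration.integral_cong refl)
    fix A :: "'v \<Rightarrow> complex mat" assume "A \<in> space (tuple_measure n R)"
    then have nA: "(n, A) \<in> mat_points R" by (simp add: mem_tuple_measure)
    show "gibbs_weight n h A *\<^sub>R ntrace n (calA_scale R c g (n, A)) = c * (gibbs_weight n h A *\<^sub>R ntrace n (g (n, A)))"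
      using nA by (simp add: calA_scale_def ntrace_smult[OF calA_carrier[OF g nA]])
  qed
  also have "\<dots> = c * (LINT A|tuple_measure n R. gibbs_weight n h A *\<^sub>R ntrace n (g (n, A)))"
    by (rule integral_mult_right_zero)
  finally show ?thesis by (simp add: gibbs_state_def del: mult_scaleR_right) simp
qed

lemma gibbs_state_one:
  fixes h :: "'v::finite cstar_elem"
  assumes h: "h \<in> calA R"
  shows "gibbs_state R n h (calA_one R) = 1"
proof -
  have "(LINT A|tuple_measure n R. gibbs_weight n h A *\<^sub>R ntrace n (calA_one R (n, A))) =
      (LINT A|tuple_measure n R. complex_of_real (gibbs_weight n h A))"
    by (intro Bochner_Integration.integral_cong refl)
      (simp add: mem_tuple_measure calA_one_def ntrace_one[OF n] of_real_def)
  also have "\<dots> = complex_of_real (partition_fun R n h)"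
    by (simp add: partition_fun_def)
  finally show ?thesis using partition_fun_pos[OF h] by (simp add: gibbs_state_def scaleR_conv_of_real)
qed

text \<open>Positivity is split into real and imaginary part because each of the two survives a
  limit separately.\<close>

lemma gibbs_state_pos:
  fixes h g :: "'v::finite cstar_elem"
  assumes h: "h \<in> calA R" and g: "g \<in> calA R"
  shows "0 \<le> Re (gibbs_state R n h (calA_mult R (calA_star R g) g))"
    and "Im (gibbs_state R n h (calA_mult R (calA_star R g) g)) = 0"
proof -
  let ?s = "\<lambda>A. (\<Sum>i<n. \<Sum>j<n. (cmod (g (n, A) $$ (j, i)))\<^sup>2) / real n"
  have "(LINT A|tuple_measure n R. gibbs_weight n h A *\<^sub>R ntrace n (calA_mult R (calA_star R g) g (n, A))) =
      (LINT A|tuple_measure n R. complex_of_real (gibbs_weight n h A * ?s A))"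
  proof (intro Bochner_Integration.integral_cong refl)
    fix A :: "'v \<Rightarrow> complex mat" assume "A \<in> space (tuple_measure n R)"
    then have nA: "(n, A) \<in> mat_points R" by (simp add: mem_tuple_measure)
    have "ntrace n (calA_mult R (calA_star R g) g (n, A)) = complex_of_real (?s A)"
      using nA ntrace_adjoint_mult[OF calA_carrier[OF g nA]] by (simp add: calA_mult_def calA_star_def)
    then show "gibbs_weight n h A *\<^sub>R ntrace n (calA_mult R (calA_star R g) g (n, A)) =
        complex_of_real (gibbs_weight n h A * ?s A)" by (simp add: scaleR_conv_of_real)
  qed
  also have "\<dots> = complex_of_real (LINT A|tuple_measure n R. gibbs_weight n h A * ?s A)"
    by (rule integral_complex_of_real)
  finally have eq: "gibbs_state R n h (calA_mult R (calA_star R g) g) =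
      complex_of_real ((LINT A|tuple_measure n R. gibbs_weight n h A * ?s A) / partition_fun R n h)"
    by (simp add: gibbs_state_def scaleR_conv_of_real field_simps)
  have "0 \<le> (LINT A|tuple_measure n R. gibbs_weight n h A * ?s A)"
    by (rule Bochner_Integration.integral_nonneg)
      (auto simp: gibbs_weight_def intro!: mult_nonneg_nonneg divide_nonneg_nonneg sum_nonneg)
  then show "0 \<le> Re (gibbs_state R n h (calA_mult R (calA_star R g) g))"
    "Im (gibbs_state R n h (calA_mult R (calA_star R g) g)) = 0"
    unfolding eq Re_complex_of_real Im_complex_of_real using partition_fun_pos[OF h]
    by (simp_all only: divide_nonneg_pos)
qed

lemma gibbs_state_commute:
  fixes h g k :: "'v::finite cstar_elem"
  assumes g: "g \<in> calA R" and k: "k \<in> calA R"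
  shows "gibbs_state R n h (calA_mult R g k) = gibbs_state R n h (calA_mult R k g)"
proof (rule gibbs_state_cong)
  fix A :: "'v \<Rightarrow> complex mat" assume nA: "(n, A) \<in> mat_points R"
  then show "ntrace n (calA_mult R g k (n, A)) = ntrace n (calA_mult R k g (n, A))"
    using ntrace_mult_commute[OF calA_carrier[OF g nA] calA_carrier[OF k nA]] by (simp add: calA_mult_def)
qed

end

section \<open>Duality\<close>

text \<open>Tychonoff gives a cluster point in a product of closed discs. Over an uncountable index
  set such a product need not be sequentially compact, so the convergence is expressed by a filter
  F; \<open>F \<le> sequentially\<close> transfers every eventual statement about the
  sequence.\<close>

lemma pointwise_bounded_cluster:
  fixes m :: "nat \<Rightarrow> 'a \<Rightarrow> complex"
  assumes bound: "\<And>j x. cmod (m j x) \<le> B x"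
  obtains \<mu> F where "F \<noteq> bot" "F \<le> sequentially" "\<And>x. ((\<lambda>j. m j x) \<longlongrightarrow> \<mu> x) F"
proof -
  have "compactin (product_topology (\<lambda>_. euclidean) UNIV) (Pi\<^sub>E UNIV (\<lambda>x. cball 0 (B x) :: complex set))"
    unfolding compactin_PiE by (intro disjI2 ballI) (simp add: compactin_euclidean_iff)
  then have "compact (Pi\<^sub>E UNIV (\<lambda>x. cball 0 (B x) :: complex set))"
    by (simp add: euclidean_product_topology compactin_euclidean_iff)
  moreover have "\<forall>\<^sub>F f in filtermap m sequentially. f \<in> Pi\<^sub>E UNIV (\<lambda>x. cball 0 (B x))"
    using bound by (simp add: eventually_filtermap PiE_def Pi_def)
  moreover have "filtermap m sequentially \<noteq> bot" by (simp add: filtermap_bot_iff)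
  ultimately obtain \<mu> where \<mu>: "inf (nhds \<mu>) (filtermap m sequentially) \<noteq> bot"
    unfolding compact_filter by blast
  \<comment> \<open>The neighbourhoods of \<mu> are pulled back to the indices and met with the
    tails; that \<mu> is a cluster point says exactly that this filter is proper.\<close>
  define F where "F = inf (filtercomap m (nhds \<mu>)) sequentially"
  have "F \<noteq> bot"
  proof
    assume "F = bot"
    then have "eventually (\<lambda>_. False) F" by simp
    then obtain P Q where P: "eventually P (filtercomap m (nhds \<mu>))" and Q: "eventually Q sequentially"
      and PQ: "\<And>k. P k \<Longrightarrow> Q k \<Longrightarrow> False" unfolding F_def eventually_inf by blast
    obtain P' where P': "eventually P' (nhds \<mu>)" "\<And>k. P' (m k) \<Longrightarrow> P k"
      using P unfolding eventually_filtercomap by blast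
    have "eventually (\<lambda>f. \<not> P' f) (filtermap m sequentially)"
      unfolding eventually_filtermap using Q by eventually_elim (use P' PQ in blast)
    then have "eventually (\<lambda>_. False) (inf (nhds \<mu>) (filtermap m sequentially))"
      unfolding eventually_inf using P'(1) by blast
    then show False using \<mu> by (simp add: trivial_limit_def)
  qed
  moreover have "F \<le> sequentially" by (simp add: F_def)
  moreover have "((\<lambda>j. m j x) \<longlongrightarrow> \<mu> x) F" for x
  proof -
    have m: "filterlim m (nhds \<mu>) F" unfolding filterlim_iff_le_filtercomap F_def by simp
    show ?thesis
    proof (rule topological_tendstoI)
      fix S :: "complex set" assume S: "open S" "\<mu> x \<in> S"
      have "open ((\<lambda>f :: 'a \<Rightarrow> complex. f x) -` S)"
        by (rule open_vimage[OF S(1) continuous_on_product_coordinates])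
      then have "eventually (\<lambda>f. f x \<in> S) (nhds \<mu>)"
        unfolding eventually_nhds using S(2) by (intro exI[of _ "(\<lambda>f. f x) -` S"]) simp
      then show "eventually (\<lambda>j. m j x \<in> S) F" by (rule eventually_compose_filterlim[OF _ m])
    qed
  qed
  ultimately show thesis by (rule that)
qed


text \<open>The functional -\<mu> is a subgradient of the pressure at h, and it is found among
  limits of Gibbs states of h.\<close>

lemma free_pressure_tangent_state:
  fixes h :: "'v::finite cstar_elem"
  assumes R: "0 < R" and h: "h \<in> calA R"
  obtains \<mu> where "\<mu> \<in> tracial_states R"
    "\<And>k. k \<in> calA R \<Longrightarrow> free_pressure R h + ereal (Re (\<mu> h) - Re (\<mu> k)) \<le> free_pressure R k"
proof -
  note R0 = less_imp_le[OF R]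
  \<comment> \<open>Along r the limsup for h becomes a limit; no convergence is claimed for other
    elements.\<close>
  obtain r :: "nat \<Rightarrow> nat" where r: "strict_mono r"
    and lim_h: "((\<lambda>n. ereal (micro_pressure R n h)) \<circ> r) \<longlonglongrightarrow> free_pressure R h"
    unfolding free_pressure_eq_limsup[OF R] using limsup_subseq_lim by blast
  \<comment> \<open>The value 0 for matrix size 0 and outside the algebra makes the pointwise bound
    hold for every index and every argument.\<close>
  define m where "m j g = (if g \<in> calA R \<and> 1 \<le> r j then gibbs_state R (r j) h g else 0)" for j g
  have "\<exists>K. \<forall>j. cmod (m j g) \<le> K" for g
  proof (cases "g \<in> calA R")
    case True
    obtain K where K: "0 \<le> K" "\<And>n A. (n, A) \<in> mat_points R \<Longrightarrow> op_norm (g (n, A)) \<le> K"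
      using calA_uniform_bound[OF R0 True] by blast
    have "cmod (m j g) \<le> K" for j
      using cmod_gibbs_state_le[OF R _ h True K(2)] K(1) by (simp add: m_def)
    then show ?thesis by blast
  qed (auto simp: m_def)
  then obtain B where B: "\<And>j g. cmod (m j g) \<le> B g" by metis
  obtain \<mu> F where F: "F \<noteq> bot" "F \<le> sequentially" and lim: "\<And>g. ((\<lambda>j. m j g) \<longlongrightarrow> \<mu> g) F"
    using pointwise_bounded_cluster[of m, OF B] by blast
  have r_ge: "\<forall>\<^sub>F j in F. 1 \<le> r j"
  proof (rule filter_leD[OF F(2)])
    show "\<forall>\<^sub>F j in sequentially. 1 \<le> r j"
      using eventually_ge_at_top[of 1] by eventually_elim (use seq_suble[OF r] order_trans in blast)
  qed
  have m: "m j g = gibbs_state R (r j) h g" if "1 \<le> r j" "g \<in> calA R" for j g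
    using that by (simp add: m_def)
  \<comment> \<open>Transfer principle for the axioms below: an identity of the Gibbs states valid
    for \<open>1 \<le> r j\<close> holds eventually along F and so passes to \<mu>.\<close>
  have lim_eq: "\<mu> g = c" if "((\<lambda>j. u j) \<longlongrightarrow> c) F" "\<And>j. 1 \<le> r j \<Longrightarrow> m j g = u j" for g c u
  proof (rule tendsto_unique[OF F(1) lim])
    show "((\<lambda>j. m j g) \<longlongrightarrow> c) F"
      by (rule Lim_transform_eventually[OF that(1)]) (use r_ge in eventually_elim, simp add: that(2))
  qed
  note closed = calA_add_closed[OF R0] calA_scale_closed[OF R0] calA_mult_closed[OF R0] calA_star_closed[OF R0]
    calA_one_closed[OF R0]
  have add: "\<mu> (calA_add R g k) = \<mu> g + \<mu> k" if "g \<in> calA R" "k \<in> calA R" for g k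
    by (rule lim_eq[OF tendsto_add[OF lim lim]]) (simp add: m that closed gibbs_state_add[OF R _ h])
  have scale: "\<mu> (calA_scale R c g) = c * \<mu> g" if "g \<in> calA R" for g c
    by (rule lim_eq[OF tendsto_mult[OF tendsto_const lim]]) (simp add: m that closed gibbs_state_scale[OF R])
  have one: "\<mu> (calA_one R) = 1"
    by (rule lim_eq[OF tendsto_const]) (simp add: m closed gibbs_state_one[OF R _ h])
  have commute: "\<mu> (calA_mult R g k) = \<mu> (calA_mult R k g)" if "g \<in> calA R" "k \<in> calA R" for g k
    by (rule lim_eq[OF lim]) (simp add: m that closed gibbs_state_commute[OF R _ that])
  have pos: "0 \<le> \<mu> (calA_mult R (calA_star R g) g)" if g: "g \<in> calA R" for g
  proof -
    let ?s = "calA_mult R (calA_star R g) g"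
    have s: "?s \<in> calA R" using g by (simp add: closed)
    have "0 \<le> Re (\<mu> ?s)"
    proof (rule tendsto_lowerbound[OF tendsto_Re[OF lim] _ F(1)])
      show "\<forall>\<^sub>F j in F. 0 \<le> Re (m j ?s)"
        using r_ge by eventually_elim (simp add: m[OF _ s] gibbs_state_pos(1)[OF R _ h g])
    qed
    moreover have "Im (\<mu> ?s) = 0"
    proof (rule tendsto_unique[OF F(1) tendsto_Im[OF lim]])
      show "((\<lambda>j. Im (m j ?s)) \<longlongrightarrow> 0) F"
      proof (rule Lim_transform_eventually[OF tendsto_const])
        show "\<forall>\<^sub>F j in F. 0 = Im (m j ?s)"
          using r_ge by eventually_elim (simp add: m[OF _ s] gibbs_state_pos(2)[OF R _ h g])
      qed
    qed
    ultimately show ?thesis by (simp add: less_eq_complex_def)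
  qed
  have tangent: "free_pressure R h + ereal (Re (\<mu> h) - Re (\<mu> k)) \<le> free_pressure R k" if k: "k \<in> calA R" for k
  proof (rule dense_ge)
    \<comment> \<open>A strict upper bound of the limsup bounds the finite-size pressures of k
      eventually, hence also along the subsequence and along F.\<close>
    fix c assume "free_pressure R k < c"
    then have "\<forall>\<^sub>F n in sequentially. ereal (micro_pressure R n k) < c"
      unfolding free_pressure_eq_limsup[OF R] by (rule Limsup_lessD)
    then have "\<forall>\<^sub>F j in sequentially. ereal (micro_pressure R (r j) k) < c"
      by (rule eventually_compose_filterlim[OF _ filterlim_subseq[OF r]])
    then have "\<forall>\<^sub>F j in F. ereal (micro_pressure R (r j) k) < c" by (rule filter_leD[OF F(2)])
    then have "\<forall>\<^sub>F j in F. ereal (micro_pressure R (r j) h) + ereal (Re (m j h) - Re (m j k)) \<le> c"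
      using r_ge
    proof eventually_elim
      case (elim j)
      have "micro_pressure R (r j) h + (Re (m j h) - Re (m j k)) \<le> micro_pressure R (r j) k"
        using gibbs_variational[OF R elim(2) h k] by (simp add: m[OF elim(2) h] m[OF elim(2) k])
      then have "ereal (micro_pressure R (r j) h) + ereal (Re (m j h) - Re (m j k)) \<le> ereal (micro_pressure R (r j) k)"
        by simp
      also have "\<dots> \<le> c" using elim(1) by (rule less_imp_le)
      finally show ?case .
    qed
    moreover have "((\<lambda>j. ereal (micro_pressure R (r j) h) + ereal (Re (m j h) - Re (m j k))) \<longlongrightarrow>
        free_pressure R h + ereal (Re (\<mu> h) - Re (\<mu> k))) F"
    \<comment> \<open>The second limit is real, so the sum converges even if the pressure of h is
      infinite.\<close>
    proof (rule tendsto_add_ereal_general1)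
      show "((\<lambda>j. ereal (micro_pressure R (r j) h)) \<longlongrightarrow> free_pressure R h) F"
        using tendsto_mono[OF F(2) lim_h] by (simp add: comp_def)
      show "((\<lambda>j. ereal (Re (m j h) - Re (m j k))) \<longlongrightarrow> ereal (Re (\<mu> h) - Re (\<mu> k))) F"
        by (intro tendsto_intros lim)
    qed simp
    ultimately show "free_pressure R h + ereal (Re (\<mu> h) - Re (\<mu> k)) \<le> c"
      by (intro tendsto_upperbound[OF _ _ F(1)])
  qed
  show thesis
  \<comment> \<open>The limit has values outside the algebra too; restriction makes it extensional,
    as states are required to be.\<close>
  proof (rule that[of "restrict \<mu> (calA R)"])
    show "restrict \<mu> (calA R) \<in> tracial_states R"
      unfolding tracial_states_def by (simp add: closed add scale one pos) (blast intro: commute)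
    show "free_pressure R h + ereal (Re (restrict \<mu> (calA R) h) - Re (restrict \<mu> (calA R) k)) \<le> free_pressure R k"
      if "k \<in> calA R" for k
      using tangent[OF that] h that by simp
  qed
qed

text \<open>The variational inequality is applied with the Gibbs state of k, the element whose
  pressure is bounded from above; this state takes a value of modulus at most e on h - k, for every
  matrix size.\<close>

lemma free_pressure_le_add:
  fixes h k :: "'v::finite cstar_elem"
  assumes R: "0 < R" and h: "h \<in> calA R" and k: "k \<in> calA R"
    and le: "\<And>n A. (n, A) \<in> mat_points R \<Longrightarrow> op_norm (h (n, A) - k (n, A)) \<le> e"
  shows "free_pressure R k \<le> free_pressure R h + ereal e"
proof -
  note R0 = less_imp_le[OF R]
  define d where "d = calA_add R h (calA_scale R (-1) k)"
  have d: "d \<in> calA R" unfolding d_def by (intro calA_add_closed calA_scale_closed R0 h k)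
  have de: "op_norm (d (n, A)) \<le> e" if nA: "(n, A) \<in> mat_points R" for n A
  proof -
    have "d (n, A) = h (n, A) - k (n, A)"
      using nA calA_carrier[OF h nA] calA_carrier[OF k nA]
      by (intro eq_matI) (auto simp: d_def calA_add_def calA_scale_def)
    then show ?thesis using le[OF nA] by simp
  qed
  have step: "ereal (micro_pressure R n k) \<le> ereal (micro_pressure R n h) + ereal e" if n: "1 \<le> n" for n
  proof -
    have "gibbs_state R n k d = gibbs_state R n k h - gibbs_state R n k k"
      unfolding d_def using gibbs_state_add[OF R n k h calA_scale_closed[OF R0 k]] gibbs_state_scale[OF R n k] by simp
    moreover have "Re (gibbs_state R n k d) \<le> e"
      using cmod_gibbs_state_le[OF R n k d de] complex_Re_le_cmod[of "gibbs_state R n k d"] by simp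
    ultimately show ?thesis using gibbs_variational[OF R n k h] by simp
  qed
  have "free_pressure R k \<le> limsup (\<lambda>n. ereal (micro_pressure R n h) + ereal e)"
    unfolding free_pressure_eq_limsup[OF R]
    by (rule Limsup_mono) (use eventually_ge_at_top[of 1] in eventually_elim, rule step)
  also have "\<dots> = free_pressure R h + ereal e"
    unfolding free_pressure_eq_limsup[OF R] by (rule Limsup_add_ereal_right) simp_all
  finally show ?thesis .
qed

section \<open>The Legendre transform over the completion and its inverse\<close>

lemma nc_embed_calA_sa:
  fixes p :: "'v ncpoly"
  assumes R: "0 \<le> R" and p: "p \<in> nc_sa"
  shows "nc_embed R p \<in> calA_sa R"
  using nc_embed_calA[OF R, of p] nc_embed_star[of R p] p by (simp add: calA_sa_def nc_sa_def)

text \<open>Polynomials form a smaller index set, so one inequality is monotonicity of infima. For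
  the other, replacing h by a nearby selfadjoint polynomial changes the state value and the pressure
  only slightly.\<close>

lemma eta_eq_INF_calA_sa:
  fixes \<mu> :: "'v::finite cstar_elem \<Rightarrow> complex"
  assumes R: "0 < R" and \<mu>: "\<mu> \<in> tracial_states R"
  shows "eta R (nc_restrict R \<mu>) = (INF h\<in>calA_sa R. ereal (Re (\<mu> h)) + free_pressure R h)"
proof (rule antisym)
  note R0 = less_imp_le[OF R]
  show "(INF h\<in>calA_sa R. ereal (Re (\<mu> h)) + free_pressure R h) \<le> eta R (nc_restrict R \<mu>)"
    unfolding eta_def nc_restrict_def
    by (rule INF_greatest) (rule INF_lower[OF nc_embed_calA_sa[OF R0]])
  show "eta R (nc_restrict R \<mu>) \<le> (INF h\<in>calA_sa R. ereal (Re (\<mu> h)) + free_pressure R h)"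
  proof (rule INF_greatest)
    fix h :: "'v cstar_elem" assume h: "h \<in> calA_sa R"
    then have hA: "h \<in> calA R" by (simp add: calA_sa_def)
    show "eta R (nc_restrict R \<mu>) \<le> ereal (Re (\<mu> h)) + free_pressure R h"
    proof (rule ereal_le_epsilon2)
      fix e :: real assume "0 < e"
      \<comment> \<open>Of the three shares, two pay for the state, whose continuity estimate
        carries a factor 2, and one pays for the pressure.\<close>
      then have e: "0 < e / 3" by simp
      obtain p where p: "p \<in> nc_sa"
        and le: "\<And>n A. (n, A) \<in> mat_points R \<Longrightarrow> op_norm (h (n, A) - nc_eval n p A) \<le> e / 3"
        using nc_sa_approx[OF R0 h e] by blast
      let ?p = "nc_embed R p"
      have pA: "?p \<in> calA R" by (rule nc_embed_calA[OF R0])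
      have eval: "?p (n, A) = nc_eval n p A" if "(n, A) \<in> mat_points R" for n A
        using that by (simp add: nc_embed_def)
      have diff: "op_norm (h (n, A) - ?p (n, A)) \<le> e / 3" if "(n, A) \<in> mat_points R" for n A
        using le[OF that] by (simp add: eval[OF that])
      define d where "d = calA_add R ?p (calA_scale R (-1) h)"
      have dA: "d \<in> calA R" unfolding d_def by (intro calA_add_closed calA_scale_closed R0 hA pA)
      have deval: "d (n, A) = ?p (n, A) - h (n, A)" if nA: "(n, A) \<in> mat_points R" for n A
        using nA calA_carrier[OF hA nA] calA_carrier[OF pA nA]
        by (intro eq_matI) (auto simp: d_def calA_add_def calA_scale_def)
      have d: "d \<in> calA_sa R"
        by (rule calA_saI[OF dA]) (simp add: deval mat_adjoint_minus[OF calA_carrier[OF pA] calA_carrier[OF hA]]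
            calA_sa_adjoint[OF h] calA_sa_adjoint[OF nc_embed_calA_sa[OF R0 p]])
      have "op_norm (d (n, A)) \<le> e / 3" if nA: "(n, A) \<in> mat_points R" for n A
        using diff[OF nA] op_norm_minus_commute[OF calA_carrier[OF hA nA] calA_carrier[OF pA nA]]
        by (simp add: deval[OF nA])
      then have "Re (\<mu> d) \<le> 2 * (e / 3)" by (rule tracial_state_Re_le[OF R0 \<mu> d e])
      moreover have "\<mu> d = \<mu> ?p - \<mu> h"
        using \<mu> hA pA calA_scale_closed[OF R0 hA, of "-1"] by (simp add: d_def tracial_states_def)
      ultimately have "Re (\<mu> ?p) \<le> Re (\<mu> h) + 2 * (e / 3)" by simp
      then have 1: "ereal (Re (\<mu> ?p)) \<le> ereal (Re (\<mu> h)) + ereal (2 * (e / 3))" by simp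
      have 2: "free_pressure R ?p \<le> free_pressure R h + ereal (e / 3)"
        by (rule free_pressure_le_add[OF R hA pA diff])
      have "eta R (nc_restrict R \<mu>) \<le> ereal (Re (\<mu> ?p)) + free_pressure R ?p"
        unfolding eta_def nc_restrict_def by (rule INF_lower[OF p])
      also have "\<dots> \<le> (ereal (Re (\<mu> h)) + ereal (2 * (e / 3))) + (free_pressure R h + ereal (e / 3))"
        by (rule add_mono[OF 1 2])
      also have "\<dots> = ereal (Re (\<mu> h)) + free_pressure R h + ereal e"
        by (cases "free_pressure R h") (simp_all add: field_simps)
      finally show "eta R (nc_restrict R \<mu>) \<le> ereal (Re (\<mu> h)) + free_pressure R h + ereal e" .
    qed
  qed
qed

text \<open>Each term of the infimum is affine in the functional, so the inequality is checked for
  one polynomial at a time.\<close>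

lemma eta_concave:
  fixes \<mu> \<nu> :: "'v::finite cstar_elem \<Rightarrow> complex"
  assumes R: "0 \<le> R" and t: "0 \<le> t" "t \<le> 1"
  shows "ereal t * eta R (nc_restrict R \<mu>) + ereal (1 - t) * eta R (nc_restrict R \<nu>)
    \<le> eta R (nc_restrict R (state_convex_comb R t \<mu> \<nu>))"
proof -
  have "ereal t * eta R (nc_restrict R \<mu>) + ereal (1 - t) * eta R (nc_restrict R \<nu>)
      \<le> ereal (Re (nc_restrict R (state_convex_comb R t \<mu> \<nu>) p)) + free_pressure R (nc_embed R p)"
    if p: "p \<in> nc_sa" for p
  proof -
    let ?\<pi> = "free_pressure R (nc_embed R p)"
    let ?a = "Re (nc_restrict R \<mu> p)" and ?b = "Re (nc_restrict R \<nu> p)"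
    have "ereal t * eta R (nc_restrict R \<mu>) \<le> ereal t * (ereal ?a + ?\<pi>)"
      unfolding eta_def using t by (intro ereal_mult_left_mono INF_lower[OF p]) simp
    moreover have "ereal (1 - t) * eta R (nc_restrict R \<nu>) \<le> ereal (1 - t) * (ereal ?b + ?\<pi>)"
      unfolding eta_def using t by (intro ereal_mult_left_mono INF_lower[OF p]) simp
    ultimately have "ereal t * eta R (nc_restrict R \<mu>) + ereal (1 - t) * eta R (nc_restrict R \<nu>)
        \<le> ereal t * (ereal ?a + ?\<pi>) + ereal (1 - t) * (ereal ?b + ?\<pi>)"
      by (rule add_mono)
    \<comment> \<open>The end points t = 0 and t = 1 are separated because 0 times an infinite value
      is 0 in the extended reals.\<close>
    also have "\<dots> \<le> ereal (t * ?a + (1 - t) * ?b) + ?\<pi>"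
      using t by (cases ?\<pi>; cases "t = 0"; cases "t = 1") (auto simp: algebra_simps)
    also have "t * ?a + (1 - t) * ?b = Re (nc_restrict R (state_convex_comb R t \<mu> \<nu>) p)"
      using nc_embed_calA[OF R, of p] by (simp add: nc_restrict_def state_convex_comb_def)
    finally show ?thesis .
  qed
  then show ?thesis unfolding eta_def[of R "nc_restrict R (state_convex_comb R t \<mu> \<nu>)"] by (rule INF_greatest)
qed

text \<open>An infimum is below c exactly when one of its terms is, so the sublevel set is a union
  of sets, each open because evaluation at one polynomial is weak* continuous.\<close>

lemma eta_upper_semicontinuous:
  assumes R: "0 \<le> R"
  shows "upper_semicontinuous_map (weak_star R :: ('v::finite cstar_elem \<Rightarrow> complex) topology)
    (\<lambda>\<mu>. eta R (nc_restrict R \<mu>))"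
  unfolding upper_semicontinuous_map_def
proof
  fix c :: ereal
  let ?X = "weak_star R :: ('v cstar_elem \<Rightarrow> complex) topology"
  let ?U = "\<lambda>p. {\<mu> \<in> topspace ?X. ereal (Re (\<mu> (nc_embed R p))) + free_pressure R (nc_embed R p) < c}"
  have "openin ?X (?U p)" for p
  proof -
    have cont: "continuous_map ?X euclidean (\<lambda>\<mu>. \<mu> (nc_embed R p))"
      unfolding weak_star_def
      by (intro continuous_map_from_subtopology continuous_map_product_projection nc_embed_calA R)
    have "open {z. ereal (Re z) + free_pressure R (nc_embed R p) < c}"
    \<comment> \<open>For an infinite pressure the condition does not depend on z, and the set is
      empty or everything.\<close>
    proof (cases "free_pressure R (nc_embed R p)")
      case (real x)
      have "{z. ereal (Re z) + ereal x < c} = {z. ereal (Re z + x) < c}" by simp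
      also have "open \<dots>"
        by (intro open_Collect_less continuous_intros)
      finally show ?thesis using real by simp
    qed auto
    then have "openin ?X {\<mu> \<in> topspace ?X. \<mu> (nc_embed R p) \<in> {z. ereal (Re z) + free_pressure R (nc_embed R p) < c}}"
      by (intro openin_continuous_map_preimage[OF cont]) simp
    then show ?thesis by simp
  qed
  then have "openin ?X (\<Union>p\<in>nc_sa. ?U p)" by blast
  also have "(\<Union>p\<in>nc_sa. ?U p) = {\<mu> \<in> topspace ?X. eta R (nc_restrict R \<mu>) < c}"
    unfolding eta_def nc_restrict_def INF_less_iff by blast
  finally show "openin ?X {\<mu> \<in> topspace ?X. eta R (nc_restrict R \<mu>) < c}" .
qed

text \<open>The upper bound is Young's inequality, the term k = h of the infimum over the whole
  algebra. For the lower bound, the tangent state at h says that this infimum is attained at k =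
  h.\<close>

lemma free_pressure_eq_SUP:
  fixes h :: "'v::finite cstar_elem"
  assumes R: "0 < R" and h: "h \<in> calA_sa R"
  shows "free_pressure R h = (SUP \<mu>\<in>tracial_states R. ereal (- Re (\<mu> h)) + eta R (nc_restrict R \<mu>))"
proof (rule antisym)
  have hA: "h \<in> calA R" using h by (simp add: calA_sa_def)
  obtain \<mu> where \<mu>: "\<mu> \<in> tracial_states R"
    and tangent: "\<And>k. k \<in> calA R \<Longrightarrow> free_pressure R h + ereal (Re (\<mu> h) - Re (\<mu> k)) \<le> free_pressure R k"
    using free_pressure_tangent_state[OF R hA] by blast
  have "ereal (Re (\<mu> h)) + free_pressure R h \<le> eta R (nc_restrict R \<mu>)"
    unfolding eta_eq_INF_calA_sa[OF R \<mu>]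
  proof (rule INF_greatest)
    fix k :: "'v cstar_elem" assume "k \<in> calA_sa R"
    then have k: "k \<in> calA R" by (simp add: calA_sa_def)
    \<comment> \<open>Adding and subtracting the real number Re (\<mu> k) is harmless for finite and
      infinite pressure alike, whence the case split.\<close>
    have "ereal (Re (\<mu> h)) + free_pressure R h = ereal (Re (\<mu> k)) + (free_pressure R h + ereal (Re (\<mu> h) - Re (\<mu> k)))"
      by (cases "free_pressure R h") simp_all
    also have "\<dots> \<le> ereal (Re (\<mu> k)) + free_pressure R k"
      by (intro add_left_mono tangent k)
    finally show "ereal (Re (\<mu> h)) + free_pressure R h \<le> ereal (Re (\<mu> k)) + free_pressure R k" .
  qed
  then have "ereal (- Re (\<mu> h)) + (ereal (Re (\<mu> h)) + free_pressure R h) \<le> ereal (- Re (\<mu> h)) + eta R (nc_restrict R \<mu>)"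
    by (rule add_left_mono)
  also have "ereal (- Re (\<mu> h)) + (ereal (Re (\<mu> h)) + free_pressure R h) = free_pressure R h"
    by (cases "free_pressure R h") simp_all
  also have "ereal (- Re (\<mu> h)) + eta R (nc_restrict R \<mu>) \<le>
      (SUP \<mu>\<in>tracial_states R. ereal (- Re (\<mu> h)) + eta R (nc_restrict R \<mu>))"
    by (rule SUP_upper[OF \<mu>])
  finally show "free_pressure R h \<le> (SUP \<mu>\<in>tracial_states R. ereal (- Re (\<mu> h)) + eta R (nc_restrict R \<mu>))" .
next
  show "(SUP \<mu>\<in>tracial_states R. ereal (- Re (\<mu> h)) + eta R (nc_restrict R \<mu>)) \<le> free_pressure R h"
  proof (rule SUP_least)
    fix \<mu> :: "'v cstar_elem \<Rightarrow> complex" assume \<mu>: "\<mu> \<in> tracial_states R"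
    have "ereal (- Re (\<mu> h)) + eta R (nc_restrict R \<mu>) \<le> ereal (- Re (\<mu> h)) + (ereal (Re (\<mu> h)) + free_pressure R h)"
      unfolding eta_eq_INF_calA_sa[OF R \<mu>] by (intro add_left_mono INF_lower h)
    also have "\<dots> = free_pressure R h" by (cases "free_pressure R h") simp_all
    finally show "ereal (- Re (\<mu> h)) + eta R (nc_restrict R \<mu>) \<le> free_pressure R h" .
  qed
qed

theorem theorem3p4:
  fixes R :: real
  assumes "R > 0"
  shows
    "(\<forall>\<mu> \<in> (tracial_states R :: ('v::finite cstar_elem \<Rightarrow> complex) set).
        eta R (nc_restrict R \<mu>) = (INF h\<in>calA_sa R. ereal (Re (\<mu> h)) + free_pressure R h))
   \<and> (\<forall>\<mu> \<in> (tracial_states R :: ('v cstar_elem \<Rightarrow> complex) set). \<forall>\<nu> \<in> tracial_states R.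
        \<forall>t\<in>{0..1}. ereal t * eta R (nc_restrict R \<mu>) + ereal (1 - t) * eta R (nc_restrict R \<nu>)
          \<le> eta R (nc_restrict R (state_convex_comb R t \<mu> \<nu>)))
   \<and> upper_semicontinuous_map (weak_star R :: ('v cstar_elem \<Rightarrow> complex) topology)
        (\<lambda>\<mu>. eta R (nc_restrict R \<mu>))
   \<and> (\<forall>h \<in> (calA_sa R :: 'v cstar_elem set).
        free_pressure R h = (SUP \<mu>\<in>tracial_states R. ereal (- Re (\<mu> h)) + eta R (nc_restrict R \<mu>)))"
proof (intro conjI ballI)
  fix t :: real and \<mu> \<nu> :: "'v cstar_elem \<Rightarrow> complex"
  assume "t \<in> {0..1}"
  then show "ereal t * eta R (nc_restrict R \<mu>) + ereal (1 - t) * eta R (nc_restrict R \<nu>)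
      \<le> eta R (nc_restrict R (state_convex_comb R t \<mu> \<nu>))"
    using assms by (intro eta_concave) auto
qed (use assms in \<open>auto intro: eta_eq_INF_calA_sa eta_upper_semicontinuous free_pressure_eq_SUP\<close>)

end
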